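(* Let $f\colon X\to Y$ be a quasi-isomorphism between schematic finite spaces and assume that $Y$ is $T_0$. Consider the affine open covering $\{f^{-1}(U_y)\}_{y\in Y}$ of $X$ and let $X/\!\sim$ be the schematic finite space associated with this covering. Then there is a set $P$ of removable points of $Y$ such that $f$ is the composition of the quotient morphism $\pi\colon X\to X/\!\sim$ with an isomorphism of ringed spaces $f'\colon X/\!\sim\;\to Y\setminus P$, $f'([x])=f(x)$ (followed by the inclusion $Y\setminus P\hookrightarrow Y$). Therefore, if $f\colon X\to Y$ is a quasi-isomorphism and $Y$ is minimal, then $f$ is the composition of the quotient morphism $X\to X/\!\sim$ and an isomorphism $X/\!\sim\;\simeq Y$.
   Context: A finite ringed space is a ringed space $(X,\mathcal O)$ (sheaf of commutative rings with unit) whose underlying topological space $X$ is finite. For $x\in X$, $U_x$ denotes the smallest open subset containing $x$; write $x\le y$ iff $U_y\subseteq U_x$, so $U_x=\{y: y\ge x\}$. The stalk is $\mathcal O_x=\mathcal O(U_x)$. Put $U_{xy}:=U_x\cap U_y$ and $\mathcal O_{xy}:=\mathcal O(U_{xy})$. An $\mathcal O$-module is quasi-coherent if locally it is the cokernel of a morphism between (arbitrary) free modules. A finite ringed space $(X,\mathcal O)$ is affine if: (i) $\mathcal O(X)\to\prod_{x\in X}\mathcal O_x$ is faithfully flat; (ii) the natural morphism $\mathcal O_x\otimes_{\mathcal O(X)}\mathcal O_y\to\mathcal O_{xy}$ is an isomorphism for all $x,y\in X$; (iii) $\mathcal O_{xy}\to\prod_{z\in U_{xy}}\mathcal O_z$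 is faithfully flat for all $x,y\in X$ (an empty product is the zero ring). A finite ringed space is schematic (a schematic finite space) if it has an open covering by affine finite spaces. A morphism of ringed spaces $f\colon X\to Y$ between schematic finite spaces is affine if $f_*\mathcal O_X$ is a quasi-coherent $\mathcal O_Y$-module and the preimage of every affine open subspace of $Y$ is an affine open subspace of $X$. It is schematic if for every $x\in X$ the morphism $U_x\to U_{f(x)}$, $x'\mapsto f(x')$, is affine. A schematic morphism $f$ is a quasi-isomorphism if it is affine and $f_*\mathcal O_X=\mathcal O_Y$ (i.e. $\mathcal O_Y\to f_*\mathcal O_X$ is an isomorphism). Finite ringed space associated with a finite open covering $\{V_i\}$ of a ringed space $(X,\mathcal O_X)$: for $x\in X$ put $V_x:=\bigcap_{x\in V_i}V_i$; let $x\sim x'$ iff $V_x=V_{x'}$; $X/\!\sim$ is the quotient, with the topology given by the partial order $[x]\le[x']$ iff $V_{x'}\subseteq V_x$; $\pi\colon X\to X/\!\sim$ is the quotient map and the sheaf of rings is $\pi_*\mathcal O_X$, so $\mathcal O_{[x]}=\mathcal O_X(V_x)$. A point $p$ of a schematic finite space $Y$ is removable if $\mathcal O_p\to\prod_{q>p}\mathcal O_q$ is faithfully flat (the product is $0$ if there is no $q>p$). For $P\subseteq Y$, $Y\setminus P$ is regarded as a ringed space with the subspace topology (induced order) and $\mathcal O_{Y\setminus P,y}:=\mathcal O_{Y,y}$. A schematic finite space is minimal if it is $T_0$ and has no removable points. *)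

theory Defs
  imports
    "HOL-Analysis.Abstract_Topological_Spaces"
    "HOL-Algebra.QuotRing"
    "HOL-Algebra.Module"
begin

section \<open>Modules, tensor products and faithful flatness\<close>

definition module_hom ::
  "'r ring \<Rightarrow> ('r, 'm) module \<Rightarrow> ('r, 'n) module \<Rightarrow> ('m \<Rightarrow> 'n) set" where
  "module_hom A M N =
    {h. h \<in> carrier M \<rightarrow> carrier N \<and>
        (\<forall>m\<in>carrier M. \<forall>m'\<in>carrier M. h (m \<oplus>\<^bsub>M\<^esub> m') = h m \<oplus>\<^bsub>N\<^esub> h m') \<and>
        (\<forall>a\<in>carrier A. \<forall>m\<in>carrier M. h (a \<odot>\<^bsub>M\<^esub> m) = a \<odot>\<^bsub>N\<^esub> h m)}"

definition exact ::
  "('r, 'l) module \<Rightarrow> ('r, 'm) module \<Rightarrow> ('r, 'n) module \<Rightarrow> ('l \<Rightarrow> 'm) \<Rightarrow> ('m \<Rightarrow> 'n) \<Rightarrow> bool" where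
  "exact M1 M2 M3 g h \<longleftrightarrow> g ` carrier M1 = {m \<in> carrier M2. h m = \<zero>\<^bsub>M3\<^esub>}"

text \<open>The library's record of modules extends that of rings; for the modules below its
  multiplicative components play no role and are left undefined.\<close>

definition free_module :: "'r ring \<Rightarrow> 'j set \<Rightarrow> ('r, 'j \<Rightarrow> 'r) module" where
  "free_module A J =
    \<lparr>carrier = {c \<in> J \<rightarrow>\<^sub>E carrier A. finite {j \<in> J. c j \<noteq> \<zero>\<^bsub>A\<^esub>}},
     mult = undefined, one = undefined,
     zero = (\<lambda>j\<in>J. \<zero>\<^bsub>A\<^esub>),
     add = (\<lambda>c d. \<lambda>j\<in>J. c j \<oplus>\<^bsub>A\<^esub> d j),
     smult = (\<lambda>a c. \<lambda>j\<in>J. a \<otimes>\<^bsub>A\<^esub> c j)\<rparr>"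

definition basis_vector :: "'r ring \<Rightarrow> 'j set \<Rightarrow> 'j \<Rightarrow> 'j \<Rightarrow> 'r" where
  "basis_vector A J j = (\<lambda>i\<in>J. if i = j then \<one>\<^bsub>A\<^esub> else \<zero>\<^bsub>A\<^esub>)"

definition submodule_span :: "'r ring \<Rightarrow> ('r, 'm) module \<Rightarrow> 'm set \<Rightarrow> 'm set" where
  "submodule_span A M S = \<Inter>{H. submodule H A M \<and> S \<subseteq> H}"

definition quotient_module :: "('r, 'm) module \<Rightarrow> 'm set \<Rightarrow> ('r, 'm set) module" where
  "quotient_module M H =
    \<lparr>carrier = a_rcosets\<^bsub>M\<^esub> H,
     mult = undefined, one = undefined,
     zero = H,
     add = set_add M,
     smult = (\<lambda>a C. \<Union>c\<in>C. H +>\<^bsub>M\<^esub> (a \<odot>\<^bsub>M\<^esub> c))\<rparr>"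

definition bilinear_relations ::
  "'r ring \<Rightarrow> ('r, 'm) module \<Rightarrow> ('r, 'n) module \<Rightarrow> ('m \<times> 'n \<Rightarrow> 'r) set" where
  "bilinear_relations A M N =
    (let J = carrier M \<times> carrier N; F = free_module A J; e = (\<lambda>m n. basis_vector A J (m, n)) in
      {e (m \<oplus>\<^bsub>M\<^esub> m') n \<ominus>\<^bsub>F\<^esub> (e m n \<oplus>\<^bsub>F\<^esub> e m' n) | m m' n.
         m \<in> carrier M \<and> m' \<in> carrier M \<and> n \<in> carrier N} \<union>
      {e m (n \<oplus>\<^bsub>N\<^esub> n') \<ominus>\<^bsub>F\<^esub> (e m n \<oplus>\<^bsub>F\<^esub> e m n') | m n n'.
         m \<in> carrier M \<and> n \<in> carrier N \<and> n' \<in> carrier N} \<union>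
      {e (a \<odot>\<^bsub>M\<^esub> m) n \<ominus>\<^bsub>F\<^esub> (a \<odot>\<^bsub>F\<^esub> e m n) | a m n.
         a \<in> carrier A \<and> m \<in> carrier M \<and> n \<in> carrier N} \<union>
      {e m (a \<odot>\<^bsub>N\<^esub> n) \<ominus>\<^bsub>F\<^esub> (a \<odot>\<^bsub>F\<^esub> e m n) | a m n.
         a \<in> carrier A \<and> m \<in> carrier M \<and> n \<in> carrier N})"

definition tensor_kernel ::
  "'r ring \<Rightarrow> ('r, 'm) module \<Rightarrow> ('r, 'n) module \<Rightarrow> ('m \<times> 'n \<Rightarrow> 'r) set" where
  "tensor_kernel A M N =
    submodule_span A (free_module A (carrier M \<times> carrier N)) (bilinear_relations A M N)"

definition tensor ::
  "'r ring \<Rightarrow> ('r, 'm) module \<Rightarrow> ('r, 'n) module \<Rightarrow> ('r, ('m \<times> 'n \<Rightarrow> 'r) set) module" where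
  "tensor A M N =
    quotient_module (free_module A (carrier M \<times> carrier N)) (tensor_kernel A M N)"

definition pure_tensor ::
  "'r ring \<Rightarrow> ('r, 'm) module \<Rightarrow> ('r, 'n) module \<Rightarrow> 'm \<Rightarrow> 'n \<Rightarrow> ('m \<times> 'n \<Rightarrow> 'r) set" where
  "pure_tensor A M N m n =
    tensor_kernel A M N +>\<^bsub>free_module A (carrier M \<times> carrier N)\<^esub>
      basis_vector A (carrier M \<times> carrier N) (m, n)"

text \<open>The linear map on \<open>M \<otimes> N\<close> induced by a bilinear map \<open>\<beta>\<close> into \<open>P\<close>: for bilinear \<open>\<beta>\<close> the sum
  below takes the same value at all representatives of a coset.\<close>

definition tensor_lift ::
  "'r ring \<Rightarrow> ('r, 'm) module \<Rightarrow> ('r, 'n) module \<Rightarrow> ('r, 'p) module \<Rightarrow> ('m \<Rightarrow> 'n \<Rightarrow> 'p) \<Rightarrow>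
    ('m \<times> 'n \<Rightarrow> 'r) set \<Rightarrow> 'p" where
  "tensor_lift A M N P \<beta> C =
    the_elem ((\<lambda>c. \<Oplus>\<^bsub>P\<^esub>q\<in>{q \<in> carrier M \<times> carrier N. c q \<noteq> \<zero>\<^bsub>A\<^esub>}.
                 c q \<odot>\<^bsub>P\<^esub> \<beta> (fst q) (snd q)) ` C)"

definition tensor_map ::
  "'r ring \<Rightarrow> ('r, 'm) module \<Rightarrow> ('r, 'k) module \<Rightarrow> ('r, 'n) module \<Rightarrow> ('m \<Rightarrow> 'k) \<Rightarrow>
    ('m \<times> 'n \<Rightarrow> 'r) set \<Rightarrow> ('k \<times> 'n \<Rightarrow> 'r) set" where
  "tensor_map A M M' N g =
    tensor_lift A M N (tensor A M' N) (\<lambda>m n. pure_tensor A M' N (g m) n)"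

text \<open>A definition cannot quantify over all types, so the test modules have their carrier in
  \<open>(nat \<Rightarrow> 'r) set\<close>. Every countably generated module over a ring with elements in \<open>'r\<close> is
  isomorphic to such a module (a quotient of a countable free module consists of cosets), and so
  is every submodule of one; flatness and faithful flatness are detected on these.\<close>

definition flat :: "'r ring \<Rightarrow> ('r, 'n) module \<Rightarrow> bool" where
  "flat A N \<longleftrightarrow>
    (\<forall>(M1 :: ('r, (nat \<Rightarrow> 'r) set) module) (M2 :: ('r, (nat \<Rightarrow> 'r) set) module)
       (M3 :: ('r, (nat \<Rightarrow> 'r) set) module) g h.
       Module.module A M1 \<and> Module.module A M2 \<and> Module.module A M3 \<and>
       g \<in> module_hom A M1 M2 \<and> h \<in> module_hom A M2 M3 \<and> exact M1 M2 M3 g h \<longrightarrow>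
       exact (tensor A M1 N) (tensor A M2 N) (tensor A M3 N)
         (tensor_map A M1 M2 N g) (tensor_map A M2 M3 N h))"

definition faithfully_flat :: "'r ring \<Rightarrow> ('r, 'n) module \<Rightarrow> bool" where
  "faithfully_flat A N \<longleftrightarrow>
    flat A N \<and>
    (\<forall>M :: ('r, (nat \<Rightarrow> 'r) set) module. Module.module A M \<and>
       carrier (tensor A M N) = {\<zero>\<^bsub>tensor A M N\<^esub>} \<longrightarrow> carrier M = {\<zero>\<^bsub>M\<^esub>})"

definition module_along :: "('r \<Rightarrow> 's) \<Rightarrow> 's ring \<Rightarrow> ('r, 's) module" where
  "module_along \<phi> B =
    \<lparr>carrier = carrier B, mult = mult B, one = one B, zero = zero B, add = add B,
     smult = (\<lambda>a b. \<phi> a \<otimes>\<^bsub>B\<^esub> b)\<rparr>"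

definition faithfully_flat_hom :: "'r ring \<Rightarrow> 's ring \<Rightarrow> ('r \<Rightarrow> 's) \<Rightarrow> bool" where
  "faithfully_flat_hom A B \<phi> \<longleftrightarrow> \<phi> \<in> ring_hom A B \<and> faithfully_flat A (module_along \<phi> B)"

definition product_ring :: "'i set \<Rightarrow> ('i \<Rightarrow> 'r ring) \<Rightarrow> ('i \<Rightarrow> 'r) ring" where
  "product_ring I R =
    \<lparr>carrier = (\<Pi>\<^sub>E i\<in>I. carrier (R i)),
     mult = (\<lambda>s t. \<lambda>i\<in>I. s i \<otimes>\<^bsub>R i\<^esub> t i),
     one = (\<lambda>i\<in>I. \<one>\<^bsub>R i\<^esub>),
     zero = (\<lambda>i\<in>I. \<zero>\<^bsub>R i\<^esub>),
     add = (\<lambda>s t. \<lambda>i\<in>I. s i \<oplus>\<^bsub>R i\<^esub> t i)\<rparr>"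


section \<open>Ringed spaces and their morphisms\<close>

definition is_sheaf ::
  "'a topology \<Rightarrow> ('a set \<Rightarrow> 's set) \<Rightarrow> ('a set \<Rightarrow> 'a set \<Rightarrow> 's \<Rightarrow> 's) \<Rightarrow> bool" where
  "is_sheaf T F \<rho> \<longleftrightarrow>
    (\<forall>U V. openin T U \<and> openin T V \<and> V \<subseteq> U \<longrightarrow> \<rho> U V \<in> F U \<rightarrow> F V) \<and>
    (\<forall>U. openin T U \<longrightarrow> (\<forall>s\<in>F U. \<rho> U U s = s)) \<and>
    (\<forall>U V W. openin T U \<and> openin T V \<and> openin T W \<and> W \<subseteq> V \<and> V \<subseteq> U \<longrightarrow>
       (\<forall>s\<in>F U. \<rho> V W (\<rho> U V s) = \<rho> U W s)) \<and>
    (\<forall>\<U>. (\<forall>V\<in>\<U>. openin T V) \<longrightarrow>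
       (\<forall>s\<in>F (\<Union>\<U>). \<forall>t\<in>F (\<Union>\<U>). (\<forall>V\<in>\<U>. \<rho> (\<Union>\<U>) V s = \<rho> (\<Union>\<U>) V t) \<longrightarrow> s = t)) \<and>
    (\<forall>\<U> s. (\<forall>V\<in>\<U>. openin T V) \<and> (\<forall>V\<in>\<U>. s V \<in> F V) \<and>
       (\<forall>V\<in>\<U>. \<forall>W\<in>\<U>. \<rho> V (V \<inter> W) (s V) = \<rho> W (V \<inter> W) (s W)) \<longrightarrow>
       (\<exists>t\<in>F (\<Union>\<U>). \<forall>V\<in>\<U>. \<rho> (\<Union>\<U>) V t = s V))"

record ('a, 'r) ringed_space =
  rs_top :: "'a topology"
  sec :: "'a set \<Rightarrow> 'r ring"
  res :: "'a set \<Rightarrow> 'a set \<Rightarrow> 'r \<Rightarrow> 'r"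

abbreviation points :: "('a, 'r) ringed_space \<Rightarrow> 'a set" where
  "points X \<equiv> topspace (rs_top X)"

definition is_ringed_space :: "('a, 'r) ringed_space \<Rightarrow> bool" where
  "is_ringed_space X \<longleftrightarrow>
    (\<forall>U. openin (rs_top X) U \<longrightarrow> cring (sec X U)) \<and>
    (\<forall>U V. openin (rs_top X) U \<and> openin (rs_top X) V \<and> V \<subseteq> U \<longrightarrow>
       res X U V \<in> ring_hom (sec X U) (sec X V)) \<and>
    is_sheaf (rs_top X) (\<lambda>U. carrier (sec X U)) (res X)"

definition finite_ringed_space :: "('a, 'r) ringed_space \<Rightarrow> bool" where
  "finite_ringed_space X \<longleftrightarrow> is_ringed_space X \<and> finite (points X)"

definition open_subspace :: "('a, 'r) ringed_space \<Rightarrow> 'a set \<Rightarrow> ('a, 'r) ringed_space" where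
  "open_subspace X U = \<lparr>rs_top = subtopology (rs_top X) U, sec = sec X, res = res X\<rparr>"

record ('a, 'r, 'b, 's) rs_map =
  pmap :: "'a \<Rightarrow> 'b"
  comap :: "'b set \<Rightarrow> 's \<Rightarrow> 'r"

definition preim :: "('a, 'r) ringed_space \<Rightarrow> ('a \<Rightarrow> 'b) \<Rightarrow> 'b set \<Rightarrow> 'a set" where
  "preim X f V = {x \<in> points X. f x \<in> V}"

definition rs_morphism ::
  "('a, 'r) ringed_space \<Rightarrow> ('b, 's) ringed_space \<Rightarrow> ('a, 'r, 'b, 's) rs_map \<Rightarrow> bool" where
  "rs_morphism X Y f \<longleftrightarrow>
    continuous_map (rs_top X) (rs_top Y) (pmap f) \<and>
    (\<forall>V. openin (rs_top Y) V \<longrightarrow>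
       comap f V \<in> ring_hom (sec Y V) (sec X (preim X (pmap f) V))) \<and>
    (\<forall>V W. openin (rs_top Y) V \<and> openin (rs_top Y) W \<and> W \<subseteq> V \<longrightarrow>
       (\<forall>s\<in>carrier (sec Y V). comap f W (res Y V W s) =
          res X (preim X (pmap f) V) (preim X (pmap f) W) (comap f V s)))"

text \<open>Composite of \<open>f\<close> with \<open>g\<close>, where \<open>Y\<close> is the source of \<open>g\<close>.\<close>

definition rs_comp ::
  "('b, 's) ringed_space \<Rightarrow> ('b, 's, 'c, 't) rs_map \<Rightarrow> ('a, 'r, 'b, 's) rs_map \<Rightarrow>
    ('a, 'r, 'c, 't) rs_map" where
  "rs_comp Y g f =
    \<lparr>pmap = pmap g \<circ> pmap f,
     comap = (\<lambda>W s. comap f (preim Y (pmap g) W) (comap g W s))\<rparr>"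

text \<open>Equality of morphisms \<open>X \<rightarrow> Y\<close>; values outside the relevant domains are irrelevant.\<close>

definition rs_map_eq ::
  "('a, 'r) ringed_space \<Rightarrow> ('b, 's) ringed_space \<Rightarrow>
    ('a, 'r, 'b, 's) rs_map \<Rightarrow> ('a, 'r, 'b, 's) rs_map \<Rightarrow> bool" where
  "rs_map_eq X Y f g \<longleftrightarrow>
    (\<forall>x\<in>points X. pmap f x = pmap g x) \<and>
    (\<forall>V. openin (rs_top Y) V \<longrightarrow> (\<forall>s\<in>carrier (sec Y V). comap f V s = comap g V s))"

definition rs_isomorphism ::
  "('a, 'r) ringed_space \<Rightarrow> ('b, 's) ringed_space \<Rightarrow> ('a, 'r, 'b, 's) rs_map \<Rightarrow> bool" where
  "rs_isomorphism X Y f \<longleftrightarrow>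
    rs_morphism X Y f \<and>
    homeomorphic_map (rs_top X) (rs_top Y) (pmap f) \<and>
    (\<forall>V. openin (rs_top Y) V \<longrightarrow>
       comap f V \<in> ring_iso (sec Y V) (sec X (preim X (pmap f) V)))"

definition restrict_map ::
  "('a, 'r) ringed_space \<Rightarrow> 'a set \<Rightarrow> ('a, 'r, 'b, 's) rs_map \<Rightarrow> ('a, 'r, 'b, 's) rs_map" where
  "restrict_map X U f =
    \<lparr>pmap = pmap f,
     comap = (\<lambda>V s. res X (preim X (pmap f) V) (preim X (pmap f) V \<inter> U) (comap f V s))\<rparr>"


section \<open>Quasi-coherent modules\<close>

record ('a, 'r, 'm) module_sheaf =
  msec :: "'a set \<Rightarrow> ('r, 'm) module"
  mres :: "'a set \<Rightarrow> 'a set \<Rightarrow> 'm \<Rightarrow> 'm"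

definition is_module_sheaf ::
  "('a, 'r) ringed_space \<Rightarrow> ('a, 'r, 'm) module_sheaf \<Rightarrow> bool" where
  "is_module_sheaf X M \<longleftrightarrow>
    (\<forall>U. openin (rs_top X) U \<longrightarrow> Module.module (sec X U) (msec M U)) \<and>
    (\<forall>U V. openin (rs_top X) U \<and> openin (rs_top X) V \<and> V \<subseteq> U \<longrightarrow>
       (\<forall>m\<in>carrier (msec M U). \<forall>m'\<in>carrier (msec M U).
          mres M U V (m \<oplus>\<^bsub>msec M U\<^esub> m') = mres M U V m \<oplus>\<^bsub>msec M V\<^esub> mres M U V m') \<and>
       (\<forall>a\<in>carrier (sec X U). \<forall>m\<in>carrier (msec M U).
          mres M U V (a \<odot>\<^bsub>msec M U\<^esub> m) = res X U V a \<odot>\<^bsub>msec M V\<^esub> mres M U V m)) \<and>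
    is_sheaf (rs_top X) (\<lambda>U. carrier (msec M U)) (mres M)"

definition module_sheaf_hom ::
  "('a, 'r) ringed_space \<Rightarrow> ('a, 'r, 'm) module_sheaf \<Rightarrow> ('a, 'r, 'n) module_sheaf \<Rightarrow>
    ('a set \<Rightarrow> 'm \<Rightarrow> 'n) \<Rightarrow> bool" where
  "module_sheaf_hom X M N h \<longleftrightarrow>
    (\<forall>U. openin (rs_top X) U \<longrightarrow> h U \<in> module_hom (sec X U) (msec M U) (msec N U)) \<and>
    (\<forall>U V. openin (rs_top X) U \<and> openin (rs_top X) V \<and> V \<subseteq> U \<longrightarrow>
       (\<forall>m\<in>carrier (msec M U). h V (mres M U V m) = mres N U V (h U m)))"

text \<open>On a finite space a direct sum of sheaves of modules is already given by the direct sums of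
  the modules of sections: the sheaf condition only involves finite limits.\<close>

definition free_module_sheaf ::
  "('a, 'r) ringed_space \<Rightarrow> 'j set \<Rightarrow> ('a, 'r, 'j \<Rightarrow> 'r) module_sheaf" where
  "free_module_sheaf X J =
    \<lparr>msec = (\<lambda>U. free_module (sec X U) J),
     mres = (\<lambda>U V c. \<lambda>j\<in>J. res X U V (c j))\<rparr>"

text \<open>\<open>q : N \<rightarrow> M\<close> is a cokernel of \<open>h : L \<rightarrow> N\<close> in the category of sheaves of modules:
  \<open>L \<rightarrow> N \<rightarrow> M \<rightarrow> 0\<close> is an exact sequence of sheaves.\<close>

definition is_sheaf_cokernel ::
  "('a, 'r) ringed_space \<Rightarrow> ('a, 'r, 'l) module_sheaf \<Rightarrow> ('a, 'r, 'n) module_sheaf \<Rightarrow>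
    ('a, 'r, 'm) module_sheaf \<Rightarrow> ('a set \<Rightarrow> 'l \<Rightarrow> 'n) \<Rightarrow> ('a set \<Rightarrow> 'n \<Rightarrow> 'm) \<Rightarrow> bool" where
  "is_sheaf_cokernel X L N M h q \<longleftrightarrow>
    (\<forall>V. openin (rs_top X) V \<longrightarrow>
       (\<forall>n\<in>carrier (msec N V). q V n = \<zero>\<^bsub>msec M V\<^esub> \<longleftrightarrow>
          (\<forall>x\<in>V. \<exists>W. openin (rs_top X) W \<and> x \<in> W \<and> W \<subseteq> V \<and>
             mres N V W n \<in> h W ` carrier (msec L W))) \<and>
       (\<forall>m\<in>carrier (msec M V). \<forall>x\<in>V. \<exists>W. openin (rs_top X) W \<and> x \<in> W \<and> W \<subseteq> V \<and>
          mres M V W m \<in> q W ` carrier (msec N W)))"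

text \<open>The index types of the free modules suffice for arbitrary presentations. On a finite space
  a presentation near \<open>x\<close> restricts to the smallest neighbourhood of \<open>x\<close>. Let \<open>M\<^sub>x\<close> be the module of
  sections there. By right exactness one exists iff \<open>\<O>\<^sub>y \<otimes> M\<^sub>x \<rightarrow> M\<^sub>y\<close> is an isomorphism for all
  \<open>y \<ge> x\<close>, and then any presentation of \<open>M\<^sub>x\<close> induces one, in particular that with all elements of
  \<open>M\<^sub>x\<close> as generators and all relations among them.\<close>

definition quasi_coherent ::
  "('a, 'r) ringed_space \<Rightarrow> ('a, 'r, 'm) module_sheaf \<Rightarrow> bool" where
  "quasi_coherent X M \<longleftrightarrow>
    is_module_sheaf X M \<and>
    (\<forall>x\<in>points X. \<exists>U. openin (rs_top X) U \<and> x \<in> U \<and>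
       (\<exists>(I :: ('m \<Rightarrow> 'r) set) (J :: 'm set) h q.
          let X' = open_subspace X U; L = free_module_sheaf X' I; N = free_module_sheaf X' J in
            module_sheaf_hom X' L N h \<and> module_sheaf_hom X' N M q \<and>
            is_sheaf_cokernel X' L N M h q))"

definition direct_image ::
  "('a, 'r) ringed_space \<Rightarrow> ('a, 'r, 'b, 's) rs_map \<Rightarrow> ('b, 's, 'r) module_sheaf" where
  "direct_image X f =
    \<lparr>msec = (\<lambda>V. module_along (comap f V) (sec X (preim X (pmap f) V))),
     mres = (\<lambda>V W. res X (preim X (pmap f) V) (preim X (pmap f) W))\<rparr>"


section \<open>Affine and schematic finite spaces\<close>

definition min_open :: "('a, 'r) ringed_space \<Rightarrow> 'a \<Rightarrow> 'a set" where
  "min_open X x = \<Inter>{U. openin (rs_top X) U \<and> x \<in> U}"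

definition stalk :: "('a, 'r) ringed_space \<Rightarrow> 'a \<Rightarrow> 'r ring" where
  "stalk X x = sec X (min_open X x)"

text \<open>The map \<open>\<O>(V) \<rightarrow> \<Prod>z\<in>S. \<O>\<^sub>z\<close>, for a set \<open>S\<close> of points of the open set \<open>V\<close>.\<close>

definition to_stalks :: "('a, 'r) ringed_space \<Rightarrow> 'a set \<Rightarrow> 'a set \<Rightarrow> 'r \<Rightarrow> 'a \<Rightarrow> 'r" where
  "to_stalks X V S s = (\<lambda>z\<in>S. res X V (min_open X z) s)"

text \<open>The natural map \<open>\<O>\<^sub>x \<otimes> \<O>\<^sub>y \<rightarrow> \<O>\<^sub>x\<^sub>y\<close>, the tensor product being taken over \<open>\<O>(X)\<close>. It is a
  homomorphism of algebras, hence an isomorphism iff it is bijective.\<close>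

definition stalk_tensor_iso :: "('a, 'r) ringed_space \<Rightarrow> 'a \<Rightarrow> 'a \<Rightarrow> bool" where
  "stalk_tensor_iso X x y \<longleftrightarrow>
    (let A = sec X (points X);
         Ux = min_open X x; Uy = min_open X y; Uxy = Ux \<inter> Uy;
         Ox = module_along (res X (points X) Ux) (stalk X x);
         Oy = module_along (res X (points X) Uy) (stalk X y);
         Oxy = module_along (res X (points X) Uxy) (sec X Uxy)
     in bij_betw
          (tensor_lift A Ox Oy Oxy (\<lambda>a b. res X Ux Uxy a \<otimes>\<^bsub>sec X Uxy\<^esub> res X Uy Uxy b))
          (carrier (tensor A Ox Oy)) (carrier (sec X Uxy)))"

definition affine_space :: "('a, 'r) ringed_space \<Rightarrow> bool" where
  "affine_space X \<longleftrightarrow>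
    finite_ringed_space X \<and>
    faithfully_flat_hom (sec X (points X)) (product_ring (points X) (stalk X))
      (to_stalks X (points X) (points X)) \<and>
    (\<forall>x\<in>points X. \<forall>y\<in>points X. stalk_tensor_iso X x y) \<and>
    (\<forall>x\<in>points X. \<forall>y\<in>points X.
       let Uxy = min_open X x \<inter> min_open X y in
         faithfully_flat_hom (sec X Uxy) (product_ring Uxy (stalk X)) (to_stalks X Uxy Uxy))"

definition affine_open_covering :: "('a, 'r) ringed_space \<Rightarrow> 'a set set \<Rightarrow> bool" where
  "affine_open_covering X \<V> \<longleftrightarrow>
    (\<forall>V\<in>\<V>. openin (rs_top X) V \<and> affine_space (open_subspace X V)) \<and> \<Union>\<V> = points X"

definition schematic_space :: "('a, 'r) ringed_space \<Rightarrow> bool" where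
  "schematic_space X \<longleftrightarrow> finite_ringed_space X \<and> (\<exists>\<V>. affine_open_covering X \<V>)"

definition affine_morphism ::
  "('a, 'r) ringed_space \<Rightarrow> ('b, 's) ringed_space \<Rightarrow> ('a, 'r, 'b, 's) rs_map \<Rightarrow> bool" where
  "affine_morphism X Y f \<longleftrightarrow>
    rs_morphism X Y f \<and>
    quasi_coherent Y (direct_image X f) \<and>
    (\<forall>V. openin (rs_top Y) V \<and> affine_space (open_subspace Y V) \<longrightarrow>
       affine_space (open_subspace X (preim X (pmap f) V)))"

definition schematic_morphism ::
  "('a, 'r) ringed_space \<Rightarrow> ('b, 's) ringed_space \<Rightarrow> ('a, 'r, 'b, 's) rs_map \<Rightarrow> bool" where
  "schematic_morphism X Y f \<longleftrightarrow>
    rs_morphism X Y f \<and>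
    (\<forall>x\<in>points X.
       affine_morphism (open_subspace X (min_open X x)) (open_subspace Y (min_open Y (pmap f x)))
         (restrict_map X (min_open X x) f))"

definition quasi_isomorphism ::
  "('a, 'r) ringed_space \<Rightarrow> ('b, 's) ringed_space \<Rightarrow> ('a, 'r, 'b, 's) rs_map \<Rightarrow> bool" where
  "quasi_isomorphism X Y f \<longleftrightarrow>
    schematic_morphism X Y f \<and> affine_morphism X Y f \<and>
    (\<forall>V. openin (rs_top Y) V \<longrightarrow>
       comap f V \<in> ring_iso (sec Y V) (sec X (preim X (pmap f) V)))"


section \<open>The finite space of a covering\<close>

definition cover_nbhd :: "'a set set \<Rightarrow> 'a \<Rightarrow> 'a set" where
  "cover_nbhd \<V> x = \<Inter>{V \<in> \<V>. x \<in> V}"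

definition cover_class :: "('a, 'r) ringed_space \<Rightarrow> 'a set set \<Rightarrow> 'a \<Rightarrow> 'a set" where
  "cover_class X \<V> x = {x' \<in> points X. cover_nbhd \<V> x' = cover_nbhd \<V> x}"

definition cover_le :: "'a set set \<Rightarrow> 'a set \<Rightarrow> 'a set \<Rightarrow> bool" where
  "cover_le \<V> c c' \<longleftrightarrow> (\<exists>x\<in>c. \<exists>x'\<in>c'. cover_nbhd \<V> x' \<subseteq> cover_nbhd \<V> x)"

definition up_set_topology :: "'a set \<Rightarrow> ('a \<Rightarrow> 'a \<Rightarrow> bool) \<Rightarrow> 'a topology" where
  "up_set_topology S r =
    topology (\<lambda>U. U \<subseteq> S \<and> (\<forall>x\<in>U. \<forall>y\<in>S. r x y \<longrightarrow> y \<in> U))"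

lemma openin_up_set_topology:
  "openin (up_set_topology S r) U \<longleftrightarrow> U \<subseteq> S \<and> (\<forall>x\<in>U. \<forall>y\<in>S. r x y \<longrightarrow> y \<in> U)"
proof -
  have "istopology (\<lambda>U. U \<subseteq> S \<and> (\<forall>x\<in>U. \<forall>y\<in>S. r x y \<longrightarrow> y \<in> U))"
    unfolding istopology_def by blast
  then show ?thesis
    unfolding up_set_topology_def by simp
qed

definition cover_space :: "('a, 'r) ringed_space \<Rightarrow> 'a set set \<Rightarrow> ('a set, 'r) ringed_space" where
  "cover_space X \<V> =
    \<lparr>rs_top = up_set_topology (cover_class X \<V> ` points X) (cover_le \<V>),
     sec = (\<lambda>U. sec X (preim X (cover_class X \<V>) U)),
     res = (\<lambda>U V. res X (preim X (cover_class X \<V>) U) (preim X (cover_class X \<V>) V))\<rparr>"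

definition cover_projection ::
  "('a, 'r) ringed_space \<Rightarrow> 'a set set \<Rightarrow> ('a, 'r, 'a set, 'r) rs_map" where
  "cover_projection X \<V> = \<lparr>pmap = cover_class X \<V>, comap = (\<lambda>U s. s)\<rparr>"

definition preimage_cover ::
  "('a, 'r) ringed_space \<Rightarrow> ('b, 's) ringed_space \<Rightarrow> ('a, 'r, 'b, 's) rs_map \<Rightarrow> 'a set set" where
  "preimage_cover X Y f = (\<lambda>y. preim X (pmap f) (min_open Y y)) ` points Y"


section \<open>Removable points\<close>

text \<open>\<open>q > p\<close> means that the smallest neighbourhood of \<open>q\<close> is strictly contained in that of \<open>p\<close>.\<close>

definition removable :: "('b, 's) ringed_space \<Rightarrow> 'b \<Rightarrow> bool" where
  "removable Y p \<longleftrightarrow>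
    p \<in> points Y \<and>
    (let S = {q \<in> points Y. min_open Y q \<subset> min_open Y p} in
       faithfully_flat_hom (stalk Y p) (product_ring S (stalk Y)) (to_stalks Y (min_open Y p) S))"

text \<open>The ringed space \<open>Y \<setminus> P\<close> with the stalks of \<open>Y\<close>: as on every finite ringed space, sections
  over \<open>U\<close> are the families of germs at the points of \<open>U\<close> compatible with the maps
  \<open>\<O>\<^sub>y \<rightarrow> \<O>\<^sub>z\<close> for \<open>y \<r> z\<close>.\<close>

definition remove_points ::
  "('b, 's) ringed_space \<Rightarrow> 'b set \<Rightarrow> ('b, 'b \<Rightarrow> 's) ringed_space" where
  "remove_points Y P =
    \<lparr>rs_top = subtopology (rs_top Y) (points Y - P),
     sec = (\<lambda>U. (product_ring U (stalk Y))
       \<lparr>carrier := {s \<in> carrier (product_ring U (stalk Y)).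
          \<forall>y\<in>U. \<forall>z\<in>U. min_open Y z \<subseteq> min_open Y y \<longrightarrow>
            res Y (min_open Y y) (min_open Y z) (s y) = s z}\<rparr>),
     res = (\<lambda>U V s. restrict s V)\<rparr>"

definition remove_points_inclusion ::
  "('b, 's) ringed_space \<Rightarrow> 'b set \<Rightarrow> ('b, 'b \<Rightarrow> 's, 'b, 's) rs_map" where
  "remove_points_inclusion Y P =
    \<lparr>pmap = (\<lambda>y. y), comap = (\<lambda>V. to_stalks Y V (V - P))\<rparr>"

definition minimal_space :: "('b, 's) ringed_space \<Rightarrow> bool" where
  "minimal_space Y \<longleftrightarrow>
    schematic_space Y \<and> t0_space (rs_top Y) \<and> (\<forall>p\<in>points Y. \<not> removable Y p)"

end

theory Submission
  imports Defs
begin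

text \<open>
  Let \<open>f : X \<rightarrow> Y\<close> be a quasi-isomorphism, with \<open>Y\<close> a T0 space, and write \<open>U\<^sub>y\<close> for the smallest
  neighbourhood of \<open>y\<close>. The intersection of the members of the covering \<open>{f\<^sup>-\<^sup>1(U\<^sub>y)}\<close> that contain \<open>x\<close>
  is \<open>f\<^sup>-\<^sup>1(U\<^sub>f\<^sub>x)\<close>. By the T0 axiom two points are therefore identified in \<open>X/~\<close> iff they have the same
  image, and \<open>X/~\<close> is, as an ordered set, the image \<open>f(X)\<close> with the order of \<open>Y\<close>. Since
  \<open>O\<^sub>Y = f\<^sub>*O\<^sub>X\<close>, the stalk of \<open>X/~\<close> at \<open>[x]\<close>, which is \<open>O\<^sub>X(f\<^sup>-\<^sup>1(U\<^sub>f\<^sub>x))\<close>, is the stalk of \<open>Y\<close> at \<open>f(x)\<close>.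
  So \<open>f\<close> induces an isomorphism of \<open>X/~\<close> onto the complement in \<open>Y\<close> of the set \<open>P\<close> of the points
  outside \<open>f(X)\<close> (\<open>quotient_iso_isomorphism\<close>); on sections it is given by gluing over the sets \<open>f\<^sup>-\<^sup>1(U\<^sub>y)\<close>
  (\<open>germs_ring_iso\<close>).

  The points \<open>p\<close> of \<open>P\<close> are removable (\<open>removable_outside_image\<close>). The maps \<open>O\<^sub>p \<rightarrow> O\<^sub>q\<close> for \<open>q > p\<close>
  are flat because \<open>U\<^sub>p\<close> is affine. For faithfulness let \<open>I\<close> be an ideal of \<open>O\<^sub>p\<close> that generates the
  unit ideal in every \<open>O\<^sub>q\<close> with \<open>q > p\<close>. The preimage \<open>f\<^sup>-\<^sup>1(U\<^sub>p)\<close> is affine, so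
  the map from \<open>O\<^sub>p = O\<^sub>X(f\<^sup>-\<^sup>1(U\<^sub>p))\<close> to the product of the stalks \<open>O\<^sub>X\<^sub>,\<^sub>x\<close> with \<open>x\<close> in this preimage is
  faithfully flat.
  As \<open>p\<close> is not in the image, \<open>f(x) > p\<close>, and \<open>O\<^sub>p \<rightarrow> O\<^sub>X\<^sub>,\<^sub>x\<close> factors through \<open>O\<^sub>f\<^sub>(\<^sub>x\<^sub>)\<close>. So \<open>I\<close> generates the unit
  ideal in each \<open>O\<^sub>X\<^sub>,\<^sub>x\<close>, and contains \<open>1\<close>. If \<open>Y\<close> has no removable points, \<open>P\<close> is empty and \<open>X/~\<close> is
  isomorphic to \<open>Y\<close> itself.

  The same argument shows that \<open>X/~\<close> is schematic: its smallest neighbourhoods correspond to the sets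
  \<open>f\<^sup>-\<^sup>1(U\<^sub>y)\<close>; the flatness conditions and the tensor product condition are transported from \<open>Y\<close>, and
  faithfulness again comes from the affine subspaces \<open>f\<^sup>-\<^sup>1(U\<^sub>y)\<close> and \<open>f\<^sup>-\<^sup>1(U\<^sub>y \<inter> U\<^sub>z)\<close> of \<open>X\<close>.

  The rings of \<open>X\<close> and those of \<open>Y\<close> have elements in unrelated types, and flatness over a ring is
  tested on modules whose elements live in a type built from that ring. To compare the two sides,
  faithful flatness of a ring homomorphism \<open>A \<rightarrow> B\<close> is first characterised by conditions on elements
  that do not refer to test modules (\<open>faithfully_flat_hom_iff\<close>): every linear relation
  \<open>a\<^sub>1 b\<^sub>1 + \<dots> + a\<^sub>k b\<^sub>k = 0\<close> in \<open>B\<close> is a combination of relations among the \<open>a\<^sub>i\<close> in \<open>A\<close>, and no proper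
  ideal of \<open>A\<close> generates the unit ideal of \<open>B\<close>. Both conditions pass along ring isomorphisms, and for a
  finite product they can be checked on the factors (\<open>faithfully_flat_hom_product_iff\<close>).
\<close>

section \<open>Modules, quotients and functions of finite support\<close>

lemma additive_mapI:
  assumes "abelian_group G" "abelian_group H"
    and "\<And>x. x \<in> carrier G \<Longrightarrow> h x \<in> carrier H"
    and "\<And>x y. x \<in> carrier G \<Longrightarrow> y \<in> carrier G \<Longrightarrow> h (x \<oplus>\<^bsub>G\<^esub> y) = h x \<oplus>\<^bsub>H\<^esub> h y"
  shows "abelian_group_hom G H h"
  using assms
  by (intro abelian_group_homI group_hom.intro group_hom_axioms.intro abelian_group.a_group)
    (auto simp: hom_def)

lemma (in abelian_group_hom) hom_finsum:
  assumes "f \<in> I \<rightarrow> carrier G"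
  shows "h (\<Oplus>\<^bsub>G\<^esub>i\<in>I. f i) = (\<Oplus>\<^bsub>H\<^esub>i\<in>I. h (f i))"
  using assms
proof (induction I rule: infinite_finite_induct)
  case (insert i I)
  then have "(\<lambda>i. h (f i)) \<in> I \<rightarrow> carrier H" by (auto intro!: hom_closed)
  with insert show ?case by (simp add: Pi_iff)
qed simp_all

lemma (in abelian_group) finsum_lessThan_Suc:
  assumes "f \<in> {..<Suc k} \<rightarrow> carrier G"
  shows "(\<Oplus>i\<in>{..<Suc k}. f i) = f k \<oplus> (\<Oplus>i\<in>{..<k}. f i)"
proof -
  have "(\<Oplus>i\<in>insert k {..<k}. f i) = f k \<oplus> (\<Oplus>i\<in>{..<k}. f i)"
    by (rule finsum_insert) (use assms in \<open>auto simp: Pi_iff\<close>)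
  then show ?thesis by (simp add: lessThan_Suc)
qed

lemma (in module) finsum_smult_rdistr:
  assumes "finite I" "f \<in> I \<rightarrow> carrier R" "x \<in> carrier M"
  shows "(\<Oplus>i\<in>I. f i) \<odot>\<^bsub>M\<^esub> x = (\<Oplus>\<^bsub>M\<^esub>i\<in>I. f i \<odot>\<^bsub>M\<^esub> x)"
  using assms
proof (induction I rule: finite_induct)
  case (insert i I)
  then have "(\<lambda>i. f i \<odot>\<^bsub>M\<^esub> x) \<in> I \<rightarrow> carrier M" by auto
  with insert show ?case by (simp add: Pi_iff smult_l_distr R.finsum_closed)
qed simp

lemma module_hom_additive:
  assumes "Module.module A M" "Module.module A N" "h \<in> module_hom A M N"
  shows "abelian_group_hom M N h"
  using assms by (intro additive_mapI) (auto simp: module_hom_def Module.module_def)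

lemma module_hom_smult:
  "h \<in> module_hom A M N \<Longrightarrow> a \<in> carrier A \<Longrightarrow> m \<in> carrier M \<Longrightarrow> h (a \<odot>\<^bsub>M\<^esub> m) = a \<odot>\<^bsub>N\<^esub> h m"
  by (simp add: module_hom_def)

lemma submodule_kernel:
  assumes "Module.module A M" "Module.module A N" "h \<in> module_hom A M N"
  shows "submodule {m \<in> carrier M. h m = \<zero>\<^bsub>N\<^esub>} A M"
proof -
  interpret M: Module.module A M by fact
  interpret N: Module.module A N by fact
  interpret h: abelian_group_hom M N h by (rule module_hom_additive) fact+
  show ?thesis
    by (rule M.submoduleI) (auto simp: module_hom_smult[OF assms(3)])
qed

lemma module_along_simps [simp]:
  "carrier (module_along \<phi> B) = carrier B" "zero (module_along \<phi> B) = zero B"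
  "add (module_along \<phi> B) = add B" "smult (module_along \<phi> B) a b = \<phi> a \<otimes>\<^bsub>B\<^esub> b"
  "mult (module_along \<phi> B) = mult B" "one (module_along \<phi> B) = one B"
  by (simp_all add: module_along_def)

lemma cring_module_along:
  assumes "cring B" shows "cring (module_along \<phi> B)"
proof -
  interpret B: cring B by fact
  have "abelian_group (module_along \<phi> B)"
  proof (rule abelian_groupI)
    fix x assume "x \<in> carrier (module_along \<phi> B)"
    then show "\<exists>y\<in>carrier (module_along \<phi> B). y \<oplus>\<^bsub>module_along \<phi> B\<^esub> x = \<zero>\<^bsub>module_along \<phi> B\<^esub>"
      by (intro bexI[of _ "\<ominus>\<^bsub>B\<^esub> x"]) (auto simp: B.l_neg)
  qed (auto simp: B.a_ac)
  then show ?thesis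
    by (intro cringI comm_monoidI) (auto simp: B.m_ac B.l_distr B.r_distr)
qed

lemma module_module_along:
  assumes "cring A" "cring B" "\<phi> \<in> ring_hom A B"
  shows "Module.module A (module_along \<phi> B)"
proof -
  interpret A: cring A by fact
  interpret B: cring B by fact
  interpret C: cring "module_along \<phi> B" by (rule cring_module_along) fact
  note h = ring_hom_closed[OF assms(3)] ring_hom_add[OF assms(3)] ring_hom_mult[OF assms(3)]
    ring_hom_one[OF assms(3)]
  show ?thesis
    by (rule moduleI) (auto simp: h B.l_distr B.r_distr B.m_assoc C.abelian_group_axioms assms(1))
qed

text \<open>The facts about quotients are stated for the coset map; everything below about tensor products
  goes through them.\<close>

lemma quotient_module:
  fixes M :: "('r, 'm) module"
  assumes "Module.module A M" "submodule H A M"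
  shows quotient_module_module: "Module.module A (quotient_module M H)"
    and quotient_module_hom: "(\<lambda>x. H +>\<^bsub>M\<^esub> x) \<in> module_hom A M (quotient_module M H)"
    and quotient_module_eq_zero_iff:
      "\<And>x. x \<in> carrier M \<Longrightarrow> H +>\<^bsub>M\<^esub> x = \<zero>\<^bsub>quotient_module M H\<^esub> \<longleftrightarrow> x \<in> H"
    and quotient_module_cases:
      "\<And>C. C \<in> carrier (quotient_module M H) \<Longrightarrow> \<exists>x\<in>carrier M. C = H +>\<^bsub>M\<^esub> x"
proof -
  interpret M: Module.module A M by fact
  have sub: "subgroup H (add_monoid M)" using assms(2) by (rule submodule.axioms)
  interpret H: abelian_subgroup H M
    using sub M.abelian_group_axioms by (intro abelian_subgroupI3 additive_subgroupI)
  let ?Q = "quotient_module M H" and ?p = "\<lambda>x. H +>\<^bsub>M\<^esub> x"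
  have closed: "?p x \<in> carrier ?Q" if "x \<in> carrier M" for x
    using that M.a_rcosetsI[OF H.a_subset] by (simp add: quotient_module_def)
  show cases: "\<exists>x\<in>carrier M. C = ?p x" if "C \<in> carrier ?Q" for C
    using that by (auto simp: quotient_module_def A_RCOSETS_def')
  then have casesE: thesis
    if "C \<in> carrier ?Q" "\<And>x. x \<in> carrier M \<Longrightarrow> C = ?p x \<Longrightarrow> thesis" for C thesis
    using that by blast
  have add: "?p x \<oplus>\<^bsub>?Q\<^esub> ?p y = ?p (x \<oplus>\<^bsub>M\<^esub> y)" if "x \<in> carrier M" "y \<in> carrier M" for x y
    using that by (simp add: quotient_module_def H.a_rcos_sum)
  have zero: "\<zero>\<^bsub>?Q\<^esub> = ?p \<zero>\<^bsub>M\<^esub>"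
    using M.a_coset_add_zero[OF H.a_subset] by (simp add: quotient_module_def)
  have smult: "a \<odot>\<^bsub>?Q\<^esub> ?p x = ?p (a \<odot>\<^bsub>M\<^esub> x)" if a: "a \<in> carrier A" and x: "x \<in> carrier M" for a x
  proof -
    have "?p (a \<odot>\<^bsub>M\<^esub> c) = ?p (a \<odot>\<^bsub>M\<^esub> x)" if "c \<in> ?p x" for c
    proof -
      obtain h where h: "h \<in> H" "c = h \<oplus>\<^bsub>M\<^esub> x" using \<open>c \<in> ?p x\<close> by (auto simp: a_r_coset_def')
      then have "a \<odot>\<^bsub>M\<^esub> c = a \<odot>\<^bsub>M\<^esub> h \<oplus>\<^bsub>M\<^esub> a \<odot>\<^bsub>M\<^esub> x"
        using a x H.a_Hcarr by (simp add: M.smult_r_distr)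
      moreover have "a \<odot>\<^bsub>M\<^esub> h \<in> H" using a h assms(2) by (simp add: submodule.smult_closed)
      ultimately have "a \<odot>\<^bsub>M\<^esub> c \<in> ?p (a \<odot>\<^bsub>M\<^esub> x)" by (auto simp: a_r_coset_def')
      then show ?thesis using a x H.a_repr_independence' by auto
    qed
    moreover have "x \<in> ?p x" using x by (rule H.a_rcos_self)
    ultimately have "(\<Union>c\<in>?p x. ?p (a \<odot>\<^bsub>M\<^esub> c)) = ?p (a \<odot>\<^bsub>M\<^esub> x)" by blast
    then show ?thesis by (simp add: quotient_module_def)
  qed
  show "Module.module A ?Q"
  proof (rule moduleI)
    show "abelian_group ?Q"
    proof (rule abelian_groupI)
      fix C assume "C \<in> carrier ?Q"
      then obtain x where "x \<in> carrier M" "C = ?p x" using cases by blast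
      then show "\<exists>D\<in>carrier ?Q. D \<oplus>\<^bsub>?Q\<^esub> C = \<zero>\<^bsub>?Q\<^esub>"
        by (intro bexI[of _ "?p (\<ominus>\<^bsub>M\<^esub> x)"]) (auto simp: closed add zero M.l_neg)
    qed (auto elim!: casesE simp: add zero closed M.a_ac)
  qed (auto elim!: casesE simp: add smult closed M.smult_l_distr M.smult_r_distr
      M.smult_assoc1 M.R.cring_axioms)
  show "?p \<in> module_hom A M ?Q" by (simp add: module_hom_def closed add smult)
  show "?p x = \<zero>\<^bsub>?Q\<^esub> \<longleftrightarrow> x \<in> H" if "x \<in> carrier M" for x
    using that H.a_rcos_self H.a_rcos_const unfolding quotient_module_def by auto
qed

text \<open>The free module with coefficients in a module \<open>N\<close> instead of the ring, that is, the direct sum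
  of copies of \<open>N\<close> indexed by \<open>J\<close>.\<close>

definition finsupp_module :: "('r, 'n) module \<Rightarrow> 'j set \<Rightarrow> ('r, 'j \<Rightarrow> 'n) module" where
  "finsupp_module N J =
    \<lparr>carrier = {c \<in> J \<rightarrow>\<^sub>E carrier N. finite {j \<in> J. c j \<noteq> \<zero>\<^bsub>N\<^esub>}},
     mult = undefined, one = undefined,
     zero = (\<lambda>j\<in>J. \<zero>\<^bsub>N\<^esub>),
     add = (\<lambda>c d. \<lambda>j\<in>J. c j \<oplus>\<^bsub>N\<^esub> d j),
     smult = (\<lambda>a c. \<lambda>j\<in>J. a \<odot>\<^bsub>N\<^esub> c j)\<rparr>"

lemma free_module_eq: "free_module A J = finsupp_module (module_along (\<lambda>a. a) A) J"
  by (simp add: free_module_def finsupp_module_def)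

lemma finsupp_module_module:
  assumes "Module.module A N" shows "Module.module A (finsupp_module N J)"
proof -
  interpret N: Module.module A N by fact
  let ?S = "finsupp_module N J"

  have add: "c \<oplus>\<^bsub>?S\<^esub> d \<in> carrier ?S" if "c \<in> carrier ?S" "d \<in> carrier ?S" for c d
  proof -
    have "{j \<in> J. (\<lambda>j\<in>J. c j \<oplus>\<^bsub>N\<^esub> d j) j \<noteq> \<zero>\<^bsub>N\<^esub>} \<subseteq> {j \<in> J. c j \<noteq> \<zero>\<^bsub>N\<^esub>} \<union> {j \<in> J. d j \<noteq> \<zero>\<^bsub>N\<^esub>}"
      using that by auto
    then show ?thesis using that
      by (auto simp: finsupp_module_def PiE_iff intro: rev_finite_subset)
  qed
  have smult: "a \<odot>\<^bsub>?S\<^esub> c \<in> carrier ?S" if "a \<in> carrier A" "c \<in> carrier ?S" for a c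
  proof -
    have "{j \<in> J. (\<lambda>j\<in>J. a \<odot>\<^bsub>N\<^esub> c j) j \<noteq> \<zero>\<^bsub>N\<^esub>} \<subseteq> {j \<in> J. c j \<noteq> \<zero>\<^bsub>N\<^esub>}"
      using that by auto
    then show ?thesis using that
      by (auto simp: finsupp_module_def PiE_iff intro: rev_finite_subset)
  qed
  have neg: "(\<lambda>j\<in>J. \<ominus>\<^bsub>N\<^esub> c j) \<in> carrier ?S" if "c \<in> carrier ?S" for c
  proof -
    have "{j \<in> J. (\<lambda>j\<in>J. \<ominus>\<^bsub>N\<^esub> c j) j \<noteq> \<zero>\<^bsub>N\<^esub>} \<subseteq> {j \<in> J. c j \<noteq> \<zero>\<^bsub>N\<^esub>}"
      using that by auto
    then show ?thesis using that
      by (auto simp: finsupp_module_def PiE_iff intro: rev_finite_subset)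
  qed
  have ops: "(c \<oplus>\<^bsub>?S\<^esub> d) j = c j \<oplus>\<^bsub>N\<^esub> d j" "(a \<odot>\<^bsub>?S\<^esub> c) j = a \<odot>\<^bsub>N\<^esub> c j"
    "\<zero>\<^bsub>?S\<^esub> j = \<zero>\<^bsub>N\<^esub>" if "j \<in> J" for a c d j
    using that by (simp_all add: finsupp_module_def)
  have zero: "\<zero>\<^bsub>?S\<^esub> \<in> carrier ?S" by (simp add: finsupp_module_def)
  have ext: "c = d" if "c \<in> carrier ?S" "d \<in> carrier ?S" "\<And>j. j \<in> J \<Longrightarrow> c j = d j" for c d
    using that by (auto simp: finsupp_module_def intro: PiE_ext)
  have val: "c j \<in> carrier N" if "c \<in> carrier ?S" "j \<in> J" for c j
    using that by (auto simp: finsupp_module_def)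
  show ?thesis
  proof (rule moduleI)
    show "abelian_group ?S"
    proof (rule abelian_groupI)
      fix c assume c: "c \<in> carrier ?S"
      show "\<exists>d\<in>carrier ?S. d \<oplus>\<^bsub>?S\<^esub> c = \<zero>\<^bsub>?S\<^esub>"
        by (rule bexI[OF _ neg[OF c]], rule ext) (auto simp: ops add zero N.l_neg val[OF c] neg c)
    qed (auto simp: ops add zero val N.a_ac intro!: ext)
  qed (auto simp: ops add smult zero val N.R.cring_axioms N.smult_l_distr N.smult_r_distr
      N.smult_assoc1 intro!: ext)
qed

lemma finsupp_module_simps:
  "c \<in> carrier (finsupp_module N J) \<longleftrightarrow> c \<in> J \<rightarrow>\<^sub>E carrier N \<and> finite {j \<in> J. c j \<noteq> \<zero>\<^bsub>N\<^esub>}"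
  "c \<oplus>\<^bsub>finsupp_module N J\<^esub> d = (\<lambda>j\<in>J. c j \<oplus>\<^bsub>N\<^esub> d j)"
  "a \<odot>\<^bsub>finsupp_module N J\<^esub> c = (\<lambda>j\<in>J. a \<odot>\<^bsub>N\<^esub> c j)"
  "\<zero>\<^bsub>finsupp_module N J\<^esub> = (\<lambda>j\<in>J. \<zero>\<^bsub>N\<^esub>)"
  by (simp_all add: finsupp_module_def)

lemma module_self: "cring A \<Longrightarrow> Module.module A (module_along (\<lambda>a. a) A)"
  by (rule module_module_along) (auto simp: ring_hom_def)

lemma free_module_module: "cring A \<Longrightarrow> Module.module A (free_module A J)"
  unfolding free_module_eq by (intro finsupp_module_module module_self)

lemma free_module_simps:
  "c \<in> carrier (free_module A J) \<longleftrightarrow> c \<in> J \<rightarrow>\<^sub>E carrier A \<and> finite {j \<in> J. c j \<noteq> \<zero>\<^bsub>A\<^esub>}"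
  "c \<oplus>\<^bsub>free_module A J\<^esub> d = (\<lambda>j\<in>J. c j \<oplus>\<^bsub>A\<^esub> d j)"
  "a \<odot>\<^bsub>free_module A J\<^esub> c = (\<lambda>j\<in>J. a \<otimes>\<^bsub>A\<^esub> c j)"
  "\<zero>\<^bsub>free_module A J\<^esub> = (\<lambda>j\<in>J. \<zero>\<^bsub>A\<^esub>)"
  by (simp_all add: free_module_def)

lemma basis_vector_closed:
  assumes "cring A" "j \<in> J"
  shows "basis_vector A J j \<in> carrier (free_module A J)"
proof -
  interpret cring A by fact
  have "{i \<in> J. basis_vector A J j i \<noteq> \<zero>\<^bsub>A\<^esub>} \<subseteq> {j}" by (auto simp: basis_vector_def)
  then show ?thesis
    by (auto simp: free_module_simps basis_vector_def intro: rev_finite_subset)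
qed

text \<open>The basis vectors generate: a family of finite support is built up by adding its coefficients
  one at a time.\<close>

lemma free_module_induct [consumes 2, case_names zero add]:
  assumes "cring A" and "c \<in> carrier (free_module A J)"
    and zero: "Q \<zero>\<^bsub>free_module A J\<^esub>"
    and add: "\<And>a j c. a \<in> carrier A \<Longrightarrow> j \<in> J \<Longrightarrow> c \<in> carrier (free_module A J) \<Longrightarrow> Q c \<Longrightarrow>
      Q (a \<odot>\<^bsub>free_module A J\<^esub> basis_vector A J j \<oplus>\<^bsub>free_module A J\<^esub> c)"
  shows "Q c"
proof -
  interpret A: cring A by fact
  let ?F = "free_module A J"
  have "Q c" if "finite S" "c \<in> carrier ?F" "{j \<in> J. c j \<noteq> \<zero>\<^bsub>A\<^esub>} \<subseteq> S" for S c
    using that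
  proof (induction S arbitrary: c rule: finite_induct)
    case empty
    then have "c = \<zero>\<^bsub>?F\<^esub>" by (auto simp: free_module_simps intro!: PiE_ext[of _ J "\<lambda>_. carrier A"])
    then show ?case using zero by simp
  next
    case (insert j S)
    show ?case
    proof (cases "j \<in> J")
      case False
      then show ?thesis using insert.IH[of c] insert.prems by auto
    next
      case True
      let ?d = "c(j := \<zero>\<^bsub>A\<^esub>)"
      have "{i \<in> J. ?d i \<noteq> \<zero>\<^bsub>A\<^esub>} \<subseteq> {j \<in> J. c j \<noteq> \<zero>\<^bsub>A\<^esub>}" by auto
      then have d: "?d \<in> carrier ?F" 
        using insert.prems True by (auto simp: free_module_simps PiE_iff extensional_def
            intro: rev_finite_subset)
      moreover have "{i \<in> J. ?d i \<noteq> \<zero>\<^bsub>A\<^esub>} \<subseteq> S" using insert.prems by auto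
      ultimately have "Q ?d" by (rule insert.IH)
      moreover have "c j \<in> carrier A" using True insert.prems by (auto simp: free_module_simps)
      ultimately have "Q (c j \<odot>\<^bsub>?F\<^esub> basis_vector A J j \<oplus>\<^bsub>?F\<^esub> ?d)" using d True by (intro add)
      moreover have "c j \<odot>\<^bsub>?F\<^esub> basis_vector A J j \<oplus>\<^bsub>?F\<^esub> ?d = c"
        using True insert.prems 
        by (auto simp: free_module_simps basis_vector_def PiE_iff extensional_def fun_eq_iff)
      ultimately show ?thesis by simp
    qed
  qed
  then show ?thesis using assms(2) by (auto simp: free_module_simps)
qed

definition free_lift ::
  "'r ring \<Rightarrow> 'j set \<Rightarrow> ('r, 'p) module \<Rightarrow> ('j \<Rightarrow> 'p) \<Rightarrow> ('j \<Rightarrow> 'r) \<Rightarrow> 'p" where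
  "free_lift A J P \<beta> c = (\<Oplus>\<^bsub>P\<^esub>q\<in>{q \<in> J. c q \<noteq> \<zero>\<^bsub>A\<^esub>}. c q \<odot>\<^bsub>P\<^esub> \<beta> q)"

lemma free_lift:
  fixes P :: "('r, 'p) module"
  assumes "Module.module A P" "\<beta> \<in> J \<rightarrow> carrier P"
  shows free_lift_hom: "free_lift A J P \<beta> \<in> module_hom A (free_module A J) P"
    and free_lift_basis_vector: "\<And>j. j \<in> J \<Longrightarrow> free_lift A J P \<beta> (basis_vector A J j) = \<beta> j"
proof -
  interpret P: Module.module A P by fact
  let ?F = "free_module A J"
  have eq: "free_lift A J P \<beta> c = (\<Oplus>\<^bsub>P\<^esub>q\<in>S. c q \<odot>\<^bsub>P\<^esub> \<beta> q)"
    if "finite S" "S \<subseteq> J" "{q \<in> J. c q \<noteq> \<zero>\<^bsub>A\<^esub>} \<subseteq> S" "c \<in> J \<rightarrow> carrier A" for c S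
    unfolding free_lift_def using that assms(2)
    by (intro P.M.add.finprod_mono_neutral_cong_left) (auto simp: Pi_iff)
  show "free_lift A J P \<beta> (basis_vector A J j) = \<beta> j" if "j \<in> J" for j
    using that assms(2) by (subst eq[of "{j}"]) (auto simp: basis_vector_def Pi_iff)
  show "free_lift A J P \<beta> \<in> module_hom A ?F P"
    unfolding module_hom_def mem_Collect_eq
  proof (intro conjI ballI)
    show "free_lift A J P \<beta> \<in> carrier ?F \<rightarrow> carrier P"
      using assms(2)
      by (auto simp: free_lift_def free_module_simps PiE_iff Pi_iff intro!: P.M.finsum_closed)
  next
    fix c d assume cd: "c \<in> carrier ?F" "d \<in> carrier ?F"
    let ?S = "{q \<in> J. c q \<noteq> \<zero>\<^bsub>A\<^esub>} \<union> {q \<in> J. d q \<noteq> \<zero>\<^bsub>A\<^esub>}"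
    have mem: "c q \<in> carrier A" "d q \<in> carrier A" "\<beta> q \<in> carrier P" if "q \<in> J" for q
      using that cd assms(2) by (auto simp: free_module_simps)
    have fin: "finite ?S" using cd by (auto simp: free_module_simps)
    have "free_lift A J P \<beta> (c \<oplus>\<^bsub>?F\<^esub> d) = (\<Oplus>\<^bsub>P\<^esub>q\<in>?S. (c \<oplus>\<^bsub>?F\<^esub> d) q \<odot>\<^bsub>P\<^esub> \<beta> q)"
      using mem fin by (intro eq) (auto simp: free_module_simps)
    also have "\<dots> = (\<Oplus>\<^bsub>P\<^esub>q\<in>?S. c q \<odot>\<^bsub>P\<^esub> \<beta> q \<oplus>\<^bsub>P\<^esub> d q \<odot>\<^bsub>P\<^esub> \<beta> q)"
      by (rule P.M.finsum_cong') (auto simp: free_module_simps mem P.smult_l_distr)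
    also have "\<dots> = (\<Oplus>\<^bsub>P\<^esub>q\<in>?S. c q \<odot>\<^bsub>P\<^esub> \<beta> q) \<oplus>\<^bsub>P\<^esub> (\<Oplus>\<^bsub>P\<^esub>q\<in>?S. d q \<odot>\<^bsub>P\<^esub> \<beta> q)"
      by (rule P.M.finsum_addf) (auto simp: mem)
    also have "(\<Oplus>\<^bsub>P\<^esub>q\<in>?S. c q \<odot>\<^bsub>P\<^esub> \<beta> q) = free_lift A J P \<beta> c"
      using mem fin by (intro eq[symmetric]) auto
    also have "(\<Oplus>\<^bsub>P\<^esub>q\<in>?S. d q \<odot>\<^bsub>P\<^esub> \<beta> q) = free_lift A J P \<beta> d"
      using mem fin by (intro eq[symmetric]) auto
    finally show "free_lift A J P \<beta> (c \<oplus>\<^bsub>?F\<^esub> d) = free_lift A J P \<beta> c \<oplus>\<^bsub>P\<^esub> free_lift A J P \<beta> d" .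
  next
    fix a c assume ac: "a \<in> carrier A" "c \<in> carrier ?F"
    let ?S = "{q \<in> J. c q \<noteq> \<zero>\<^bsub>A\<^esub>}"
    have mem: "c q \<in> carrier A" "\<beta> q \<in> carrier P" if "q \<in> J" for q
      using that ac assms(2) by (auto simp: free_module_simps)
    have fin: "finite ?S" using ac by (auto simp: free_module_simps)
    have "free_lift A J P \<beta> (a \<odot>\<^bsub>?F\<^esub> c) = (\<Oplus>\<^bsub>P\<^esub>q\<in>?S. (a \<odot>\<^bsub>?F\<^esub> c) q \<odot>\<^bsub>P\<^esub> \<beta> q)"
      using mem fin ac(1) by (intro eq) (auto simp: free_module_simps)
    also have "\<dots> = (\<Oplus>\<^bsub>P\<^esub>q\<in>?S. a \<odot>\<^bsub>P\<^esub> (c q \<odot>\<^bsub>P\<^esub> \<beta> q))"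
      by (rule P.M.finsum_cong') (auto simp: free_module_simps mem ac(1) P.smult_assoc1)
    also have "\<dots> = a \<odot>\<^bsub>P\<^esub> free_lift A J P \<beta> c"
      unfolding free_lift_def using mem ac(1) fin by (subst P.finsum_smult_ldistr) auto
    finally show "free_lift A J P \<beta> (a \<odot>\<^bsub>?F\<^esub> c) = a \<odot>\<^bsub>P\<^esub> free_lift A J P \<beta> c" .
  qed
qed

section \<open>Tensor products\<close>

lemma submodule_span:
  assumes "Module.module A M" "S \<subseteq> carrier M"
  shows submodule_span_submodule: "submodule (submodule_span A M S) A M"
    and submodule_span_superset: "S \<subseteq> submodule_span A M S"
    and submodule_span_least: "\<And>H. submodule H A M \<Longrightarrow> S \<subseteq> H \<Longrightarrow> submodule_span A M S \<subseteq> H"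
proof -
  interpret M: Module.module A M by fact
  note E = M.submoduleE
  have zero: "\<zero>\<^bsub>M\<^esub> \<in> H" if "submodule H A M" for H
    using submodule.axioms(1)[OF that] subgroup.one_closed by fastforce
  have top: "submodule_span A M S \<subseteq> carrier M"
    using M.carrier_is_submodule assms(2) by (auto simp: submodule_span_def)
  show "submodule (submodule_span A M S) A M"
    by (rule M.submoduleI) (use top in \<open>auto simp: submodule_span_def zero E(3-6)\<close>)
qed (auto simp: submodule_span_def)

definition bilinear ::
  "'r ring \<Rightarrow> ('r, 'm) module \<Rightarrow> ('r, 'n) module \<Rightarrow> ('r, 'p) module \<Rightarrow> ('m \<Rightarrow> 'n \<Rightarrow> 'p) \<Rightarrow> bool" where
  "bilinear A M N P \<beta> \<longleftrightarrow>
    (\<forall>m\<in>carrier M. \<forall>n\<in>carrier N. \<beta> m n \<in> carrier P) \<and>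
    (\<forall>m\<in>carrier M. \<forall>m'\<in>carrier M. \<forall>n\<in>carrier N. \<beta> (m \<oplus>\<^bsub>M\<^esub> m') n = \<beta> m n \<oplus>\<^bsub>P\<^esub> \<beta> m' n) \<and>
    (\<forall>m\<in>carrier M. \<forall>n\<in>carrier N. \<forall>n'\<in>carrier N. \<beta> m (n \<oplus>\<^bsub>N\<^esub> n') = \<beta> m n \<oplus>\<^bsub>P\<^esub> \<beta> m n') \<and>
    (\<forall>a\<in>carrier A. \<forall>m\<in>carrier M. \<forall>n\<in>carrier N. \<beta> (a \<odot>\<^bsub>M\<^esub> m) n = a \<odot>\<^bsub>P\<^esub> \<beta> m n) \<and>
    (\<forall>a\<in>carrier A. \<forall>m\<in>carrier M. \<forall>n\<in>carrier N. \<beta> m (a \<odot>\<^bsub>N\<^esub> n) = a \<odot>\<^bsub>P\<^esub> \<beta> m n)"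

lemma bilinearI:
  assumes "\<And>m n. m \<in> carrier M \<Longrightarrow> n \<in> carrier N \<Longrightarrow> \<beta> m n \<in> carrier P"
    and "\<And>m m' n. m \<in> carrier M \<Longrightarrow> m' \<in> carrier M \<Longrightarrow> n \<in> carrier N \<Longrightarrow>
      \<beta> (m \<oplus>\<^bsub>M\<^esub> m') n = \<beta> m n \<oplus>\<^bsub>P\<^esub> \<beta> m' n"
    and "\<And>m n n'. m \<in> carrier M \<Longrightarrow> n \<in> carrier N \<Longrightarrow> n' \<in> carrier N \<Longrightarrow>
      \<beta> m (n \<oplus>\<^bsub>N\<^esub> n') = \<beta> m n \<oplus>\<^bsub>P\<^esub> \<beta> m n'"
    and "\<And>a m n. a \<in> carrier A \<Longrightarrow> m \<in> carrier M \<Longrightarrow> n \<in> carrier N \<Longrightarrow>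
      \<beta> (a \<odot>\<^bsub>M\<^esub> m) n = a \<odot>\<^bsub>P\<^esub> \<beta> m n"
    and "\<And>a m n. a \<in> carrier A \<Longrightarrow> m \<in> carrier M \<Longrightarrow> n \<in> carrier N \<Longrightarrow>
      \<beta> m (a \<odot>\<^bsub>N\<^esub> n) = a \<odot>\<^bsub>P\<^esub> \<beta> m n"
  shows "bilinear A M N P \<beta>"
  using assms unfolding bilinear_def by blast

lemma bilinearD:
  assumes "bilinear A M N P \<beta>" "m \<in> carrier M" "n \<in> carrier N"
  shows "\<beta> m n \<in> carrier P"
    and "m' \<in> carrier M \<Longrightarrow> \<beta> (m \<oplus>\<^bsub>M\<^esub> m') n = \<beta> m n \<oplus>\<^bsub>P\<^esub> \<beta> m' n"
    and "n' \<in> carrier N \<Longrightarrow> \<beta> m (n \<oplus>\<^bsub>N\<^esub> n') = \<beta> m n \<oplus>\<^bsub>P\<^esub> \<beta> m n'"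
    and "a \<in> carrier A \<Longrightarrow> \<beta> (a \<odot>\<^bsub>M\<^esub> m) n = a \<odot>\<^bsub>P\<^esub> \<beta> m n"
    and "a \<in> carrier A \<Longrightarrow> \<beta> m (a \<odot>\<^bsub>N\<^esub> n) = a \<odot>\<^bsub>P\<^esub> \<beta> m n"
  using assms unfolding bilinear_def by blast+

locale tensor_product = M: Module.module A M + N: Module.module A N
  for A :: "'r ring" and M :: "('r, 'm) module" and N :: "('r, 'n) module"
begin

abbreviation J where "J \<equiv> carrier M \<times> carrier N"
abbreviation F where "F \<equiv> free_module A J"
abbreviation K where "K \<equiv> tensor_kernel A M N"
abbreviation T where "T \<equiv> tensor A M N"
abbreviation e where "e m n \<equiv> basis_vector A J (m, n)"
abbreviation pure (infixl \<open>\<^bold>\<otimes>\<close> 75) where "m \<^bold>\<otimes> n \<equiv> pure_tensor A M N m n"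

lemma F_module: "Module.module A F"
  by (rule free_module_module) (rule M.R.cring_axioms)

lemma e_closed [simp]: "m \<in> carrier M \<Longrightarrow> n \<in> carrier N \<Longrightarrow> e m n \<in> carrier F"
  by (rule basis_vector_closed) (auto intro: M.R.cring_axioms)

lemma relations_closed: "bilinear_relations A M N \<subseteq> carrier F"
proof -
  interpret F: Module.module A F by (rule F_module)
  show ?thesis by (auto simp: bilinear_relations_def Let_def intro!: F.M.minus_closed)
qed

lemma K_submodule: "submodule K A F"
  unfolding tensor_kernel_def by (intro submodule_span_submodule F_module relations_closed)

lemma T_eq: "T = quotient_module F K" by (simp add: tensor_def)

lemma T_module: "Module.module A T"
  unfolding T_eq by (rule quotient_module_module[OF F_module K_submodule])

sublocale T: Module.module A T by (rule T_module)

lemma coset_hom: "(\<lambda>x. K +>\<^bsub>F\<^esub> x) \<in> module_hom A F T"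
  unfolding T_eq by (rule quotient_module_hom[OF F_module K_submodule])

lemma coset_eqI:
  assumes "u \<ominus>\<^bsub>F\<^esub> v \<in> bilinear_relations A M N" "u \<in> carrier F" "v \<in> carrier F"
  shows "K +>\<^bsub>F\<^esub> u = K +>\<^bsub>F\<^esub> v"
proof -
  interpret F: Module.module A F by (rule F_module)
  interpret p: abelian_group_hom F T "\<lambda>x. K +>\<^bsub>F\<^esub> x"
    by (rule module_hom_additive[OF F_module T_module coset_hom])
  have "u \<ominus>\<^bsub>F\<^esub> v \<in> K"
    using assms(1) submodule_span_superset[OF F_module relations_closed]
    by (auto simp: tensor_kernel_def)
  then have "K +>\<^bsub>F\<^esub> (u \<ominus>\<^bsub>F\<^esub> v) = \<zero>\<^bsub>T\<^esub>"
    using assms quotient_module_eq_zero_iff[OF F_module K_submodule] by (simp add: T_eq)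
  then have "(K +>\<^bsub>F\<^esub> u) \<ominus>\<^bsub>T\<^esub> (K +>\<^bsub>F\<^esub> v) = \<zero>\<^bsub>T\<^esub>"
    using assms by (simp add: F.M.minus_eq T.M.minus_eq)
  then show ?thesis using assms p.hom_closed T.M.add.inv_equality T.M.minus_eq T.M.minus_minus T.M.a_inv_closed by metis
qed

lemma pure_closed [simp]: "m \<in> carrier M \<Longrightarrow> n \<in> carrier N \<Longrightarrow> m \<^bold>\<otimes> n \<in> carrier T"
  using coset_hom e_closed unfolding module_hom_def pure_tensor_def by blast

lemma coset_simps:
  assumes "u \<in> carrier F" "v \<in> carrier F"
  shows "K +>\<^bsub>F\<^esub> (u \<oplus>\<^bsub>F\<^esub> v) = (K +>\<^bsub>F\<^esub> u) \<oplus>\<^bsub>T\<^esub> (K +>\<^bsub>F\<^esub> v)"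
    and "a \<in> carrier A \<Longrightarrow> K +>\<^bsub>F\<^esub> (a \<odot>\<^bsub>F\<^esub> u) = a \<odot>\<^bsub>T\<^esub> (K +>\<^bsub>F\<^esub> u)"
  using assms coset_hom unfolding module_hom_def by blast+

lemma pure_bilinear: "bilinear A M N T (\<lambda>m n. m \<^bold>\<otimes> n)"
proof -
  interpret F: Module.module A F by (rule F_module)
  show ?thesis
  proof (rule bilinearI)
    fix m m' n assume *: "m \<in> carrier M" "m' \<in> carrier M" "n \<in> carrier N"
    have "K +>\<^bsub>F\<^esub> e (m \<oplus>\<^bsub>M\<^esub> m') n = K +>\<^bsub>F\<^esub> (e m n \<oplus>\<^bsub>F\<^esub> e m' n)"
      by (rule coset_eqI) (use * in \<open>auto simp: bilinear_relations_def Let_def\<close>)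
    then show "(m \<oplus>\<^bsub>M\<^esub> m') \<^bold>\<otimes> n = m \<^bold>\<otimes> n \<oplus>\<^bsub>T\<^esub> m' \<^bold>\<otimes> n"
      using * by (simp add: pure_tensor_def coset_simps)
  next
    fix m n n' assume *: "m \<in> carrier M" "n \<in> carrier N" "n' \<in> carrier N"
    have "K +>\<^bsub>F\<^esub> e m (n \<oplus>\<^bsub>N\<^esub> n') = K +>\<^bsub>F\<^esub> (e m n \<oplus>\<^bsub>F\<^esub> e m n')"
      by (rule coset_eqI) (use * in \<open>auto simp: bilinear_relations_def Let_def\<close>)
    then show "m \<^bold>\<otimes> (n \<oplus>\<^bsub>N\<^esub> n') = m \<^bold>\<otimes> n \<oplus>\<^bsub>T\<^esub> m \<^bold>\<otimes> n'"
      using * by (simp add: pure_tensor_def coset_simps)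
  next
    fix a m n assume *: "a \<in> carrier A" "m \<in> carrier M" "n \<in> carrier N"
    have "K +>\<^bsub>F\<^esub> e (a \<odot>\<^bsub>M\<^esub> m) n = K +>\<^bsub>F\<^esub> (a \<odot>\<^bsub>F\<^esub> e m n)"
      by (rule coset_eqI) (use * in \<open>auto simp: bilinear_relations_def Let_def\<close>)
    then show "(a \<odot>\<^bsub>M\<^esub> m) \<^bold>\<otimes> n = a \<odot>\<^bsub>T\<^esub> (m \<^bold>\<otimes> n)"
      using * by (simp add: pure_tensor_def coset_simps(2)[OF e_closed e_closed])
    have "K +>\<^bsub>F\<^esub> e m (a \<odot>\<^bsub>N\<^esub> n) = K +>\<^bsub>F\<^esub> (a \<odot>\<^bsub>F\<^esub> e m n)"
      by (rule coset_eqI) (use * in \<open>auto simp: bilinear_relations_def Let_def\<close>)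
    then show "m \<^bold>\<otimes> (a \<odot>\<^bsub>N\<^esub> n) = a \<odot>\<^bsub>T\<^esub> (m \<^bold>\<otimes> n)"
      using * by (simp add: pure_tensor_def coset_simps(2)[OF e_closed e_closed])
  qed simp
qed

lemmas pure_add_left = bilinearD(2)[OF pure_bilinear]
lemmas pure_add_right = bilinearD(3)[OF pure_bilinear]
lemmas pure_smult_left = bilinearD(4)[OF pure_bilinear]
lemmas pure_smult_right = bilinearD(5)[OF pure_bilinear]

lemma pure_left_hom: "n \<in> carrier N \<Longrightarrow> (\<lambda>m. m \<^bold>\<otimes> n) \<in> module_hom A M T"
  by (auto simp: module_hom_def pure_add_left pure_smult_left)

lemma pure_right_hom: "m \<in> carrier M \<Longrightarrow> (\<lambda>n. m \<^bold>\<otimes> n) \<in> module_hom A N T"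
  by (auto simp: module_hom_def pure_add_right pure_smult_right)

text \<open>Scalars can be absorbed into the first factor, so every tensor is a plain sum of pure ones.\<close>

lemma tensor_induct [consumes 1, case_names zero add]:
  assumes "t \<in> carrier T"
    and zero: "Q \<zero>\<^bsub>T\<^esub>"
    and add: "\<And>m n t. m \<in> carrier M \<Longrightarrow> n \<in> carrier N \<Longrightarrow> t \<in> carrier T \<Longrightarrow> Q t \<Longrightarrow> Q (m \<^bold>\<otimes> n \<oplus>\<^bsub>T\<^esub> t)"
  shows "Q t"
proof -
  interpret F: Module.module A F by (rule F_module)
  interpret p: abelian_group_hom F T "\<lambda>x. K +>\<^bsub>F\<^esub> x"
    by (rule module_hom_additive[OF F_module T_module coset_hom])
  obtain c where "c \<in> carrier F" "t = K +>\<^bsub>F\<^esub> c"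
    using assms(1) quotient_module_cases[OF F_module K_submodule] by (auto simp: T_eq)
  moreover have "Q (K +>\<^bsub>F\<^esub> c)" if "c \<in> carrier F"
    using M.R.cring_axioms that
  proof (induction rule: free_module_induct)
    case zero
    then show ?case using assms(2) by simp
  next
    case (add a j c)
    obtain m n where j: "j = (m, n)" "m \<in> carrier M" "n \<in> carrier N" using add.hyps by blast
    have "K +>\<^bsub>F\<^esub> (a \<odot>\<^bsub>F\<^esub> e m n \<oplus>\<^bsub>F\<^esub> c) = (K +>\<^bsub>F\<^esub> (a \<odot>\<^bsub>F\<^esub> e m n)) \<oplus>\<^bsub>T\<^esub> (K +>\<^bsub>F\<^esub> c)"
      using j add.hyps by (simp add: coset_simps(1))
    also have "K +>\<^bsub>F\<^esub> (a \<odot>\<^bsub>F\<^esub> e m n) = a \<odot>\<^bsub>T\<^esub> (m \<^bold>\<otimes> n)"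
      using j add.hyps by (simp add: coset_simps(2)[OF e_closed e_closed] pure_tensor_def)
    also have "\<dots> = (a \<odot>\<^bsub>M\<^esub> m) \<^bold>\<otimes> n"
      using j add.hyps by (simp add: pure_smult_left)
    finally have "K +>\<^bsub>F\<^esub> (a \<odot>\<^bsub>F\<^esub> e m n \<oplus>\<^bsub>F\<^esub> c) = (a \<odot>\<^bsub>M\<^esub> m) \<^bold>\<otimes> n \<oplus>\<^bsub>T\<^esub> (K +>\<^bsub>F\<^esub> c)" .
    then show ?case using assms(3) j add by simp
  qed
  ultimately show ?thesis by simp
qed

text \<open>The linear extension of a bilinear map to the free module kills the defining relations and
  hence is constant on cosets; this is what makes \<open>tensor_lift\<close> meaningful.\<close>

lemma tensor_lift_coset:
  fixes P :: "('r, 'p) module"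
  assumes P: "Module.module A P" and \<beta>: "bilinear A M N P \<beta>" and c: "c \<in> carrier F"
  shows "tensor_lift A M N P \<beta> (K +>\<^bsub>F\<^esub> c) = free_lift A J P (\<lambda>q. \<beta> (fst q) (snd q)) c"
proof -
  interpret F: Module.module A F by (rule F_module)
  interpret P: Module.module A P by fact
  let ?h = "free_lift A J P (\<lambda>q. \<beta> (fst q) (snd q))"
  have \<beta>': "(\<lambda>q. \<beta> (fst q) (snd q)) \<in> J \<rightarrow> carrier P" using bilinearD(1)[OF \<beta>] by auto
  note h = free_lift_hom[OF P \<beta>']
  interpret h: abelian_group_hom F P ?h by (rule module_hom_additive[OF F_module P h])
  have he: "?h (e m n) = \<beta> m n" if "m \<in> carrier M" "n \<in> carrier N" for m n
    using free_lift_basis_vector[OF P \<beta>', of "(m, n)"] that by simp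
  note hs = module_hom_smult[OF h]
  have "bilinear_relations A M N \<subseteq> {c \<in> carrier F. ?h c = \<zero>\<^bsub>P\<^esub>}"
    using relations_closed bilinearD[OF \<beta>]
    by (auto simp: bilinear_relations_def Let_def F.M.minus_eq he hs P.M.r_neg)
  then have K0: "K \<subseteq> {c \<in> carrier F. ?h c = \<zero>\<^bsub>P\<^esub>}"
    unfolding tensor_kernel_def
    by (intro submodule_span_least F_module relations_closed submodule_kernel[OF F_module P h])
  have "?h d = ?h c" if "d \<in> K +>\<^bsub>F\<^esub> c" for d
    using that K0 c by (auto simp: a_r_coset_def')
  moreover have "c \<in> K +>\<^bsub>F\<^esub> c"
  proof -
    have "\<zero>\<^bsub>F\<^esub> \<in> K" using submodule.axioms(1)[OF K_submodule] subgroup.one_closed by fastforce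
    then show ?thesis using c by (force simp: a_r_coset_def')
  qed
  ultimately have "?h ` (K +>\<^bsub>F\<^esub> c) = {?h c}" by blast
  moreover have "tensor_lift A M N P \<beta> (K +>\<^bsub>F\<^esub> c) = the_elem (?h ` (K +>\<^bsub>F\<^esub> c))"
    by (simp add: tensor_lift_def free_lift_def)
  ultimately show ?thesis by simp
qed

lemma tensor_lift:
  fixes P :: "('r, 'p) module"
  assumes P: "Module.module A P" and \<beta>: "bilinear A M N P \<beta>"
  shows tensor_lift_hom: "tensor_lift A M N P \<beta> \<in> module_hom A T P"
    and tensor_lift_pure:
      "\<And>m n. m \<in> carrier M \<Longrightarrow> n \<in> carrier N \<Longrightarrow> tensor_lift A M N P \<beta> (m \<^bold>\<otimes> n) = \<beta> m n"
proof -
  interpret F: Module.module A F by (rule F_module)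
  let ?h = "free_lift A J P (\<lambda>q. \<beta> (fst q) (snd q))"
  have \<beta>': "(\<lambda>q. \<beta> (fst q) (snd q)) \<in> J \<rightarrow> carrier P" using bilinearD(1)[OF \<beta>] by auto
  note h = free_lift_hom[OF P \<beta>']
  note eq = tensor_lift_coset[OF P \<beta>]
  have cases: thesis if "t \<in> carrier T" "\<And>c. c \<in> carrier F \<Longrightarrow> t = K +>\<^bsub>F\<^esub> c \<Longrightarrow> thesis" for t thesis
    using that quotient_module_cases[OF F_module K_submodule] by (auto simp: T_eq)
  show "tensor_lift A M N P \<beta> \<in> module_hom A T P"
    using h unfolding module_hom_def
    by (auto elim!: cases simp: eq F.M.a_closed coset_simps[symmetric]) 
  show "tensor_lift A M N P \<beta> (m \<^bold>\<otimes> n) = \<beta> m n" if "m \<in> carrier M" "n \<in> carrier N" for m n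
    using free_lift_basis_vector[OF P \<beta>', of "(m, n)"] that by (simp add: pure_tensor_def eq)
qed

lemma tensor_sum_cases:
  assumes "t \<in> carrier T"
  obtains k :: nat and m n where "m \<in> {..<k} \<rightarrow> carrier M" "n \<in> {..<k} \<rightarrow> carrier N"
    "t = (\<Oplus>\<^bsub>T\<^esub>i\<in>{..<k}. m i \<^bold>\<otimes> n i)"
proof -
  have "\<exists>(k::nat) m n. m \<in> {..<k} \<rightarrow> carrier M \<and> n \<in> {..<k} \<rightarrow> carrier N \<and> t = (\<Oplus>\<^bsub>T\<^esub>i\<in>{..<k}. m i \<^bold>\<otimes> n i)"
    using assms
  proof (induction rule: tensor_induct)
    case zero
    show ?case by (rule exI[of _ 0]) simp
  next
    case (add m0 n0 t)
    then obtain k :: nat and m n where kmn: "m \<in> {..<k} \<rightarrow> carrier M" "n \<in> {..<k} \<rightarrow> carrier N"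
      "t = (\<Oplus>\<^bsub>T\<^esub>i\<in>{..<k}. m i \<^bold>\<otimes> n i)" by blast
    let ?m = "m(k := m0)" and ?n = "n(k := n0)"
    have mem: "?m \<in> {..<Suc k} \<rightarrow> carrier M" "?n \<in> {..<Suc k} \<rightarrow> carrier N"
      using kmn add.hyps by (auto simp: less_Suc_eq Pi_iff)
    then have "(\<Oplus>\<^bsub>T\<^esub>i\<in>{..<Suc k}. ?m i \<^bold>\<otimes> ?n i) = ?m k \<^bold>\<otimes> ?n k \<oplus>\<^bsub>T\<^esub> (\<Oplus>\<^bsub>T\<^esub>i\<in>{..<k}. ?m i \<^bold>\<otimes> ?n i)"
      by (intro T.M.finsum_lessThan_Suc) (auto simp: Pi_iff)
    also have "(\<Oplus>\<^bsub>T\<^esub>i\<in>{..<k}. ?m i \<^bold>\<otimes> ?n i) = t"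
      unfolding kmn(3) using kmn(1,2) by (intro T.M.finsum_cong') (auto simp: Pi_iff)
    finally show ?case using mem by (intro exI[of _ "Suc k"] exI[of _ ?m] exI[of _ ?n]) auto
  qed
  then show thesis using that by blast
qed

end

lemma tensor_map:
  fixes A :: "'r ring"
  assumes "Module.module A M" "Module.module A M'" "Module.module A N" and g: "g \<in> module_hom A M M'"
  shows tensor_map_hom: "tensor_map A M M' N g \<in> module_hom A (tensor A M N) (tensor A M' N)"
    and tensor_map_pure: "\<And>m n. m \<in> carrier M \<Longrightarrow> n \<in> carrier N \<Longrightarrow>
      tensor_map A M M' N g (pure_tensor A M N m n) = pure_tensor A M' N (g m) n"
proof -
  interpret T: tensor_product A M N using assms by (simp add: tensor_product_def)
  interpret T': tensor_product A M' N using assms by (simp add: tensor_product_def)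
  have g': "\<And>m. m \<in> carrier M \<Longrightarrow> g m \<in> carrier M'"
    "\<And>m m'. m \<in> carrier M \<Longrightarrow> m' \<in> carrier M \<Longrightarrow> g (m \<oplus>\<^bsub>M\<^esub> m') = g m \<oplus>\<^bsub>M'\<^esub> g m'"
    "\<And>a m. a \<in> carrier A \<Longrightarrow> m \<in> carrier M \<Longrightarrow> g (a \<odot>\<^bsub>M\<^esub> m) = a \<odot>\<^bsub>M'\<^esub> g m"
    using g by (auto simp: module_hom_def)
  have \<beta>: "bilinear A M N T'.T (\<lambda>m n. T'.pure (g m) n)"
    by (rule bilinearI) (simp_all add: g' T'.pure_add_left T'.pure_smult_left
        T'.pure_add_right T'.pure_smult_right)
  show "tensor_map A M M' N g \<in> module_hom A T.T T'.T"
    unfolding tensor_map_def by (rule T.tensor_lift_hom[OF T'.T_module \<beta>])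
  show "tensor_map A M M' N g (T.pure m n) = T'.pure (g m) n" if "m \<in> carrier M" "n \<in> carrier N" for m n
    unfolding tensor_map_def by (rule T.tensor_lift_pure[OF T'.T_module \<beta> that])
qed

text \<open>Needed to compare tensor products over different rings: a tensor product over the larger ring
  has to serve as the target of a map that is bilinear over the smaller one.\<close>

definition restrict_scalars :: "('r \<Rightarrow> 's) \<Rightarrow> ('s, 'm) module \<Rightarrow> ('r, 'm) module" where
  "restrict_scalars \<sigma> M =
    \<lparr>carrier = carrier M, mult = mult M, one = one M, zero = zero M, add = add M,
     smult = (\<lambda>a. smult M (\<sigma> a))\<rparr>"

lemma restrict_scalars_module:
  assumes "cring A" "\<sigma> \<in> ring_hom A B" "Module.module B M"
  shows "Module.module A (restrict_scalars \<sigma> M)"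
proof -
  interpret M: Module.module B M by fact
  note h = ring_hom_closed[OF assms(2)] ring_hom_add[OF assms(2)] ring_hom_mult[OF assms(2)]
    ring_hom_one[OF assms(2)]
  have "abelian_group (restrict_scalars \<sigma> M)"
  proof (rule abelian_groupI)
    fix x assume "x \<in> carrier (restrict_scalars \<sigma> M)"
    then show "\<exists>y\<in>carrier (restrict_scalars \<sigma> M).
        y \<oplus>\<^bsub>restrict_scalars \<sigma> M\<^esub> x = \<zero>\<^bsub>restrict_scalars \<sigma> M\<^esub>"
      by (intro bexI[of _ "\<ominus>\<^bsub>M\<^esub> x"]) (auto simp: restrict_scalars_def M.l_neg)
  qed (auto simp: restrict_scalars_def M.M.a_ac)
  then show ?thesis
    by (intro moduleI)
      (auto simp: restrict_scalars_def h assms(1) M.smult_l_distr M.smult_r_distr M.smult_assoc1)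
qed

text \<open>This covers both a change of rings (\<open>u\<close>, \<open>v\<close> and \<open>w\<close> are identities) and the transport along an
  isomorphism. The maps \<open>u\<close> and \<open>v\<close> induce a map \<open>p\<close> between the two tensor products, which is
  surjective as they are, and the two lifts form a commutative square with \<open>p\<close> and the bijection \<open>w\<close>.
  If the first lift is bijective then \<open>p\<close> is injective, hence bijective, and so is the second lift.\<close>

lemma tensor_lift_bij_transfer:
  fixes A :: "'r ring" and A' :: "'s ring"
  assumes "Module.module A M" "Module.module A N" "Module.module A P"
    and "Module.module A' M'" "Module.module A' N'" "Module.module A' P'"
    and \<beta>: "bilinear A M N P \<beta>" and \<beta>': "bilinear A' M' N' P' \<beta>'"
    and \<sigma>: "\<sigma> \<in> ring_hom A A'"
    and u: "abelian_group_hom M M' u" "u ` carrier M = carrier M'"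
      "\<And>a m. a \<in> carrier A \<Longrightarrow> m \<in> carrier M \<Longrightarrow> u (a \<odot>\<^bsub>M\<^esub> m) = \<sigma> a \<odot>\<^bsub>M'\<^esub> u m"
    and v: "abelian_group_hom N N' v" "v ` carrier N = carrier N'"
      "\<And>a n. a \<in> carrier A \<Longrightarrow> n \<in> carrier N \<Longrightarrow> v (a \<odot>\<^bsub>N\<^esub> n) = \<sigma> a \<odot>\<^bsub>N'\<^esub> v n"
    and w: "abelian_group_hom P P' w" "bij_betw w (carrier P) (carrier P')"
    and comm: "\<And>m n. m \<in> carrier M \<Longrightarrow> n \<in> carrier N \<Longrightarrow> \<beta>' (u m) (v n) = w (\<beta> m n)"
    and bij: "bij_betw (tensor_lift A M N P \<beta>) (carrier (tensor A M N)) (carrier P)"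
  shows "bij_betw (tensor_lift A' M' N' P' \<beta>') (carrier (tensor A' M' N')) (carrier P')"
proof -
  interpret T: tensor_product A M N using assms by (simp add: tensor_product_def)
  interpret T': tensor_product A' M' N' using assms by (simp add: tensor_product_def)
  interpret P: Module.module A P by fact
  interpret P': Module.module A' P' by fact
  interpret u: abelian_group_hom M M' u by fact
  interpret v: abelian_group_hom N N' v by fact
  interpret w: abelian_group_hom P P' w by fact
  let ?R = "restrict_scalars \<sigma> T'.T"
  have R: "Module.module A ?R"
    by (intro restrict_scalars_module[OF _ \<sigma>] T'.T_module T.M.R.cring_axioms)
  have R_simps: "carrier ?R = carrier T'.T" "add ?R = add T'.T" "zero ?R = zero T'.T"
    "smult ?R = (\<lambda>a. smult T'.T (\<sigma> a))"
    by (simp_all add: restrict_scalars_def)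
  have \<gamma>: "bilinear A M N ?R (\<lambda>m n. T'.pure (u m) (v n))"
    by (rule bilinearI) (simp_all add: R_simps u(3) v(3) ring_hom_closed[OF \<sigma>]
        T'.pure_add_left T'.pure_smult_left T'.pure_add_right T'.pure_smult_right)
  define p where "p = tensor_lift A M N ?R (\<lambda>m n. T'.pure (u m) (v n))"
  have p_pure: "p (T.pure m n) = T'.pure (u m) (v n)" if "m \<in> carrier M" "n \<in> carrier N" for m n
    unfolding p_def by (rule T.tensor_lift_pure[OF R \<gamma> that])
  have p_hom: "p \<in> module_hom A T.T ?R"
    unfolding p_def by (rule T.tensor_lift_hom[OF R \<gamma>])
  have "abelian_group_hom T.T ?R p" by (rule module_hom_additive[OF T.T_module R p_hom])
  note p = abelian_group_hom.hom_add[OF this, unfolded R_simps]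
    abelian_group_hom.hom_zero[OF this, unfolded R_simps]
    abelian_group_hom.hom_closed[OF this, unfolded R_simps]
  interpret l: abelian_group_hom T.T P "tensor_lift A M N P \<beta>"
    by (rule module_hom_additive[OF T.T_module _ T.tensor_lift_hom]) fact+
  interpret l': abelian_group_hom T'.T P' "tensor_lift A' M' N' P' \<beta>'"
    by (rule module_hom_additive[OF T'.T_module _ T'.tensor_lift_hom]) fact+
  have surj: "t \<in> p ` carrier T.T" if "t \<in> carrier T'.T" for t
    using that
  proof (induction rule: T'.tensor_induct)
    case zero
    show ?case using p(2) T.T.M.zero_closed by (metis image_eqI)
  next
    case (add m' n' t)
    then obtain m n s where "m \<in> carrier M" "m' = u m" "n \<in> carrier N" "n' = v n"
      "s \<in> carrier T.T" "t = p s"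
      using u(2) v(2) by blast
    then show ?case by (intro image_eqI[of _ _ "T.pure m n \<oplus>\<^bsub>T.T\<^esub> s"]) (simp_all add: p p_pure)
  qed
  have eq: "tensor_lift A' M' N' P' \<beta>' (p t) = w (tensor_lift A M N P \<beta> t)" if "t \<in> carrier T.T" for t
    using that
  proof (induction rule: T.tensor_induct)
    case zero
    show ?case by (simp add: p)
  next
    case (add m n t)
    then show ?case
      using T.tensor_lift_pure[OF assms(3) \<beta>] T'.tensor_lift_pure[OF assms(6) \<beta>'] comm
      by (simp add: p p_pure l.hom_closed p(3) bilinearD(1)[OF \<beta>])
  qed
  have "bij_betw (w \<circ> tensor_lift A M N P \<beta>) (carrier T.T) (carrier P')"
    using bij w(2) by (rule bij_betw_trans)
  then have b: "bij_betw (tensor_lift A' M' N' P' \<beta>' \<circ> p) (carrier T.T) (carrier P')"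
    by (rule bij_betw_cong[THEN iffD1, rotated]) (simp add: eq)
  then have "inj_on p (carrier T.T)"
    by (auto simp: bij_betw_def dest: inj_on_imageI2)
  then have "bij_betw p (carrier T.T) (carrier T'.T)"
    using surj p(3) by (auto simp: bij_betw_def)
  then show ?thesis using b bij_betw_comp_iff by blast
qed

section \<open>Linear combinations of families of scalars\<close>

text \<open>The families \<open>I \<rightarrow> N\<close> in the additive span of the products \<open>i \<mapsto> r i \<cdot> x\<close> with \<open>r \<in> R\<close> and \<open>x \<in> N\<close>.
  An inductive definition avoids matrices of coefficients: maps out of the span are handled by
  rule induction, and only values on \<open>I\<close> count.\<close>

inductive lin_comb :: "('r, 'n) module \<Rightarrow> 'i set \<Rightarrow> ('i \<Rightarrow> 'r) set \<Rightarrow> ('i \<Rightarrow> 'n) \<Rightarrow> bool"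
  for N :: "('r, 'n) module" and I :: "'i set" and R :: "('i \<Rightarrow> 'r) set" where
  zero: "(\<And>i. i \<in> I \<Longrightarrow> t i = \<zero>\<^bsub>N\<^esub>) \<Longrightarrow> lin_comb N I R t"
| step: "lin_comb N I R t \<Longrightarrow> r \<in> R \<Longrightarrow> x \<in> carrier N \<Longrightarrow>
    (\<And>i. i \<in> I \<Longrightarrow> t' i = t i \<oplus>\<^bsub>N\<^esub> r i \<odot>\<^bsub>N\<^esub> x) \<Longrightarrow> lin_comb N I R t'"

lemma lin_comb_mono: "lin_comb N I R t \<Longrightarrow> R \<subseteq> R' \<Longrightarrow> lin_comb N I R' t"
  by (induction rule: lin_comb.induct) (auto intro: lin_comb.intros)

lemma lin_comb_cong: "lin_comb N I R t \<Longrightarrow> (\<And>i. i \<in> I \<Longrightarrow> t' i = t i) \<Longrightarrow> lin_comb N I R t'"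
  by (erule lin_comb.cases) (auto intro: lin_comb.intros)

lemma lin_comb_closed:
  assumes "Module.module A N" "R \<subseteq> I \<rightarrow> carrier A" "lin_comb N I R t" "i \<in> I"
  shows "t i \<in> carrier N"
proof -
  interpret N: Module.module A N by fact
  show ?thesis using assms(3,4)
  proof (induction rule: lin_comb.induct)
    case (step t r x t')
    moreover have "r i \<in> carrier A" using step assms(2) by auto
    ultimately show ?case by auto
  qed simp
qed

text \<open>Spans are compatible with semilinear maps of the values, in particular with changes of the type
  of the ring and of the module.\<close>

lemma lin_comb_map:
  fixes N :: "('r, 'n) module" and N' :: "('s, 'k) module"
  assumes "Module.module A N" "Module.module B N'" "R \<subseteq> I \<rightarrow> carrier A"
    and h: "abelian_group_hom N N' h"
    and \<pi>: "\<And>i. i \<in> I' \<Longrightarrow> \<pi> i \<in> I"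
    and \<tau>: "\<And>r. r \<in> R \<Longrightarrow> \<tau> r \<in> R'"
    and comm: "\<And>r x i. r \<in> R \<Longrightarrow> x \<in> carrier N \<Longrightarrow> i \<in> I' \<Longrightarrow> h (r (\<pi> i) \<odot>\<^bsub>N\<^esub> x) = \<tau> r i \<odot>\<^bsub>N'\<^esub> h x"
    and "lin_comb N I R t"
  shows "lin_comb N' I' R' (\<lambda>i. h (t (\<pi> i)))"
  using assms(8)
proof (induction rule: lin_comb.induct)
  interpret h: abelian_group_hom N N' h by fact
  {
    case (zero t)
    then show ?case by (intro lin_comb.zero) (simp add: \<pi>)
  next
    interpret N: Module.module A N by fact
    case (step t r x t')
    have "h (t' (\<pi> i)) = h (t (\<pi> i)) \<oplus>\<^bsub>N'\<^esub> \<tau> r i \<odot>\<^bsub>N'\<^esub> h x" if "i \<in> I'" for i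
    proof -
      have "r (\<pi> i) \<in> carrier A" using step assms(3) \<pi>[OF that] by blast
      moreover have "t (\<pi> i) \<in> carrier N"
        using lin_comb_closed[OF assms(1,3) step.hyps(1) \<pi>[OF that]] .
      ultimately show ?thesis using step that by (simp add: \<pi> comm[symmetric])
    qed
    then show ?case
      by (intro lin_comb.step[OF step.IH \<tau>[OF step.hyps(2)] h.hom_closed[OF step.hyps(3)]])
  }
qed

lemma lin_comb_add:
  assumes "Module.module A N" "R \<subseteq> I \<rightarrow> carrier A" "lin_comb N I R t" "lin_comb N I R u"
  shows "lin_comb N I R (\<lambda>i. t i \<oplus>\<^bsub>N\<^esub> u i)"
  using assms(4)
proof (induction rule: lin_comb.induct)
  interpret N: Module.module A N by fact
  note closed = lin_comb_closed[OF assms(1,2)]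
  {
    case (zero u)
    then show ?case using assms(3) closed[OF assms(3)] by (auto intro: lin_comb_cong)
  next
    case (step u r x u')
    have "t i \<oplus>\<^bsub>N\<^esub> u' i = (t i \<oplus>\<^bsub>N\<^esub> u i) \<oplus>\<^bsub>N\<^esub> r i \<odot>\<^bsub>N\<^esub> x" if "i \<in> I" for i
    proof -
      have "r i \<in> carrier A" using step assms(2) that by blast
      then show ?thesis using step that closed[OF assms(3) that] closed[OF step.hyps(1) that]
        by (simp add: N.M.a_assoc)
    qed
    then show ?case by (rule lin_comb.step[OF step.IH step.hyps(2,3)])
  }
qed

lemma lin_comb_smult:
  assumes "Module.module A N" "R \<subseteq> I \<rightarrow> carrier A" "lin_comb N I R t" "a \<in> carrier A"
  shows "lin_comb N I R (\<lambda>i. a \<odot>\<^bsub>N\<^esub> t i)"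
proof -
  interpret N: Module.module A N by fact
  show ?thesis
  proof (rule lin_comb_map[OF assms(1,1,2) _ _ _ _ assms(3), where \<tau> = "\<lambda>r. r"])
    show "abelian_group_hom N N ((\<odot>\<^bsub>N\<^esub>) a)"
      using assms(4) by (intro additive_mapI) (auto simp: N.smult_r_distr N.M.abelian_group_axioms)
    fix r x i assume "r \<in> R" "x \<in> carrier N" "i \<in> I"
    moreover then have "r i \<in> carrier A" using assms(2) by blast
    ultimately show "a \<odot>\<^bsub>N\<^esub> (r i \<odot>\<^bsub>N\<^esub> x) = r i \<odot>\<^bsub>N\<^esub> (a \<odot>\<^bsub>N\<^esub> x)"
      using assms(4) by (simp flip: N.smult_assoc1 add: N.R.m_comm)
  qed auto
qed

lemma lin_comb_explicit:
  assumes "Module.module A N" "R \<subseteq> I \<rightarrow> carrier A" "lin_comb N I R t"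
  obtains k :: nat and r x where "r \<in> {..<k} \<rightarrow> R" "x \<in> {..<k} \<rightarrow> carrier N"
    "\<And>i. i \<in> I \<Longrightarrow> t i = (\<Oplus>\<^bsub>N\<^esub>j\<in>{..<k}. r j i \<odot>\<^bsub>N\<^esub> x j)"
proof -
  interpret N: Module.module A N by fact
  have "\<exists>(k::nat) r x. r \<in> {..<k} \<rightarrow> R \<and> x \<in> {..<k} \<rightarrow> carrier N \<and>
    (\<forall>i\<in>I. t i = (\<Oplus>\<^bsub>N\<^esub>j\<in>{..<k}. r j i \<odot>\<^bsub>N\<^esub> x j))"
    using assms(3)
  proof (induction rule: lin_comb.induct)
    case (zero t)
    then show ?case by (intro exI[of _ 0]) simp
  next
    case (step t r0 x0 t')
    then obtain k :: nat and r x where krx: "r \<in> {..<k} \<rightarrow> R" "x \<in> {..<k} \<rightarrow> carrier N"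
      "\<And>i. i \<in> I \<Longrightarrow> t i = (\<Oplus>\<^bsub>N\<^esub>j\<in>{..<k}. r j i \<odot>\<^bsub>N\<^esub> x j)" by blast
    let ?r = "r(k := r0)" and ?x = "x(k := x0)"
    have mem: "?r \<in> {..<Suc k} \<rightarrow> R" "?x \<in> {..<Suc k} \<rightarrow> carrier N"
      using krx step.hyps by (auto simp: less_Suc_eq Pi_iff)
    have "t' i = (\<Oplus>\<^bsub>N\<^esub>j\<in>{..<Suc k}. ?r j i \<odot>\<^bsub>N\<^esub> ?x j)" if i: "i \<in> I" for i
    proof -
      have RA: "s i \<in> carrier A" if "s \<in> R" for s using assms(2) i that by blast
      have c: "r j i \<odot>\<^bsub>N\<^esub> x j \<in> carrier N" if "j < k" for j
        using krx(1,2) that RA by (auto simp: Pi_iff)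
      have "(\<Oplus>\<^bsub>N\<^esub>j\<in>{..<Suc k}. ?r j i \<odot>\<^bsub>N\<^esub> ?x j) =
          ?r k i \<odot>\<^bsub>N\<^esub> ?x k \<oplus>\<^bsub>N\<^esub> (\<Oplus>\<^bsub>N\<^esub>j\<in>{..<k}. ?r j i \<odot>\<^bsub>N\<^esub> ?x j)"
        using mem RA by (intro N.M.finsum_lessThan_Suc) (auto simp: Pi_iff)
      also have "(\<Oplus>\<^bsub>N\<^esub>j\<in>{..<k}. ?r j i \<odot>\<^bsub>N\<^esub> ?x j) = (\<Oplus>\<^bsub>N\<^esub>j\<in>{..<k}. r j i \<odot>\<^bsub>N\<^esub> x j)"
        using c by (intro N.M.finsum_cong') auto
      finally show ?thesis
        using step.hyps(2-4) i krx(3)[OF i] c RA N.M.finsum_closed[of "\<lambda>j. r j i \<odot>\<^bsub>N\<^esub> x j" "{..<k}"]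
        by (simp add: N.M.a_comm Pi_iff)
    qed
    then show ?case using mem by blast
  qed
  then show thesis using that by blast
qed

section \<open>Equational flatness\<close>

abbreviation self_module :: "'r ring \<Rightarrow> ('r, 'r) module" where
  "self_module A \<equiv> module_along (\<lambda>a. a) A"

definition relations :: "'r ring \<Rightarrow> 'i set \<Rightarrow> ('r, 'm) module \<Rightarrow> ('i \<Rightarrow> 'm) \<Rightarrow> ('i \<Rightarrow> 'r) set" where
  "relations A I M m = {r \<in> I \<rightarrow> carrier A. (\<Oplus>\<^bsub>M\<^esub>i\<in>I. r i \<odot>\<^bsub>M\<^esub> m i) = \<zero>\<^bsub>M\<^esub>}"

text \<open>The equational criterion for flatness: the relations that hold in \<open>N\<close> between elements of \<open>A\<close>
  come from relations that hold in \<open>A\<close>. It mentions no module besides \<open>N\<close>, so it makes sense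
  independently of the type in which test modules have their elements.\<close>

definition equationally_flat :: "'r ring \<Rightarrow> ('r, 'n) module \<Rightarrow> bool" where
  "equationally_flat A N \<longleftrightarrow>
    (\<forall>(k::nat) a n. a \<in> {..<k} \<rightarrow> carrier A \<longrightarrow> n \<in> {..<k} \<rightarrow> carrier N \<longrightarrow>
       (\<Oplus>\<^bsub>N\<^esub>i\<in>{..<k}. a i \<odot>\<^bsub>N\<^esub> n i) = \<zero>\<^bsub>N\<^esub> \<longrightarrow>
       lin_comb N {..<k} (relations A {..<k} (self_module A) a) n)"

lemma equationally_flatD:
  assumes "equationally_flat A N" "a \<in> {..<k::nat} \<rightarrow> carrier A" "n \<in> {..<k} \<rightarrow> carrier N"
    "(\<Oplus>\<^bsub>N\<^esub>i\<in>{..<k}. a i \<odot>\<^bsub>N\<^esub> n i) = \<zero>\<^bsub>N\<^esub>"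
  shows "lin_comb N {..<k} (relations A {..<k} (self_module A) a) n"
  using assms unfolding equationally_flat_def by blast

lemma finsum_self_module: "finsum (module_along \<phi> B) = finsum B"
  by (intro ext) (simp add: finsum_def finprod_def)

lemma submodule_finsum:
  assumes "Module.module A M" "submodule H A M" "finite I" "f \<in> I \<rightarrow> H"
  shows "(\<Oplus>\<^bsub>M\<^esub>i\<in>I. f i) \<in> H"
proof -
  interpret M: Module.module A M by fact
  note E = M.submoduleE[OF assms(2)]
  have zero: "\<zero>\<^bsub>M\<^esub> \<in> H" 
    using submodule.axioms(1)[OF assms(2)] subgroup.one_closed by fastforce
  show ?thesis using assms(3,4)
  proof (induction I)
    case (insert i I)
    then have "(\<Oplus>\<^bsub>M\<^esub>i\<in>insert i I. f i) = f i \<oplus>\<^bsub>M\<^esub> (\<Oplus>\<^bsub>M\<^esub>i\<in>I. f i)"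
      using E(1) by (intro M.M.finsum_insert) auto
    then show ?case using insert E(5) by auto
  qed (simp add: zero)
qed

lemma finsupp_eval_hom:
  assumes "Module.module A N" "j \<in> J"
  shows "abelian_group_hom (finsupp_module N J) N (\<lambda>c. c j)"
  using assms(2) finsupp_module_module[OF assms(1), of J] assms(1)
  by (intro additive_mapI) (auto simp: finsupp_module_simps Module.module_def)

lemma free_eval_hom:
  assumes "cring A" "j \<in> J"
  shows "abelian_group_hom (free_module A J) A (\<lambda>c. c j)"
proof -
  interpret cring A by fact
  show ?thesis
    using assms(2) free_module_module[OF assms(1), of J] abelian_group_axioms
    by (intro additive_mapI) (auto simp: free_module_simps Module.module_def)
qed

text \<open>Let \<open>H\<close> be a submodule of the free module on \<open>J\<close>. Evaluation at \<open>q\<close> is a functional on \<open>H\<close>, with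
  kernel \<open>H'\<close>, and flatness of \<open>N\<close> turns the exact sequence \<open>H' \<rightarrow> H \<rightarrow> A\<close> into the statement that a family in \<open>H \<cdot> N\<close>
  vanishing at \<open>q\<close> lies in \<open>H' \<cdot> N\<close>. With \<open>\<phi> = \<Sum> c\<^sub>j x\<^sub>j\<close> the hypothesis reads \<open>\<Sum> c\<^sub>j(q) x\<^sub>j = 0\<close>; the
  criterion writes \<open>x\<close> through relations \<open>r\<close> between the scalars \<open>c\<^sub>j(q)\<close>, and for each of them
  \<open>\<Sum> r\<^sub>j c\<^sub>j\<close> is an element of \<open>H\<close> that vanishes at \<open>q\<close>.\<close>

lemma lin_comb_vanishing_at:
  fixes N :: "('r, 'n) module"
  assumes flat: "equationally_flat A N" and N: "Module.module A N"
    and H: "submodule H A (free_module A J)" and q: "q \<in> J"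
    and \<phi>: "lin_comb N J H \<phi>" "\<phi> q = \<zero>\<^bsub>N\<^esub>"
  shows "lin_comb N J {c \<in> H. c q = \<zero>\<^bsub>A\<^esub>} \<phi>"
proof -
  interpret N: Module.module A N by fact
  let ?F = "free_module A J"
  have F: "Module.module A ?F" by (rule free_module_module) (rule N.R.cring_axioms)
  interpret F: Module.module A ?F by fact
  note E = F.submoduleE[OF H]
  have HJ: "H \<subseteq> J \<rightarrow> carrier A" using E(1) by (fastforce simp: free_module_simps)
  obtain k :: nat and c x where c: "c \<in> {..<k} \<rightarrow> H" and x: "x \<in> {..<k} \<rightarrow> carrier N"
    and \<phi>_eq: "\<And>p. p \<in> J \<Longrightarrow> \<phi> p = (\<Oplus>\<^bsub>N\<^esub>j\<in>{..<k}. c j p \<odot>\<^bsub>N\<^esub> x j)"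
    by (rule lin_comb_explicit[OF N HJ \<phi>(1)], rule that, assumption, assumption, simp)
  let ?a = "\<lambda>j. c j q"
  let ?Rel = "relations A {..<k} (self_module A) ?a"
  have a: "?a \<in> {..<k} \<rightarrow> carrier A" using c HJ q by blast
  have x_comb: "lin_comb N {..<k} ?Rel x"
    by (rule equationally_flatD[OF flat a x]) (use \<phi>(2) \<phi>_eq[OF q] in simp)
  have "lin_comb N J {c \<in> H. c q = \<zero>\<^bsub>A\<^esub>} (\<lambda>p. \<Oplus>\<^bsub>N\<^esub>j\<in>{..<k}. c j p \<odot>\<^bsub>N\<^esub> y j)"
    if "lin_comb N {..<k} ?Rel y" for y
    using that
  proof (induction rule: lin_comb.induct)
    case (zero y)
    have "(\<Oplus>\<^bsub>N\<^esub>j\<in>{..<k}. c j p \<odot>\<^bsub>N\<^esub> y j) = \<zero>\<^bsub>N\<^esub>" if "p \<in> J" for p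
      using zero c HJ that by (intro N.M.add.finprod_one_eqI) (auto simp: Pi_iff subset_iff)
    then show ?case by (rule lin_comb.zero)
  next
    case (step y r z y')
    have r: "r \<in> {..<k} \<rightarrow> carrier A" "(\<Oplus>\<^bsub>A\<^esub>j\<in>{..<k}. r j \<otimes>\<^bsub>A\<^esub> ?a j) = \<zero>\<^bsub>A\<^esub>"
      using step.hyps(2) by (auto simp: relations_def finsum_self_module)
    define d where "d = (\<Oplus>\<^bsub>?F\<^esub>j\<in>{..<k}. r j \<odot>\<^bsub>?F\<^esub> c j)"
    have "d \<in> H" unfolding d_def using c r(1) E(4)
      by (intro submodule_finsum[OF F H]) (auto simp: Pi_iff)
    have d: "d p = (\<Oplus>\<^bsub>A\<^esub>j\<in>{..<k}. r j \<otimes>\<^bsub>A\<^esub> c j p)" if "p \<in> J" for p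
    proof -
      have "(\<lambda>j. r j \<odot>\<^bsub>?F\<^esub> c j) \<in> {..<k} \<rightarrow> carrier ?F"
        using c r(1) E(1) by (auto simp: Pi_iff)
      from abelian_group_hom.hom_finsum[OF free_eval_hom[OF N.R.cring_axioms that] this]
      show ?thesis using that by (simp add: d_def free_module_simps)
    qed
    have yN: "y j \<in> carrier N" if "j < k" for j
      by (rule lin_comb_closed[OF N _ step.hyps(1)]) (use that in \<open>auto simp: relations_def\<close>)
    have "(\<Oplus>\<^bsub>N\<^esub>j\<in>{..<k}. c j p \<odot>\<^bsub>N\<^esub> y' j) =
        (\<Oplus>\<^bsub>N\<^esub>j\<in>{..<k}. c j p \<odot>\<^bsub>N\<^esub> y j) \<oplus>\<^bsub>N\<^esub> d p \<odot>\<^bsub>N\<^esub> z" if p: "p \<in> J" for p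
    proof -
      have cp: "c j p \<in> carrier A" if "j < k" for j using that c HJ p by (auto simp: Pi_iff subset_iff)
      have rj: "r j \<in> carrier A" if "j < k" for j using that r(1) by auto
      have "(\<Oplus>\<^bsub>N\<^esub>j\<in>{..<k}. c j p \<odot>\<^bsub>N\<^esub> y' j) =
          (\<Oplus>\<^bsub>N\<^esub>j\<in>{..<k}. c j p \<odot>\<^bsub>N\<^esub> y j \<oplus>\<^bsub>N\<^esub> (r j \<otimes>\<^bsub>A\<^esub> c j p) \<odot>\<^bsub>N\<^esub> z)"
        using cp rj yN step.hyps(3)
        by (intro N.M.finsum_cong')
          (auto simp: step.hyps(4) N.smult_r_distr N.R.m_comm simp flip: N.smult_assoc1)
      also have "\<dots> = (\<Oplus>\<^bsub>N\<^esub>j\<in>{..<k}. c j p \<odot>\<^bsub>N\<^esub> y j) \<oplus>\<^bsub>N\<^esub> (\<Oplus>\<^bsub>N\<^esub>j\<in>{..<k}. (r j \<otimes>\<^bsub>A\<^esub> c j p) \<odot>\<^bsub>N\<^esub> z)"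
        using cp rj yN step.hyps(3) by (intro N.M.finsum_addf) auto
      also have "(\<Oplus>\<^bsub>N\<^esub>j\<in>{..<k}. (r j \<otimes>\<^bsub>A\<^esub> c j p) \<odot>\<^bsub>N\<^esub> z) = d p \<odot>\<^bsub>N\<^esub> z"
        using cp rj step.hyps(3) p by (subst d) (auto simp: N.finsum_smult_rdistr)
      finally show ?thesis .
    qed
    moreover have "d q = \<zero>\<^bsub>A\<^esub>" using d[OF q] r(2) by simp
    ultimately show ?case using \<open>d \<in> H\<close> step.hyps(3)
      by (intro lin_comb.step[OF step.IH, of d z]) auto
  qed
  from this[OF x_comb] show ?thesis by (rule lin_comb_cong) (simp add: \<phi>_eq)
qed

lemma submodule_vanishing:
  assumes "cring A" "submodule H A (free_module A J)" "S \<subseteq> J"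
  shows "submodule {c \<in> H. \<forall>q\<in>S. c q = \<zero>\<^bsub>A\<^esub>} A (free_module A J)"
proof -
  interpret A: cring A by fact
  interpret F: Module.module A "free_module A J" by (rule free_module_module) fact
  note E = F.submoduleE[OF assms(2)]
  have zero: "\<zero>\<^bsub>free_module A J\<^esub> \<in> H" 
    using submodule.axioms(1)[OF assms(2)] subgroup.one_closed by fastforce
  note hom = free_eval_hom[OF assms(1), of _ J]
  show ?thesis
  proof (rule F.submoduleI)
    fix c assume c: "c \<in> {c \<in> H. \<forall>q\<in>S. c q = \<zero>\<^bsub>A\<^esub>}"
    then have "(\<ominus>\<^bsub>free_module A J\<^esub> c) q = \<zero>\<^bsub>A\<^esub>" if "q \<in> S" for q
      using abelian_group_hom.hom_a_inv[OF hom, of q c] that assms(3) E(1) by auto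
    then show "\<ominus>\<^bsub>free_module A J\<^esub> c \<in> {c \<in> H. \<forall>q\<in>S. c q = \<zero>\<^bsub>A\<^esub>}" using c E(3) by auto
  qed (use zero E assms(3) in \<open>auto simp: free_module_simps subset_iff\<close>)
qed

lemma lin_comb_vanishing_on:
  fixes N :: "('r, 'n) module"
  assumes flat: "equationally_flat A N" and N: "Module.module A N"
    and H: "submodule H A (free_module A J)" and S: "finite S" "S \<subseteq> J"
    and \<phi>: "lin_comb N J H \<phi>" "\<And>q. q \<in> S \<Longrightarrow> \<phi> q = \<zero>\<^bsub>N\<^esub>"
  shows "lin_comb N J {c \<in> H. \<forall>q\<in>S. c q = \<zero>\<^bsub>A\<^esub>} \<phi>"
  using S \<phi>(2)
proof (induction S rule: finite_induct)
  case empty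
  then show ?case using \<phi>(1) by simp
next
  case (insert q S)
  interpret N: Module.module A N by fact
  have "lin_comb N J {c \<in> {c \<in> H. \<forall>q\<in>S. c q = \<zero>\<^bsub>A\<^esub>}. c q = \<zero>\<^bsub>A\<^esub>} \<phi>"
    using insert by (intro lin_comb_vanishing_at[OF flat N] submodule_vanishing H N.R.cring_axioms) auto
  then show ?case by (rule lin_comb_mono) auto
qed

lemma lin_comb_finite_support:
  assumes N: "Module.module A N" and H: "submodule H A (free_module A J)" and \<phi>: "lin_comb N J H \<phi>"
  shows "\<exists>S. finite S \<and> S \<subseteq> J \<and> lin_comb N J {c \<in> H. \<forall>q\<in>J - S. c q = \<zero>\<^bsub>A\<^esub>} \<phi>"
  using \<phi>
proof (induction rule: lin_comb.induct)
  case (zero t)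
  then have "lin_comb N J {c \<in> H. \<forall>q\<in>J - {}. c q = \<zero>\<^bsub>A\<^esub>} t" by (rule lin_comb.zero)
  then show ?case by blast
next
  case (step t r x t')
  interpret N: Module.module A N by fact
  interpret F: Module.module A "free_module A J" by (rule free_module_module) (rule N.R.cring_axioms)
  from step.IH obtain S where S: "finite S" "S \<subseteq> J"
    "lin_comb N J {c \<in> H. \<forall>q\<in>J - S. c q = \<zero>\<^bsub>A\<^esub>} t" by blast
  let ?S = "S \<union> {q \<in> J. r q \<noteq> \<zero>\<^bsub>A\<^esub>}"
  have "finite {q \<in> J. r q \<noteq> \<zero>\<^bsub>A\<^esub>}"
    using step.hyps(2) F.submoduleE(1)[OF H] by (auto simp: free_module_simps)
  moreover have "lin_comb N J {c \<in> H. \<forall>q\<in>J - ?S. c q = \<zero>\<^bsub>A\<^esub>} t'"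
  proof (rule lin_comb.step[of N J _ t r x])
    show "lin_comb N J {c \<in> H. \<forall>q\<in>J - ?S. c q = \<zero>\<^bsub>A\<^esub>} t" using S(3) by (rule lin_comb_mono) auto
  qed (use step.hyps in auto)
  ultimately show ?case using S by (intro exI[of _ ?S]) auto
qed

lemma free_lift_eq_finsum:
  assumes "Module.module A P" "\<beta> \<in> J \<rightarrow> carrier P" "c \<in> J \<rightarrow> carrier A"
    and "finite S" "S \<subseteq> J" "\<And>q. q \<in> J - S \<Longrightarrow> c q = \<zero>\<^bsub>A\<^esub>"
  shows "free_lift A J P \<beta> c = (\<Oplus>\<^bsub>P\<^esub>q\<in>S. c q \<odot>\<^bsub>P\<^esub> \<beta> q)"
proof -
  interpret P: Module.module A P by fact
  show ?thesis
    unfolding free_lift_def using assms(2-6)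
    by (intro P.M.add.finprod_mono_neutral_cong_left) (auto simp: Pi_iff subset_iff)
qed

text \<open>A vanishing sum of pure tensors is explained by linear relations between the left factors, when
  the right module is flat. The proof maps the tensor product to a quotient of the module of
  finitely supported families with values in \<open>N\<close>, indexed by the elements of \<open>M\<close> and separate copies of the
  given ones, by the span of the linear relations between these elements. Vanishing there gives relations that
  involve further elements of \<open>M\<close>; flatness removes these one at a time.\<close>

lemma tensor_sum_eq_zeroD:
  fixes A :: "'r ring" and M :: "('r, 'm) module" and N :: "('r, 'n) module" and I :: "'i set"
  assumes flat: "equationally_flat A N" and M: "Module.module A M" and N: "Module.module A N"
    and I: "finite I" and m: "m \<in> I \<rightarrow> carrier M" and n: "n \<in> I \<rightarrow> carrier N"
    and zero: "(\<Oplus>\<^bsub>tensor A M N\<^esub>i\<in>I. pure_tensor A M N (m i) (n i)) = \<zero>\<^bsub>tensor A M N\<^esub>"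
  shows "lin_comb N I (relations A I M m) n"
proof -
  interpret M: Module.module A M by fact
  interpret N: Module.module A N by fact
  interpret T: tensor_product A M N using M N by (simp add: tensor_product_def)
  have A: "cring A" using N by (simp add: Module.module_def)
  (* The elements of M index the target of the bilinear map. The given family gets separate
     indices, so that repetitions among the m i do no harm. *)
  define J :: "('i + 'm) set" where "J = Inl ` I \<union> Inr ` carrier M"
  define w where "w = case_sum m id"
  have w: "w \<in> J \<rightarrow> carrier M" using m by (auto simp: J_def w_def)
  have J: "Inl i \<in> J" "Inr x \<in> J" if "i \<in> I" "x \<in> carrier M" for i x using that by (auto simp: J_def)
  let ?F = "free_module A J" and ?S = "finsupp_module N J"
  have F: "Module.module A ?F" by (rule free_module_module) (rule A)
  have S: "Module.module A ?S" by (rule finsupp_module_module) (rule N)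
  interpret F: Module.module A ?F by (rule F)
  interpret S: Module.module A ?S by (rule S)
  let ?W = "free_lift A J M w"
  note W_hom = free_lift_hom[OF M w]
  interpret W: abelian_group_hom ?F M ?W by (rule module_hom_additive[OF F M W_hom])
  have W_basis: "?W (basis_vector A J q) = w q" if "q \<in> J" for q
    by (rule free_lift_basis_vector[OF M w that])
  define H where "H = {c \<in> carrier ?F. ?W c = \<zero>\<^bsub>M\<^esub>}"
  have H: "submodule H A ?F" unfolding H_def by (rule submodule_kernel[OF F M W_hom])
  have HA: "H \<subseteq> J \<rightarrow> carrier A" by (auto simp: H_def free_module_simps)
  note basis = basis_vector_closed[OF A, of _ J]

  define act where "act c x = (\<lambda>q\<in>J. c q \<odot>\<^bsub>N\<^esub> x)" for c x
  have coeff: "c q \<in> carrier A" if "c \<in> carrier ?F" "q \<in> J" for c q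
    using that by (auto simp: free_module_simps)
  have act: "act c x \<in> carrier ?S" if "c \<in> carrier ?F" "x \<in> carrier N" for c x
  proof -
    have "{q \<in> J. act c x q \<noteq> \<zero>\<^bsub>N\<^esub>} \<subseteq> {q \<in> J. c q \<noteq> \<zero>\<^bsub>A\<^esub>}" using that by (auto simp: act_def)
    moreover have "finite {q \<in> J. c q \<noteq> \<zero>\<^bsub>A\<^esub>}" using that by (simp add: free_module_simps)
    ultimately have "finite {q \<in> J. act c x q \<noteq> \<zero>\<^bsub>N\<^esub>}" by (rule finite_subset)
    then show ?thesis using that coeff by (auto simp: finsupp_module_simps act_def)
  qed
  have act_add_left: "act (c \<oplus>\<^bsub>?F\<^esub> d) x = act c x \<oplus>\<^bsub>?S\<^esub> act d x"
    if "c \<in> carrier ?F" "d \<in> carrier ?F" "x \<in> carrier N" for c d x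
    using that coeff by (auto simp: act_def free_module_simps(2) finsupp_module_simps(2) N.smult_l_distr)
  have act_add_right: "act c (x \<oplus>\<^bsub>N\<^esub> y) = act c x \<oplus>\<^bsub>?S\<^esub> act c y"
    if "c \<in> carrier ?F" "x \<in> carrier N" "y \<in> carrier N" for c x y
    using that coeff by (auto simp: act_def finsupp_module_simps(2) N.smult_r_distr)
  have act_smult_left: "act (a \<odot>\<^bsub>?F\<^esub> c) x = a \<odot>\<^bsub>?S\<^esub> act c x"
    if "a \<in> carrier A" "c \<in> carrier ?F" "x \<in> carrier N" for a c x
    using that coeff by (auto simp: act_def free_module_simps(3) finsupp_module_simps(3) N.smult_assoc1)
  have act_smult_right: "act c (a \<odot>\<^bsub>N\<^esub> x) = a \<odot>\<^bsub>?S\<^esub> act c x"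
    if "a \<in> carrier A" "c \<in> carrier ?F" "x \<in> carrier N" for a c x
    using that coeff
    by (auto simp: act_def finsupp_module_simps(3) M.R.m_comm simp flip: N.smult_assoc1)

  (* Modulo Z, the family with the single value y at Inr x is additive and homogeneous in x, too. *)
  define Z where "Z = {\<phi> \<in> carrier ?S. lin_comb N J H \<phi>}"
  have Z_smult: "a \<odot>\<^bsub>?S\<^esub> \<phi> \<in> Z" if "a \<in> carrier A" "\<phi> \<in> Z" for a \<phi>
  proof -
    have "lin_comb N J H (\<lambda>q. a \<odot>\<^bsub>N\<^esub> \<phi> q)"
      using that lin_comb_smult[OF N HA] by (simp add: Z_def)
    then have "lin_comb N J H (a \<odot>\<^bsub>?S\<^esub> \<phi>)"
      by (rule lin_comb_cong) (simp add: finsupp_module_simps)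
    then show ?thesis using that by (simp add: Z_def)
  qed
  have Z: "submodule Z A ?S"
  proof (rule S.submoduleI)
    show "\<zero>\<^bsub>?S\<^esub> \<in> Z" by (auto simp: Z_def finsupp_module_simps(4) intro!: lin_comb.zero)
       (simp flip: finsupp_module_simps(4))
    show "\<ominus>\<^bsub>?S\<^esub> \<phi> \<in> Z" if "\<phi> \<in> Z" for \<phi>
      using Z_smult[of "\<ominus>\<^bsub>A\<^esub> \<one>\<^bsub>A\<^esub>" \<phi>] that by (simp add: S.smult_l_minus Z_def)
    fix \<phi> \<psi> assume *: "\<phi> \<in> Z" "\<psi> \<in> Z"
    then have "lin_comb N J H (\<lambda>q. \<phi> q \<oplus>\<^bsub>N\<^esub> \<psi> q)" using lin_comb_add[OF N HA] by (simp add: Z_def)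
    then have "lin_comb N J H (\<phi> \<oplus>\<^bsub>?S\<^esub> \<psi>)"
      by (rule lin_comb_cong) (simp add: finsupp_module_simps)
    then show "\<phi> \<oplus>\<^bsub>?S\<^esub> \<psi> \<in> Z" using * by (simp add: Z_def)
    show "a \<odot>\<^bsub>?S\<^esub> \<phi> \<in> Z" if "a \<in> carrier A" "\<phi> \<in> Z" for a \<phi> using that by (rule Z_smult)
  qed (auto simp: Z_def)
  let ?P = "quotient_module ?S Z" and ?p = "\<lambda>\<phi>. Z +>\<^bsub>?S\<^esub> \<phi>"
  have P: "Module.module A ?P" by (rule quotient_module_module[OF S Z])
  interpret P: Module.module A ?P by (rule P)
  note p_hom = quotient_module_hom[OF S Z]
  interpret p: abelian_group_hom ?S ?P ?p by (rule module_hom_additive[OF S P p_hom])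

  have p_eq: "?p (act c x) = ?p (act d x)"
    if "c \<in> carrier ?F" "d \<in> carrier ?F" "x \<in> carrier N" "?W c = ?W d" for c d x
  proof -
    let ?c = "c \<ominus>\<^bsub>?F\<^esub> d"
    have c: "?c \<in> carrier ?F" using that by simp
    have "?W ?c = \<zero>\<^bsub>M\<^esub>" using that by (simp add: F.M.minus_eq M.M.r_neg)
    then have "?c \<in> H" using c by (simp add: H_def)
    have "lin_comb N J H (act ?c x)"
    proof (rule lin_comb.step)
      show "lin_comb N J H (\<lambda>_. \<zero>\<^bsub>N\<^esub>)" by (rule lin_comb.zero) simp
      show "act ?c x q = \<zero>\<^bsub>N\<^esub> \<oplus>\<^bsub>N\<^esub> ?c q \<odot>\<^bsub>N\<^esub> x" if "q \<in> J" for q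
        using that coeff[OF c that] \<open>x \<in> carrier N\<close> by (simp add: act_def)
    qed fact+
    then have "act ?c x \<in> Z" using act[OF c] that by (simp add: Z_def)
    then have "?p (act ?c x) = \<zero>\<^bsub>?P\<^esub>"
      using quotient_module_eq_zero_iff[OF S Z] act[OF c] that by blast
    moreover have "c = ?c \<oplus>\<^bsub>?F\<^esub> d" using that by (simp add: F.M.minus_eq F.M.a_assoc F.M.l_neg)
    then have "act c x = act ?c x \<oplus>\<^bsub>?S\<^esub> act d x" using act_add_left[OF c] that by metis
    ultimately show ?thesis using act c that by (simp add: p.hom_closed)
  qed
  define \<beta> where "\<beta> x y = ?p (act (basis_vector A J (Inr x)) y)" for x y
  have \<beta>: "bilinear A M N ?P \<beta>"
  proof (rule bilinearI)
    fix x y assume xy: "x \<in> carrier M" "y \<in> carrier N"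
    let ?e = "\<lambda>x. basis_vector A J (Inr x)"
    have e: "?e x \<in> carrier ?F" if "x \<in> carrier M" for x using basis that by (auto simp: J_def)
    have We: "?W (?e x) = x" if "x \<in> carrier M" for x
      using W_basis[of "Inr x"] that by (simp add: J_def w_def)
    show "\<beta> x y \<in> carrier ?P" unfolding \<beta>_def using act e xy by simp
    {
      fix x' assume x': "x' \<in> carrier M"
      have "\<beta> (x \<oplus>\<^bsub>M\<^esub> x') y = ?p (act (?e x \<oplus>\<^bsub>?F\<^esub> ?e x') y)"
        unfolding \<beta>_def using e xy x' We by (intro p_eq) auto
      then show "\<beta> (x \<oplus>\<^bsub>M\<^esub> x') y = \<beta> x y \<oplus>\<^bsub>?P\<^esub> \<beta> x' y"
        using act e xy x' by (simp add: \<beta>_def act_add_left)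
    next
      fix y' assume "y' \<in> carrier N"
      then show "\<beta> x (y \<oplus>\<^bsub>N\<^esub> y') = \<beta> x y \<oplus>\<^bsub>?P\<^esub> \<beta> x y'"
        using act e xy by (simp add: \<beta>_def act_add_right)
    next
      fix a assume a: "a \<in> carrier A"
      have "\<beta> (a \<odot>\<^bsub>M\<^esub> x) y = ?p (act (a \<odot>\<^bsub>?F\<^esub> ?e x) y)"
        unfolding \<beta>_def using e xy a We by (intro p_eq) (auto simp: module_hom_smult[OF W_hom])
      then show "\<beta> (a \<odot>\<^bsub>M\<^esub> x) y = a \<odot>\<^bsub>?P\<^esub> \<beta> x y"
        using act e xy a by (simp add: \<beta>_def act_smult_left module_hom_smult[OF p_hom])
      show "\<beta> x (a \<odot>\<^bsub>N\<^esub> y) = a \<odot>\<^bsub>?P\<^esub> \<beta> x y"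
        using act e xy a by (simp add: \<beta>_def act_smult_right module_hom_smult[OF p_hom])
    }
  qed
  interpret L: abelian_group_hom T.T ?P "tensor_lift A M N ?P \<beta>"
    by (rule module_hom_additive[OF T.T_module P T.tensor_lift_hom[OF P \<beta>]])
  let ?d = "\<lambda>i. basis_vector A J (Inl i)"
  have d: "?d i \<in> carrier ?F" "?W (?d i) = m i" if "i \<in> I" for i
    using basis W_basis[of "Inl i"] that by (auto simp: J_def w_def)
  define \<phi> where "\<phi> = (\<Oplus>\<^bsub>?S\<^esub>i\<in>I. act (?d i) (n i))"
  have \<phi>_in: "(\<lambda>i. act (?d i) (n i)) \<in> I \<rightarrow> carrier ?S" using act d n by (auto simp: Pi_iff)
  then have \<phi>S: "\<phi> \<in> carrier ?S" unfolding \<phi>_def by (rule S.M.finsum_closed)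
  have "\<zero>\<^bsub>?P\<^esub> = tensor_lift A M N ?P \<beta> (\<Oplus>\<^bsub>T.T\<^esub>i\<in>I. T.pure (m i) (n i))"
    using zero by simp
  also have "\<dots> = (\<Oplus>\<^bsub>?P\<^esub>i\<in>I. tensor_lift A M N ?P \<beta> (T.pure (m i) (n i)))"
    using m n by (intro L.hom_finsum) (auto simp: Pi_iff)
  also have "\<dots> = (\<Oplus>\<^bsub>?P\<^esub>i\<in>I. ?p (act (?d i) (n i)))"
  proof (rule P.M.finsum_cong')
    fix i assume i: "i \<in> I"
    then have mi: "m i \<in> carrier M" "n i \<in> carrier N" using m n by auto
    then have "tensor_lift A M N ?P \<beta> (T.pure (m i) (n i)) = \<beta> (m i) (n i)"
      by (rule T.tensor_lift_pure[OF P \<beta>])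
    also have "\<dots> = ?p (act (?d i) (n i))"
      unfolding \<beta>_def using d[OF i] mi basis W_basis[of "Inr (m i)"]
      by (intro p_eq) (auto simp: J_def w_def)
    finally show "tensor_lift A M N ?P \<beta> (T.pure (m i) (n i)) = ?p (act (?d i) (n i))" .
  next
    show "(\<lambda>i. ?p (act (?d i) (n i))) \<in> I \<rightarrow> carrier ?P"
      using \<phi>_in p.hom_closed by (simp only: Pi_iff) blast
  qed simp
  also have "\<dots> = ?p \<phi>" unfolding \<phi>_def using \<phi>_in by (rule p.hom_finsum[symmetric])
  finally have "\<phi> \<in> Z" using quotient_module_eq_zero_iff[OF S Z \<phi>S] by simp
  then have "lin_comb N J H \<phi>" by (simp add: Z_def)
  then obtain S where S: "finite S" "S \<subseteq> J" "lin_comb N J {c \<in> H. \<forall>q\<in>J - S. c q = \<zero>\<^bsub>A\<^esub>} \<phi>"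
    using lin_comb_finite_support[OF N H] by blast

  have \<phi>_eval: "\<phi> q = (\<Oplus>\<^bsub>N\<^esub>i\<in>I. ?d i q \<odot>\<^bsub>N\<^esub> n i)" if "q \<in> J" for q
    unfolding \<phi>_def using abelian_group_hom.hom_finsum[OF finsupp_eval_hom[OF N that] \<phi>_in] that
    by (simp add: act_def)
  have nN: "n i \<in> carrier N" if "i \<in> I" for i using n that by auto
  have \<phi>_Inl: "\<phi> (Inl i) = n i" if "i \<in> I" for i
  proof -
    have "\<phi> (Inl i) = (\<Oplus>\<^bsub>N\<^esub>j\<in>I. ?d j (Inl i) \<odot>\<^bsub>N\<^esub> n j)"
      using \<phi>_eval[of "Inl i"] that by (simp add: J_def)
    also have "\<dots> = (\<Oplus>\<^bsub>N\<^esub>j\<in>I. if i = j then n j else \<zero>\<^bsub>N\<^esub>)"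
      by (rule N.M.finsum_cong') (use nN that in \<open>auto simp: basis_vector_def J_def\<close>)
    finally show ?thesis using N.M.finsum_singleton[OF that I n] by simp
  qed
  have \<phi>_Inr: "\<phi> (Inr x) = \<zero>\<^bsub>N\<^esub>" if "x \<in> carrier M" for x
  proof -
    have "\<phi> (Inr x) = (\<Oplus>\<^bsub>N\<^esub>j\<in>I. ?d j (Inr x) \<odot>\<^bsub>N\<^esub> n j)"
      using \<phi>_eval[of "Inr x"] that by (simp add: J_def)
    also have "\<dots> = \<zero>\<^bsub>N\<^esub>"
      by (rule N.M.add.finprod_one_eqI) (use nN that in \<open>auto simp: basis_vector_def J_def\<close>)
    finally show ?thesis .
  qed
  (* The family vanishes at the indices outside Inl ` I, so these can be dropped from the relations. *)
  let ?H = "{c \<in> {c \<in> H. \<forall>q\<in>J - S. c q = \<zero>\<^bsub>A\<^esub>}. \<forall>q\<in>S - Inl ` I. c q = \<zero>\<^bsub>A\<^esub>}"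
  have "lin_comb N J ?H \<phi>"
  proof (rule lin_comb_vanishing_on[OF flat N])
    show "submodule {c \<in> H. \<forall>q\<in>J - S. c q = \<zero>\<^bsub>A\<^esub>} A ?F"
      by (rule submodule_vanishing[OF A H]) auto
    show "\<phi> q = \<zero>\<^bsub>N\<^esub>" if "q \<in> S - Inl ` I" for q
      using that S(2) \<phi>_Inr by (auto simp: J_def)
  qed (use S in auto)
  then have "lin_comb N I (relations A I M m) (\<lambda>i. \<phi> (Inl i))"
  proof (rule lin_comb_map[OF N N, where h = "\<lambda>x. x" and \<tau> = "\<lambda>r. r \<circ> Inl", rotated -1])
    show "abelian_group_hom N N (\<lambda>x. x)"
      by (rule additive_mapI) (auto intro: N.M.abelian_group_axioms)
    fix r assume r: "r \<in> ?H"
    have rJ: "r \<in> J \<rightarrow> carrier A" using r HA by blast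
    have "(\<Oplus>\<^bsub>M\<^esub>i\<in>I. r (Inl i) \<odot>\<^bsub>M\<^esub> m i) = (\<Oplus>\<^bsub>M\<^esub>q\<in>Inl ` I. r q \<odot>\<^bsub>M\<^esub> w q)"
      using rJ w by (subst M.M.finsum_reindex) (auto simp: w_def J_def Pi_iff)
    also have "\<dots> = ?W r"
      using r I by (intro free_lift_eq_finsum[OF M w rJ, symmetric]) (auto simp: J_def)
    also have "\<dots> = \<zero>\<^bsub>M\<^esub>" using r by (simp add: H_def)
    finally show "r \<circ> Inl \<in> relations A I M m" using rJ by (auto simp: relations_def J_def)
  next
    show "?H \<subseteq> J \<rightarrow> carrier A" using HA by blast
  qed (auto simp: J_def)
  then show ?thesis by (rule lin_comb_cong) (simp add: \<phi>_Inl)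
qed

text \<open>Exactness in the middle: if \<open>\<Sum> h(m\<^sub>i) \<otimes> n\<^sub>i = 0\<close>, the family \<open>n\<close> is a combination of relations between
  the \<open>h(m\<^sub>i)\<close>. For such a relation \<open>c\<close> the element \<open>\<Sum> c\<^sub>i m\<^sub>i\<close> is in the kernel of \<open>h\<close>, that is, in the
  image of \<open>g\<close>, and \<open>\<Sum> m\<^sub>i \<otimes> c\<^sub>i x = (\<Sum> c\<^sub>i m\<^sub>i) \<otimes> x\<close>.\<close>

lemma equationally_flat_exact:
  fixes A :: "'r ring"
  assumes flat: "equationally_flat A N" and N: "Module.module A N"
    and M: "Module.module A M1" "Module.module A M2" "Module.module A M3"
    and g: "g \<in> module_hom A M1 M2" and h: "h \<in> module_hom A M2 M3"
    and exact: "exact M1 M2 M3 g h"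
  shows "exact (tensor A M1 N) (tensor A M2 N) (tensor A M3 N)
    (tensor_map A M1 M2 N g) (tensor_map A M2 M3 N h)"
proof -
  interpret N: Module.module A N by fact
  interpret M1: Module.module A M1 by fact
  interpret M2: Module.module A M2 by fact
  interpret M3: Module.module A M3 by fact
  interpret T1: tensor_product A M1 N using M N by (simp add: tensor_product_def)
  interpret T2: tensor_product A M2 N using M N by (simp add: tensor_product_def)
  interpret T3: tensor_product A M3 N using M N by (simp add: tensor_product_def)
  let ?g = "tensor_map A M1 M2 N g" and ?h = "tensor_map A M2 M3 N h"
  interpret G: abelian_group_hom T1.T T2.T ?g
    by (rule module_hom_additive[OF T1.T_module T2.T_module tensor_map_hom]) fact+
  interpret H: abelian_group_hom T2.T T3.T ?h
    by (rule module_hom_additive[OF T2.T_module T3.T_module tensor_map_hom]) fact+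
  interpret h: abelian_group_hom M2 M3 h by (rule module_hom_additive) fact+
  note g_pure = tensor_map_pure[OF M(1,2) N g] and h_pure = tensor_map_pure[OF M(2,3) N h]
  have gM: "g x \<in> carrier M2" "h (g x) = \<zero>\<^bsub>M3\<^esub>" if "x \<in> carrier M1" for x
    using exact that by (auto simp: exact_def)
  have "?h (?g t) = \<zero>\<^bsub>T3.T\<^esub>" if "t \<in> carrier T1.T" for t
    using that
  proof (induction rule: T1.tensor_induct)
    case (add m n t)
    interpret n: abelian_group_hom M3 T3.T "\<lambda>m. T3.pure m n"
      by (rule module_hom_additive[OF M(3) T3.T_module T3.pure_left_hom[OF add.hyps(2)]])
    show ?case using add gM by (simp add: g_pure h_pure)
  qed simp
  moreover have "t \<in> ?g ` carrier T1.T" if t: "t \<in> carrier T2.T" and ht: "?h t = \<zero>\<^bsub>T3.T\<^esub>" for t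
  proof -
    obtain k :: nat and m n where m: "m \<in> {..<k} \<rightarrow> carrier M2" and n: "n \<in> {..<k} \<rightarrow> carrier N"
      and t_eq: "t = (\<Oplus>\<^bsub>T2.T\<^esub>i\<in>{..<k}. T2.pure (m i) (n i))"
      by (rule T2.tensor_sum_cases[OF t])
    have "(\<Oplus>\<^bsub>T3.T\<^esub>i\<in>{..<k}. T3.pure (h (m i)) (n i)) = (\<Oplus>\<^bsub>T3.T\<^esub>i\<in>{..<k}. ?h (T2.pure (m i) (n i)))"
      using m n by (intro T3.T.M.finsum_cong') (simp_all add: h_pure Pi_iff H.hom_closed)
    also have "\<dots> = ?h t" unfolding t_eq using m n by (intro H.hom_finsum[symmetric]) (auto simp: Pi_iff)
    finally have "(\<Oplus>\<^bsub>T3.T\<^esub>i\<in>{..<k}. T3.pure (h (m i)) (n i)) = \<zero>\<^bsub>T3.T\<^esub>" using ht by simp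
    then have "lin_comb N {..<k} (relations A {..<k} M3 (\<lambda>i. h (m i))) n"
      using m n by (intro tensor_sum_eq_zeroD[OF flat M(3) N]) (auto simp: Pi_iff)
    then have "(\<Oplus>\<^bsub>T2.T\<^esub>i\<in>{..<k}. T2.pure (m i) (n i)) \<in> ?g ` carrier T1.T"
    proof (induction rule: lin_comb.induct)
      case (zero y)
      have "T2.pure (m i) (y i) = \<zero>\<^bsub>T2.T\<^esub>" if "i \<in> {..<k}" for i
        using abelian_group_hom.hom_zero[OF module_hom_additive[OF N T2.T_module T2.pure_right_hom[of "m i"]]]
          zero[OF that] m that by auto
      then have "(\<Oplus>\<^bsub>T2.T\<^esub>i\<in>{..<k}. T2.pure (m i) (y i)) = \<zero>\<^bsub>T2.T\<^esub>"
        by (rule T2.T.M.add.finprod_one_eqI)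
      then show ?case by (intro image_eqI[of _ _ "\<zero>\<^bsub>T1.T\<^esub>"]) simp_all
    next
      case (step y r z y')
      have r: "r i \<in> carrier A" if "i < k" for i using step.hyps(2) that by (auto simp: relations_def)
      have r0: "(\<Oplus>\<^bsub>M3\<^esub>i\<in>{..<k}. r i \<odot>\<^bsub>M3\<^esub> h (m i)) = \<zero>\<^bsub>M3\<^esub>"
        using step.hyps(2) by (auto simp: relations_def)
      have mi: "m i \<in> carrier M2" if "i < k" for i using m that by auto
      have y: "y i \<in> carrier N" if "i < k" for i
        by (rule lin_comb_closed[OF N _ step.hyps(1)]) (use that in \<open>auto simp: relations_def\<close>)
      let ?x = "\<Oplus>\<^bsub>M2\<^esub>i\<in>{..<k}. r i \<odot>\<^bsub>M2\<^esub> m i"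
      have x: "?x \<in> carrier M2" using r mi by (intro M2.M.finsum_closed) auto
      have "h ?x = (\<Oplus>\<^bsub>M3\<^esub>i\<in>{..<k}. h (r i \<odot>\<^bsub>M2\<^esub> m i))" using r mi by (intro h.hom_finsum) auto
      also have "\<dots> = (\<Oplus>\<^bsub>M3\<^esub>i\<in>{..<k}. r i \<odot>\<^bsub>M3\<^esub> h (m i))"
        using r mi by (intro M3.M.finsum_cong') (auto simp: module_hom_smult[OF h])
      finally have "?x \<in> {x \<in> carrier M2. h x = \<zero>\<^bsub>M3\<^esub>}" using x r0 by simp
      then have "?x \<in> g ` carrier M1" using exact by (simp add: exact_def)
      then obtain x1 where x1: "?x = g x1" "x1 \<in> carrier M1" by (rule imageE)
      interpret z: abelian_group_hom M2 T2.T "\<lambda>m. T2.pure m z"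
        by (rule module_hom_additive[OF M(2) T2.T_module T2.pure_left_hom[OF step.hyps(3)]])
      have "(\<Oplus>\<^bsub>T2.T\<^esub>i\<in>{..<k}. T2.pure (m i) (y' i)) =
          (\<Oplus>\<^bsub>T2.T\<^esub>i\<in>{..<k}. T2.pure (m i) (y i) \<oplus>\<^bsub>T2.T\<^esub> T2.pure (r i \<odot>\<^bsub>M2\<^esub> m i) z)"
        using r mi y step.hyps(3)
        by (intro T2.T.M.finsum_cong')
          (auto simp: step.hyps(4) T2.pure_add_right T2.pure_smult_right T2.pure_smult_left)
      also have "\<dots> = (\<Oplus>\<^bsub>T2.T\<^esub>i\<in>{..<k}. T2.pure (m i) (y i)) \<oplus>\<^bsub>T2.T\<^esub>
          (\<Oplus>\<^bsub>T2.T\<^esub>i\<in>{..<k}. T2.pure (r i \<odot>\<^bsub>M2\<^esub> m i) z)"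
        using r mi y step.hyps(3) by (intro T2.T.M.finsum_addf) auto
      also have "(\<Oplus>\<^bsub>T2.T\<^esub>i\<in>{..<k}. T2.pure (r i \<odot>\<^bsub>M2\<^esub> m i) z) = T2.pure ?x z"
        using r mi by (intro z.hom_finsum[symmetric]) auto
      also have "\<dots> = ?g (T1.pure x1 z)" using x1 step.hyps(3) by (simp add: g_pure)
      finally have eq: "(\<Oplus>\<^bsub>T2.T\<^esub>i\<in>{..<k}. T2.pure (m i) (y' i)) =
        (\<Oplus>\<^bsub>T2.T\<^esub>i\<in>{..<k}. T2.pure (m i) (y i)) \<oplus>\<^bsub>T2.T\<^esub> ?g (T1.pure x1 z)" .
      obtain s where s: "s \<in> carrier T1.T" "(\<Oplus>\<^bsub>T2.T\<^esub>i\<in>{..<k}. T2.pure (m i) (y i)) = ?g s"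
        using step.IH by blast
      show ?case unfolding eq s(2) using s(1) x1 step.hyps(3)
        by (intro image_eqI[of _ _ "s \<oplus>\<^bsub>T1.T\<^esub> T1.pure x1 z"]) auto
    qed
    then show ?thesis by (simp add: t_eq)
  qed
  ultimately show ?thesis unfolding exact_def by auto
qed

section \<open>Faithful flatness in terms of equations and ideals\<close>

text \<open>Test modules have their carrier in a prescribed type; \<open>relabel_module\<close> moves a module
  there along an injection \<open>j\<close> with left inverse \<open>d\<close>.\<close>

definition relabel_module :: "('m \<Rightarrow> 'k) \<Rightarrow> ('k \<Rightarrow> 'm) \<Rightarrow> ('r, 'm) module \<Rightarrow> ('r, 'k) module" where
  "relabel_module j d M =
    \<lparr>carrier = j ` carrier M, mult = undefined, one = undefined, zero = j \<zero>\<^bsub>M\<^esub>,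
     add = (\<lambda>x y. j (d x \<oplus>\<^bsub>M\<^esub> d y)), smult = (\<lambda>a x. j (a \<odot>\<^bsub>M\<^esub> d x))\<rparr>"

lemma relabel_module_simps:
  "carrier (relabel_module j d M) = j ` carrier M" "\<zero>\<^bsub>relabel_module j d M\<^esub> = j \<zero>\<^bsub>M\<^esub>"
  "x \<oplus>\<^bsub>relabel_module j d M\<^esub> y = j (d x \<oplus>\<^bsub>M\<^esub> d y)" "a \<odot>\<^bsub>relabel_module j d M\<^esub> x = j (a \<odot>\<^bsub>M\<^esub> d x)"
  by (simp_all add: relabel_module_def)

lemma relabel_module_module:
  assumes "Module.module A M" and d: "\<And>x. x \<in> carrier M \<Longrightarrow> d (j x) = x"
  shows "Module.module A (relabel_module j d M)"
proof -
  interpret M: Module.module A M by fact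
  have "abelian_group (relabel_module j d M)"
  proof (rule abelian_groupI)
    fix x assume "x \<in> carrier (relabel_module j d M)"
    then show "\<exists>y\<in>carrier (relabel_module j d M).
        y \<oplus>\<^bsub>relabel_module j d M\<^esub> x = \<zero>\<^bsub>relabel_module j d M\<^esub>"
      by (intro bexI[of _ "j (\<ominus>\<^bsub>M\<^esub> (d x))"]) (auto simp: relabel_module_simps d M.M.l_neg)
  qed (auto simp: relabel_module_simps d M.M.a_ac)
  then show ?thesis
    by (intro moduleI)
      (auto simp: relabel_module_simps d M.R.cring_axioms M.smult_l_distr M.smult_r_distr M.smult_assoc1)
qed

text \<open>Given \<open>\<Sum> a\<^sub>i n\<^sub>i = 0\<close>, apply flatness to \<open>K \<rightarrow> A\<^sup>k \<rightarrow> A\<close>, where the second map sends \<open>e\<^sub>i\<close> to \<open>a\<^sub>i\<close> and \<open>K\<close>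
  is its kernel, the module of relations. The tensor \<open>\<Sum> e\<^sub>i \<otimes> n\<^sub>i\<close> goes to \<open>1 \<otimes> \<Sum> a\<^sub>i n\<^sub>i = 0\<close>, so it comes
  from \<open>K \<otimes> N\<close>; its coordinates, which are the \<open>n\<^sub>i\<close>, are then combinations of relations.\<close>

lemma flat_imp_equationally_flat:
  fixes A :: "'r ring" and N :: "('r, 'n) module"
  assumes flat: "flat A N" and N: "Module.module A N"
  shows "equationally_flat A N"
  unfolding equationally_flat_def
proof (intro allI impI)
  fix k :: nat and a n
  assume a: "a \<in> {..<k} \<rightarrow> carrier A" and n: "n \<in> {..<k} \<rightarrow> carrier N"
    and zero: "(\<Oplus>\<^bsub>N\<^esub>i\<in>{..<k}. a i \<odot>\<^bsub>N\<^esub> n i) = \<zero>\<^bsub>N\<^esub>"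
  interpret N: Module.module A N by fact
  have A: "cring A" by (rule N.R.cring_axioms)
  let ?F = "free_module A {..<k}" and ?S = "self_module A"
  have F: "Module.module A ?F" by (rule free_module_module) (rule A)
  have S: "Module.module A ?S" by (rule module_self) (rule A)
  have aS: "a \<in> {..<k} \<rightarrow> carrier ?S" using a by simp
  let ?ev = "free_lift A {..<k} ?S a"
  note ev_hom = free_lift_hom[OF S aS]
  let ?K = "{c \<in> carrier ?F. ?ev c = \<zero>\<^bsub>?S\<^esub>}"
  have K: "submodule ?K A ?F" by (rule submodule_kernel[OF F S ev_hom])
  have ev: "?ev c = (\<Oplus>\<^bsub>?S\<^esub>i\<in>{..<k}. c i \<otimes>\<^bsub>A\<^esub> a i)" if "c \<in> carrier ?F" for c
    using free_lift_eq_finsum[OF S aS, of c "{..<k}"] that by (simp add: free_module_simps PiE_iff Pi_iff)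

  define j where "j = (\<lambda>c :: nat \<Rightarrow> 'r. {c})"
  define d where "d = (the_elem :: (nat \<Rightarrow> 'r) set \<Rightarrow> nat \<Rightarrow> 'r)"
  define j' where "j' = (\<lambda>x :: 'r. {\<lambda>_ :: nat. x})"
  define d' where "d' = (\<lambda>X. (the_elem X :: nat \<Rightarrow> 'r) 0)"
  have dj: "d (j c) = c" "d' (j' x) = x" for c x by (simp_all add: j_def d_def j'_def d'_def)
  define M1 where "M1 = relabel_module j d (?F\<lparr>carrier := ?K\<rparr>)"
  define M2 where "M2 = relabel_module j d ?F"
  define M3 where "M3 = relabel_module j' d' ?S"
  have M: "Module.module A M1" "Module.module A M2" "Module.module A M3"
    unfolding M1_def M2_def M3_def
    by (intro relabel_module_module submodule.submodule_is_module[OF K] F S dj)+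
  interpret M2: Module.module A M2 by (rule M)
  interpret M3: Module.module A M3 by (rule M)
  interpret T1: tensor_product A M1 N using M N by (simp add: tensor_product_def)
  interpret T2: tensor_product A M2 N using M N by (simp add: tensor_product_def)
  interpret T3: tensor_product A M3 N using M N by (simp add: tensor_product_def)
  have M1_mem: "x \<in> carrier M1 \<longleftrightarrow> (\<exists>c\<in>?K. x = j c)" for x
    by (auto simp: M1_def relabel_module_simps)
  have M2_mem: "x \<in> carrier M2 \<longleftrightarrow> (\<exists>c\<in>carrier ?F. x = j c)" for x
    by (auto simp: M2_def relabel_module_simps)
  define h where "h = (\<lambda>x. j' (?ev (d x)))"
  have g_hom: "(\<lambda>x. x) \<in> module_hom A M1 M2"
    by (auto simp: module_hom_def M1_def M2_def relabel_module_simps)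
  have h_hom: "h \<in> module_hom A M2 M3"
    using ev_hom by (auto simp: module_hom_def M2_def M3_def h_def relabel_module_simps dj)
  have "exact M1 M2 M3 (\<lambda>x. x) h"
    by (auto simp: exact_def M1_def M2_def M3_def relabel_module_simps h_def dj j'_def dest: fun_cong)
  then have ex: "exact T1.T T2.T T3.T (tensor_map A M1 M2 N (\<lambda>x. x)) (tensor_map A M2 M3 N h)"
    using flat M g_hom h_hom unfolding flat_def by blast
  let ?g = "tensor_map A M1 M2 N (\<lambda>x. x)" and ?h = "tensor_map A M2 M3 N h"
  interpret G: abelian_group_hom T1.T T2.T ?g
    by (rule module_hom_additive[OF T1.T_module T2.T_module tensor_map_hom]) fact+
  interpret H: abelian_group_hom T2.T T3.T ?h
    by (rule module_hom_additive[OF T2.T_module T3.T_module tensor_map_hom]) fact+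
  note g_pure = tensor_map_pure[OF M(1,2) N g_hom] and h_pure = tensor_map_pure[OF M(2,3) N h_hom]

  let ?e = "\<lambda>i. j (basis_vector A {..<k} i)"
  have e: "?e i \<in> carrier M2" if "i < k" for i
    unfolding M2_mem using basis_vector_closed[OF A, of i "{..<k}"] that by (intro bexI) auto
  have nN: "n i \<in> carrier N" if "i < k" for i using n that by auto
  have aA: "a i \<in> carrier A" if "i < k" for i using a that by auto
  let ?u = "j' \<one>\<^bsub>A\<^esub>"
  have u: "?u \<in> carrier M3" by (simp add: M3_def relabel_module_simps)
  have he: "h (?e i) = a i \<odot>\<^bsub>M3\<^esub> ?u" if "i < k" for i
    using that free_lift_basis_vector[OF S aS] aA[OF that]
    by (simp add: h_def dj M3_def relabel_module_simps)
  define t where "t = (\<Oplus>\<^bsub>T2.T\<^esub>i\<in>{..<k}. T2.pure (?e i) (n i))"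
  have pure_in: "(\<lambda>i. T2.pure (?e i) (n i)) \<in> {..<k} \<rightarrow> carrier T2.T"
    using e nN by (simp add: Pi_iff)
  have t: "t \<in> carrier T2.T" unfolding t_def using pure_in by (rule T2.T.M.finsum_closed)
  interpret u: abelian_group_hom N T3.T "\<lambda>n. T3.pure ?u n"
    by (rule module_hom_additive[OF N T3.T_module T3.pure_right_hom[OF u]])
  have "?h t = (\<Oplus>\<^bsub>T3.T\<^esub>i\<in>{..<k}. ?h (T2.pure (?e i) (n i)))"
    unfolding t_def using pure_in by (rule H.hom_finsum)
  also have "\<dots> = (\<Oplus>\<^bsub>T3.T\<^esub>i\<in>{..<k}. T3.pure ?u (a i \<odot>\<^bsub>N\<^esub> n i))"
    using e nN u aA
    by (intro T3.T.M.finsum_cong')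
      (simp_all add: h_pure he T3.pure_smult_left T3.pure_smult_right Pi_iff)
  also have "\<dots> = T3.pure ?u (\<Oplus>\<^bsub>N\<^esub>i\<in>{..<k}. a i \<odot>\<^bsub>N\<^esub> n i)"
    using nN aA by (intro u.hom_finsum[symmetric]) (simp add: Pi_iff)
  also have "\<dots> = \<zero>\<^bsub>T3.T\<^esub>" by (simp add: zero)
  finally have "t \<in> ?g ` carrier T1.T" using ex t by (simp add: exact_def)
  then obtain s where s: "t = ?g s" "s \<in> carrier T1.T" by (rule imageE)

  define \<gamma> where "\<gamma> i = tensor_lift A M2 N N (\<lambda>x y. d x i \<odot>\<^bsub>N\<^esub> y)" for i
  have dA: "d x i \<in> carrier A" if "x \<in> carrier M2" "i < k" for x i
    using that by (auto simp: M2_mem dj free_module_simps)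
  have \<gamma>_bil: "bilinear A M2 N N (\<lambda>x y. d x i \<odot>\<^bsub>N\<^esub> y)" if "i < k" for i
    by (rule bilinearI) (use that in \<open>auto simp: dA M2_mem dj M2_def relabel_module_simps
        free_module_simps PiE_iff N.smult_l_distr N.smult_r_distr N.smult_assoc1 N.R.m_comm
        simp flip: N.smult_assoc1\<close>)
  have \<gamma>_hom: "abelian_group_hom T2.T N (\<gamma> i)" if "i < k" for i
    unfolding \<gamma>_def by (rule module_hom_additive[OF T2.T_module N T2.tensor_lift_hom[OF N \<gamma>_bil[OF that]]])
  have \<gamma>_pure: "\<gamma> i (T2.pure x y) = d x i \<odot>\<^bsub>N\<^esub> y" if "i < k" "x \<in> carrier M2" "y \<in> carrier N" for i x y
    unfolding \<gamma>_def using that by (intro T2.tensor_lift_pure[OF N \<gamma>_bil])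
  have \<gamma>_t: "\<gamma> i t = n i" if i: "i < k" for i
  proof -
    have "\<gamma> i t = (\<Oplus>\<^bsub>N\<^esub>l\<in>{..<k}. \<gamma> i (T2.pure (?e l) (n l)))"
      unfolding t_def using pure_in by (rule abelian_group_hom.hom_finsum[OF \<gamma>_hom[OF i]])
    also have "\<dots> = (\<Oplus>\<^bsub>N\<^esub>l\<in>{..<k}. if i = l then n l else \<zero>\<^bsub>N\<^esub>)"
      by (rule N.M.finsum_cong')
        (use nN i e in \<open>auto simp: \<gamma>_pure dj basis_vector_def\<close>)
    also have "\<dots> = n i" using n i by (intro N.M.finsum_singleton) auto
    finally show ?thesis .
  qed
  have "lin_comb N {..<k} (relations A {..<k} ?S a) (\<lambda>i. \<gamma> i (?g s))"
    using s(2)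
  proof (induction rule: T1.tensor_induct)
    case zero
    show ?case
      by (rule lin_comb.zero) (simp add: abelian_group_hom.hom_zero[OF \<gamma>_hom])
  next
    case (add x y s)
    obtain c where c: "c \<in> ?K" "x = j c" using add.hyps(1) M1_mem by blast
    have x2: "x \<in> carrier M2" using c by (auto simp: M2_mem)
    have "c \<in> relations A {..<k} ?S a"
      using c(1) ev by (auto simp: relations_def free_module_simps PiE_iff)
    then show ?case
    proof (rule lin_comb.step[OF add.IH _ add.hyps(2)])
      fix i assume "i \<in> {..<k}"
      then have i: "i < k" by simp
      interpret \<gamma>: abelian_group_hom T2.T N "\<gamma> i" by (rule \<gamma>_hom[OF i])
      have ci: "c i \<in> carrier A" using c i by (auto simp: free_module_simps)
      have "\<gamma> i (?g (T1.pure x y \<oplus>\<^bsub>T1.T\<^esub> s)) = \<gamma> i (T2.pure x y) \<oplus>\<^bsub>N\<^esub> \<gamma> i (?g s)"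
        using add.hyps x2 by (simp add: g_pure)
      then show "\<gamma> i (?g (T1.pure x y \<oplus>\<^bsub>T1.T\<^esub> s)) = \<gamma> i (?g s) \<oplus>\<^bsub>N\<^esub> c i \<odot>\<^bsub>N\<^esub> y"
        using add.hyps x2 i ci c(2) by (simp add: \<gamma>_pure dj N.M.a_comm)
    qed
  qed
  then show "lin_comb N {..<k} (relations A {..<k} ?S a) n"
    by (rule lin_comb_cong) (simp add: \<gamma>_t flip: s(1))
qed

lemma equationally_flat_imp_flat:
  assumes "equationally_flat A N" "Module.module A N"
  shows "flat A N"
  unfolding flat_def using equationally_flat_exact[OF assms] by blast

lemma ideal_imp_submodule:
  assumes "cring A" "ideal I A"
  shows "submodule I A (self_module A)"
proof -
  interpret I: ideal I A by fact
  interpret S: Module.module A "self_module A" by (rule module_self) fact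
  have inv: "\<ominus>\<^bsub>self_module A\<^esub> x = \<ominus>\<^bsub>A\<^esub> x" for x by (simp add: a_inv_def m_inv_def)
  show ?thesis by (rule S.submoduleI) (auto simp: I.I_l_closed inv)
qed

text \<open>For the ideal condition, the test module \<open>A/I\<close> becomes zero over \<open>B\<close> iff \<open>I\<close> generates the unit
  ideal of \<open>B\<close>. Conversely, if \<open>M \<otimes> B = 0\<close> and \<open>m \<in> M\<close>, then \<open>m \<otimes> 1 = 0\<close>, and by flatness \<open>1\<close> is a
  combination of elements of the annihilator of \<open>m\<close>; so the annihilator is the whole ring.\<close>

theorem faithfully_flat_hom_iff:
  fixes A :: "'r ring" and B :: "'s ring"
  assumes A: "cring A" and B: "cring B" and \<phi>: "\<phi> \<in> ring_hom A B"
  shows "faithfully_flat_hom A B \<phi> \<longleftrightarrow>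
    equationally_flat A (module_along \<phi> B) \<and>
    (\<forall>I. ideal I A \<longrightarrow> \<one>\<^bsub>B\<^esub> \<in> genideal B (\<phi> ` I) \<longrightarrow> \<one>\<^bsub>A\<^esub> \<in> I)"
    (is "_ \<longleftrightarrow> ?E \<and> ?I")
proof -
  interpret A: cring A by fact
  interpret B: cring B by fact
  let ?N = "module_along \<phi> B"
  have N: "Module.module A ?N" by (rule module_module_along) fact+
  interpret N: Module.module A ?N by (rule N)
  have \<phi>A: "\<phi> a \<in> carrier B" if "a \<in> carrier A" for a using that ring_hom_closed[OF \<phi>] by simp
  have gen: "ideal (genideal B (\<phi> ` I)) B" if "I \<subseteq> carrier A" for I
    using that \<phi>A by (intro B.genideal_ideal) auto
  have ?I if ff: "faithfully_flat A ?N"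
  proof (intro allI impI)
    fix I assume I: "ideal I A" and one: "\<one>\<^bsub>B\<^esub> \<in> genideal B (\<phi> ` I)"
    interpret I: ideal I A by fact
    let ?S = "self_module A"
    have S: "Module.module A ?S" by (rule module_self) (rule A)
    have sub: "submodule I A ?S" by (rule ideal_imp_submodule) fact+
    let ?Q = "quotient_module ?S I" and ?p = "\<lambda>x. I +>\<^bsub>?S\<^esub> x"
    have Q: "Module.module A ?Q" by (rule quotient_module_module[OF S sub])
    note p_hom = quotient_module_hom[OF S sub] and p_zero = quotient_module_eq_zero_iff[OF S sub]
    define j where "j = (\<lambda>C :: 'r set. (\<lambda>x. \<lambda>_ :: nat. x) ` C)"
    define d where "d = (\<lambda>X :: (nat \<Rightarrow> 'r) set. (\<lambda>f. f 0) ` X)"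
    have dj: "d (j C) = C" for C by (auto simp: d_def j_def image_image)
    let ?M = "relabel_module j d ?Q"
    have M: "Module.module A ?M" by (rule relabel_module_module) (simp_all add: Q dj)
    interpret M: Module.module A ?M by (rule M)
    interpret Q: Module.module A ?Q by (rule Q)
    interpret T: tensor_product A ?M ?N using M N by (simp add: tensor_product_def)
    have M_mem: "\<exists>x\<in>carrier A. m = j (?p x)" if "m \<in> carrier ?M" for m
      using that quotient_module_cases[OF S sub] by (auto simp: relabel_module_simps)
    have p_closed: "?p x \<in> carrier ?Q" if "x \<in> carrier A" for x
      using that p_hom by (auto simp: module_hom_def)
    have kill: "i \<odot>\<^bsub>?M\<^esub> m = \<zero>\<^bsub>?M\<^esub>" if iI: "i \<in> I" and mM: "m \<in> carrier ?M" for i m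
    proof -
      obtain x where x: "x \<in> carrier A" "m = j (?p x)" using M_mem[OF mM] by (elim bexE)
      have i: "i \<in> carrier A" using that by simp
      have "i \<odot>\<^bsub>?Q\<^esub> ?p x = ?p (i \<otimes>\<^bsub>A\<^esub> x)" using module_hom_smult[OF p_hom i, of x] x by simp
      also have "\<dots> = \<zero>\<^bsub>?Q\<^esub>" using p_zero[of "i \<otimes>\<^bsub>A\<^esub> x"] i x iI I.I_r_closed by simp
      finally show ?thesis using x by (simp add: relabel_module_simps dj)
    qed
    (* The factor b' makes this an ideal of B: the tensor product carries no action of B here. *)
    let ?Z = "{b \<in> carrier B. \<forall>b'\<in>carrier B. \<forall>m\<in>carrier ?M. T.pure m (b \<otimes>\<^bsub>B\<^esub> b') = \<zero>\<^bsub>T.T\<^esub>}"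
    have pure_hom: "abelian_group_hom ?N T.T (\<lambda>n. T.pure m n)" if "m \<in> carrier ?M" for m
      by (rule module_hom_additive[OF N T.T_module T.pure_right_hom[OF that]])
    have pure_add: "T.pure m (b \<oplus>\<^bsub>B\<^esub> b') = T.pure m b \<oplus>\<^bsub>T.T\<^esub> T.pure m b'"
      if "m \<in> carrier ?M" "b \<in> carrier B" "b' \<in> carrier B" for m b b'
      using T.pure_add_right[of m b b'] that by simp
    have pure_zero: "T.pure m \<zero>\<^bsub>B\<^esub> = \<zero>\<^bsub>T.T\<^esub>" if "m \<in> carrier ?M" for m
      using abelian_group_hom.hom_zero[OF pure_hom[OF that]] by simp
    have pure_neg: "T.pure m (\<ominus>\<^bsub>B\<^esub> b) = \<zero>\<^bsub>T.T\<^esub>"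
      if "T.pure m b = \<zero>\<^bsub>T.T\<^esub>" "m \<in> carrier ?M" "b \<in> carrier B" for m b
    proof -
      have "T.pure m b \<oplus>\<^bsub>T.T\<^esub> T.pure m (\<ominus>\<^bsub>B\<^esub> b) = T.pure m (b \<oplus>\<^bsub>B\<^esub> \<ominus>\<^bsub>B\<^esub> b)"
        using that by (simp only: pure_add B.a_inv_closed)
      then show ?thesis using that by (simp add: B.r_neg pure_zero)
    qed
    have "ideal ?Z B"
    proof (rule idealI)
      show "subgroup ?Z (add_monoid B)"
      proof (rule B.add.subgroupI)
        have "\<zero>\<^bsub>B\<^esub> \<in> ?Z" by (simp add: pure_zero)
        then show "?Z \<noteq> {}" by blast
        fix x y assume x: "x \<in> ?Z" and y: "y \<in> ?Z"
        show "\<ominus>\<^bsub>B\<^esub> x \<in> ?Z" using x pure_neg by (simp add: B.l_minus)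
        show "x \<oplus>\<^bsub>B\<^esub> y \<in> ?Z" using x y by (simp add: B.l_distr pure_add)
      qed auto
      fix x b assume x: "x \<in> ?Z" and b: "b \<in> carrier B"
      show "x \<otimes>\<^bsub>B\<^esub> b \<in> ?Z" using x b by (simp add: B.m_assoc)
      then show "b \<otimes>\<^bsub>B\<^esub> x \<in> ?Z" using x b B.m_comm[of x b] by simp
    qed (rule B.ring_axioms)
    moreover have "\<phi> ` I \<subseteq> ?Z"
    proof
      fix b assume "b \<in> \<phi> ` I"
      then obtain i where i: "i \<in> I" "b = \<phi> i" by blast
      have "T.pure m (\<phi> i \<otimes>\<^bsub>B\<^esub> b') = \<zero>\<^bsub>T.T\<^esub>" if "b' \<in> carrier B" "m \<in> carrier ?M" for b' m
      proof -
        have iA: "i \<in> carrier A" using i by simp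
        have "T.pure m (\<phi> i \<otimes>\<^bsub>B\<^esub> b') = i \<odot>\<^bsub>T.T\<^esub> T.pure m b'"
          using T.pure_smult_right[of m b' i] that iA by simp
        also have "\<dots> = T.pure (i \<odot>\<^bsub>?M\<^esub> m) b'"
          using T.pure_smult_left[of m b' i] that iA by simp
        also have "\<dots> = \<zero>\<^bsub>T.T\<^esub>"
          using kill[OF i(1) that(2)] that
            abelian_group_hom.hom_zero[OF module_hom_additive[OF M T.T_module T.pure_left_hom[of b']]]
          by simp
        finally show ?thesis .
      qed
      then show "b \<in> ?Z" using i \<phi>A by auto
    qed
    ultimately have "genideal B (\<phi> ` I) \<subseteq> ?Z" by (rule B.genideal_minimal)
    then have one_Z: "\<one>\<^bsub>B\<^esub> \<in> ?Z" using one by blast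
    have pure0: "T.pure m b = \<zero>\<^bsub>T.T\<^esub>" if "m \<in> carrier ?M" "b \<in> carrier B" for m b
      using one_Z that by simp
    have "t = \<zero>\<^bsub>T.T\<^esub>" if "t \<in> carrier T.T" for t
      using that by (induction rule: T.tensor_induct) (simp_all add: pure0)
    then have "carrier T.T = {\<zero>\<^bsub>T.T\<^esub>}" by auto
    then have "carrier ?M = {\<zero>\<^bsub>?M\<^esub>}"
      using ff M unfolding faithfully_flat_def by blast
    then have "j (?p \<one>\<^bsub>A\<^esub>) = j \<zero>\<^bsub>?Q\<^esub>" using p_closed[of "\<one>\<^bsub>A\<^esub>"] by (auto simp: relabel_module_simps)
    then have "?p \<one>\<^bsub>A\<^esub> = \<zero>\<^bsub>?Q\<^esub>" by (metis dj)
    then show "\<one>\<^bsub>A\<^esub> \<in> I" using p_zero[of "\<one>\<^bsub>A\<^esub>"] by simp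
  qed
  moreover have "faithfully_flat A ?N" if E: ?E and I: ?I
    unfolding faithfully_flat_def
  proof (intro conjI allI impI)
    show "flat A ?N" using E N by (rule equationally_flat_imp_flat)
    fix M :: "('r, (nat \<Rightarrow> 'r) set) module"
    assume *: "Module.module A M \<and> carrier (tensor A M ?N) = {\<zero>\<^bsub>tensor A M ?N\<^esub>}"
    then have M: "Module.module A M" and zero: "carrier (tensor A M ?N) = {\<zero>\<^bsub>tensor A M ?N\<^esub>}" by auto
    interpret M: Module.module A M by (rule M)
    interpret T: tensor_product A M ?N using M N by (simp add: tensor_product_def)
    have "m = \<zero>\<^bsub>M\<^esub>" if m: "m \<in> carrier M" for m
    proof -
      let ?Ann = "{a \<in> carrier A. a \<odot>\<^bsub>M\<^esub> m = \<zero>\<^bsub>M\<^esub>}"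
      have Ann: "ideal ?Ann A"
      proof (rule idealI)
        show "subgroup ?Ann (add_monoid A)"
        proof (rule A.add.subgroupI)
          have "\<zero>\<^bsub>A\<^esub> \<in> ?Ann" using m by simp
          then show "?Ann \<noteq> {}" by blast
          fix x y assume x: "x \<in> ?Ann" and y: "y \<in> ?Ann"
          show "\<ominus>\<^bsub>A\<^esub> x \<in> ?Ann" using x m by (simp add: M.smult_l_minus)
          show "x \<oplus>\<^bsub>A\<^esub> y \<in> ?Ann" using x y m by (simp add: M.smult_l_distr)
        qed auto
        fix a x assume a: "a \<in> ?Ann" and x: "x \<in> carrier A"
        show "x \<otimes>\<^bsub>A\<^esub> a \<in> ?Ann" using a x m by (simp add: M.smult_assoc1)
        then show "a \<otimes>\<^bsub>A\<^esub> x \<in> ?Ann" using a x A.m_comm[of a x] by simp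
      qed (rule A.ring_axioms)
      let ?G = "genideal B (\<phi> ` ?Ann)"
      interpret G: ideal ?G B by (rule gen) auto
      have "T.pure m \<one>\<^bsub>B\<^esub> \<in> carrier T.T" using m by simp
      then have "T.pure m \<one>\<^bsub>B\<^esub> = \<zero>\<^bsub>T.T\<^esub>" using zero by blast
      then have one: "lin_comb ?N {0::nat} (relations A {0} M (\<lambda>_. m)) (\<lambda>_. \<one>\<^bsub>B\<^esub>)"
        using m by (intro tensor_sum_eq_zeroD[OF E M N]) (simp_all add: T.T.M.finsum_insert)
      have "t 0 \<in> ?G" if "lin_comb ?N {0::nat} (relations A {0} M (\<lambda>_. m)) t" for t
        using that
      proof (induction rule: lin_comb.induct)
        case (zero t)
        then show ?case using G.zero_closed by simp
      next
        case (step t r x t')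
        have r0: "r 0 \<in> carrier A" "(\<Oplus>\<^bsub>M\<^esub>i\<in>{0}. r i \<odot>\<^bsub>M\<^esub> m) = \<zero>\<^bsub>M\<^esub>"
          using step.hyps(2) by (auto simp: relations_def)
        have "(\<Oplus>\<^bsub>M\<^esub>i\<in>insert 0 {}. r i \<odot>\<^bsub>M\<^esub> m) = r 0 \<odot>\<^bsub>M\<^esub> m \<oplus>\<^bsub>M\<^esub> (\<Oplus>\<^bsub>M\<^esub>i\<in>{}. r i \<odot>\<^bsub>M\<^esub> m)"
          using r0(1) m by (intro M.M.finsum_insert) auto
        then have "r 0 \<in> ?Ann" using r0 m by simp
        moreover have "\<phi> ` ?Ann \<subseteq> carrier B" using \<phi>A by auto
        ultimately have "\<phi> (r 0) \<in> ?G" by (intro subsetD[OF B.genideal_self] imageI)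
        then have "\<phi> (r 0) \<otimes>\<^bsub>B\<^esub> x \<in> ?G" using step.hyps(3) by (simp add: G.I_r_closed)
        then show ?case using step.IH step.hyps(4)[of 0] by simp
      qed
      from I[rule_format, OF Ann this[OF one]] show ?thesis using m by simp
    qed
    then show "carrier M = {\<zero>\<^bsub>M\<^esub>}" by auto
  qed
  ultimately show ?thesis
    using \<phi> flat_imp_equationally_flat[OF _ N]
    unfolding faithfully_flat_hom_def faithfully_flat_def by blast
qed

section \<open>Products of rings and transport along isomorphisms\<close>

lemma product_ring_simps:
  "carrier (product_ring S R) = (\<Pi>\<^sub>E i\<in>S. carrier (R i))"
  "p \<otimes>\<^bsub>product_ring S R\<^esub> q = (\<lambda>i\<in>S. p i \<otimes>\<^bsub>R i\<^esub> q i)"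
  "p \<oplus>\<^bsub>product_ring S R\<^esub> q = (\<lambda>i\<in>S. p i \<oplus>\<^bsub>R i\<^esub> q i)"
  "\<one>\<^bsub>product_ring S R\<^esub> = (\<lambda>i\<in>S. \<one>\<^bsub>R i\<^esub>)" "\<zero>\<^bsub>product_ring S R\<^esub> = (\<lambda>i\<in>S. \<zero>\<^bsub>R i\<^esub>)"
  by (simp_all add: product_ring_def)

lemma cring_product_ring:
  assumes R: "\<And>i. i \<in> S \<Longrightarrow> cring (R i)"
  shows "cring (product_ring S R)"
proof -
  let ?P = "product_ring S R"
  have ext: "p = q" if "p \<in> carrier ?P" "q \<in> carrier ?P" "\<And>i. i \<in> S \<Longrightarrow> p i = q i" for p q
    using that by (auto simp: product_ring_simps intro: PiE_ext)
  have val: "p i \<in> carrier (R i)" if "p \<in> carrier ?P" "i \<in> S" for p i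
    using that by (auto simp: product_ring_simps)
  have ops: "(p \<otimes>\<^bsub>?P\<^esub> q) i = p i \<otimes>\<^bsub>R i\<^esub> q i" "(p \<oplus>\<^bsub>?P\<^esub> q) i = p i \<oplus>\<^bsub>R i\<^esub> q i"
    "\<one>\<^bsub>?P\<^esub> i = \<one>\<^bsub>R i\<^esub>" "\<zero>\<^bsub>?P\<^esub> i = \<zero>\<^bsub>R i\<^esub>" if "i \<in> S" for p q i
    using that by (simp_all add: product_ring_simps)
  have closed: "p \<otimes>\<^bsub>?P\<^esub> q \<in> carrier ?P" "p \<oplus>\<^bsub>?P\<^esub> q \<in> carrier ?P" "\<one>\<^bsub>?P\<^esub> \<in> carrier ?P" "\<zero>\<^bsub>?P\<^esub> \<in> carrier ?P"
    if "p \<in> carrier ?P" "q \<in> carrier ?P" for p q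
  proof -
    show "p \<otimes>\<^bsub>?P\<^esub> q \<in> carrier ?P" "p \<oplus>\<^bsub>?P\<^esub> q \<in> carrier ?P"
      using val that R by (simp_all add: product_ring_simps(1-3) cring.cring_simprules)
    show "\<one>\<^bsub>?P\<^esub> \<in> carrier ?P" "\<zero>\<^bsub>?P\<^esub> \<in> carrier ?P"
      using R by (simp_all add: product_ring_simps cring.cring_simprules)
  qed
  have one: "\<one>\<^bsub>?P\<^esub> \<in> carrier ?P" and zero: "\<zero>\<^bsub>?P\<^esub> \<in> carrier ?P"
    using R by (simp_all add: product_ring_simps cring.cring_simprules)
  have r_one: "x \<otimes>\<^bsub>R i\<^esub> \<one>\<^bsub>R i\<^esub> = x" if "i \<in> S" "x \<in> carrier (R i)" for i x
  proof -
    interpret cring "R i" by (rule R[OF that(1)])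
    show ?thesis using that by simp
  qed
  note R_rules = cring.cring_simprules[OF R] r_one
  have "abelian_group ?P"
  proof (rule abelian_groupI)
    fix p assume p: "p \<in> carrier ?P"
    have "(\<lambda>i\<in>S. \<ominus>\<^bsub>R i\<^esub> p i) \<in> carrier ?P"
      using val[OF p] R by (simp add: product_ring_simps(1) cring.cring_simprules)
    then show "\<exists>q\<in>carrier ?P. q \<oplus>\<^bsub>?P\<^esub> p = \<zero>\<^bsub>?P\<^esub>"
      using val[OF p] R by (intro bexI) (auto intro!: ext closed zero p simp: ops R_rules)
  qed (auto intro!: ext closed zero simp: ops val R_rules)
  then show ?thesis
    by (intro cringI comm_monoidI) (auto intro!: ext closed one simp: ops val R_rules)
qed

lemma product_proj_hom:
  assumes "s \<in> S"
  shows "(\<lambda>p. p s) \<in> ring_hom (product_ring S R) (R s)"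
  using assms by (auto simp: ring_hom_def product_ring_simps)

lemma product_hom:
  assumes "\<And>s. s \<in> S \<Longrightarrow> \<phi> s \<in> ring_hom A (R s)"
  shows "(\<lambda>a. \<lambda>s\<in>S. \<phi> s a) \<in> ring_hom A (product_ring S R)"
  using assms by (auto simp: ring_hom_def product_ring_simps Pi_iff)

definition product_inj :: "'i set \<Rightarrow> ('i \<Rightarrow> 'r ring) \<Rightarrow> 'i \<Rightarrow> 'r \<Rightarrow> 'i \<Rightarrow> 'r" where
  "product_inj S R s b = (\<lambda>t\<in>S. if t = s then b else \<zero>\<^bsub>R t\<^esub>)"

lemma product_inj_closed:
  assumes "\<And>i. i \<in> S \<Longrightarrow> cring (R i)" "b \<in> carrier (R s)"
  shows "product_inj S R s b \<in> carrier (product_ring S R)"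
  using assms by (auto simp: product_inj_def product_ring_simps cring.cring_simprules)

lemma product_inj_hom:
  assumes R: "\<And>i. i \<in> S \<Longrightarrow> cring (R i)" and s: "s \<in> S"
  shows "abelian_group_hom (R s) (product_ring S R) (product_inj S R s)"
proof (rule additive_mapI)
  show "abelian_group (R s)" "abelian_group (product_ring S R)"
    using R[OF s] cring_product_ring[where R = R and S = S, OF R] by (auto simp: cring_def ring_def)
  show "product_inj S R s (x \<oplus>\<^bsub>R s\<^esub> y) = product_inj S R s x \<oplus>\<^bsub>product_ring S R\<^esub> product_inj S R s y"
    if "x \<in> carrier (R s)" "y \<in> carrier (R s)" for x y
    using R by (auto simp: product_inj_def product_ring_simps cring.cring_simprules fun_eq_iff)
qed (rule product_inj_closed[OF R])

lemma sum_product_inj: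
  assumes R: "\<And>i. i \<in> S \<Longrightarrow> cring (R i)" and S: "finite S" and p: "p \<in> carrier (product_ring S R)"
  shows "(\<Oplus>\<^bsub>product_ring S R\<^esub>s\<in>S. product_inj S R s (p s)) = p"
proof -
  let ?P = "product_ring S R"
  interpret P: cring ?P by (rule cring_product_ring[OF R])
  have pv: "p s \<in> carrier (R s)" if "s \<in> S" for s using p that by (auto simp: product_ring_simps)
  have in_P: "(\<lambda>s. product_inj S R s (p s)) \<in> S \<rightarrow> carrier ?P"
    using pv product_inj_closed[of S R] R by simp
  have "(\<Oplus>\<^bsub>?P\<^esub>s\<in>S. product_inj S R s (p s)) t = p t" if t: "t \<in> S" for t
  proof -
    interpret Rt: cring "R t" by (rule R[OF t])
    have "abelian_group_hom ?P (R t) (\<lambda>p. p t)"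
      using product_proj_hom[OF t, of R] P.abelian_group_axioms Rt.abelian_group_axioms
      by (intro additive_mapI) (auto simp: ring_hom_def)
    then have "(\<Oplus>\<^bsub>?P\<^esub>s\<in>S. product_inj S R s (p s)) t = (\<Oplus>\<^bsub>R t\<^esub>s\<in>S. product_inj S R s (p s) t)"
      using in_P by (rule abelian_group_hom.hom_finsum)
    also have "\<dots> = (\<Oplus>\<^bsub>R t\<^esub>s\<in>S. if t = s then p t else \<zero>\<^bsub>R t\<^esub>)"
      by (rule Rt.finsum_cong') (use t pv in \<open>auto simp: product_inj_def\<close>)
    also have "\<dots> = p t" using pv t S by (intro Rt.finsum_singleton) auto
    finally show ?thesis .
  qed
  moreover have "(\<Oplus>\<^bsub>?P\<^esub>s\<in>S. product_inj S R s (p s)) \<in> carrier ?P"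
    using in_P by (rule P.finsum_closed)
  ultimately show ?thesis using p by (auto simp: product_ring_simps intro: PiE_ext)
qed

text \<open>The projections and the inclusions of the factors map spans to spans, and every element of the
  product is the sum of its components.\<close>

lemma equationally_flat_product:
  fixes A :: "'r ring"
  assumes A: "cring A" and R: "\<And>s. s \<in> S \<Longrightarrow> cring (R s)" and \<phi>: "\<And>s. s \<in> S \<Longrightarrow> \<phi> s \<in> ring_hom A (R s)"
    and S: "finite S"
  shows "equationally_flat A (module_along (\<lambda>a. \<lambda>s\<in>S. \<phi> s a) (product_ring S R)) \<longleftrightarrow>
    (\<forall>s\<in>S. equationally_flat A (module_along (\<phi> s) (R s)))"
proof -
  let ?P = "product_ring S R" and ?\<Phi> = "\<lambda>a. \<lambda>s\<in>S. \<phi> s a"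
  let ?N = "module_along ?\<Phi> ?P" and ?Ns = "\<lambda>s. module_along (\<phi> s) (R s)"
  interpret A: cring A by fact
  have P: "cring ?P" by (rule cring_product_ring) (rule R)
  have N: "Module.module A ?N" by (rule module_module_along[OF A P product_hom[OF \<phi>]])
  have Ns: "Module.module A (?Ns s)" if "s \<in> S" for s
    by (rule module_module_along[OF A R[OF that] \<phi>[OF that]])
  interpret N: Module.module A ?N by (rule N)
  have inj: "abelian_group_hom (?Ns s) ?N (product_inj S R s)" if "s \<in> S" for s
    using product_inj_hom[where R = R, OF R that] Ns[OF that] N
    by (intro additive_mapI) (auto simp: Module.module_def abelian_group_hom.hom_closed abelian_group_hom.hom_add)
  have proj: "abelian_group_hom ?N (?Ns s) (\<lambda>p. p s)" if "s \<in> S" for s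
    using product_proj_hom[OF that, of R] Ns[OF that] N
    by (intro additive_mapI) (auto simp: Module.module_def ring_hom_def)
  have \<phi>A: "\<phi> s a \<in> carrier (R s)" if "s \<in> S" "a \<in> carrier A" for s a
    using ring_hom_closed[OF \<phi>] that by blast
  have inj_smult: "product_inj S R s (\<phi> s a \<otimes>\<^bsub>R s\<^esub> b) = ?\<Phi> a \<otimes>\<^bsub>?P\<^esub> product_inj S R s b"
    if "s \<in> S" "a \<in> carrier A" "b \<in> carrier (R s)" for s a b
    using that \<phi>A R by (auto simp: product_inj_def product_ring_simps cring.cring_simprules fun_eq_iff)
  have rel: "relations A I M a \<subseteq> I \<rightarrow> carrier A" for I :: "nat set" and M :: "('r, 'r) module" and a
    by (auto simp: relations_def)
  show ?thesis
  proof (intro iffI ballI)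
    fix s assume flat: "equationally_flat A ?N" and s: "s \<in> S"
    interpret inj: abelian_group_hom "?Ns s" ?N "product_inj S R s" by (rule inj[OF s])
    interpret Ns: Module.module A "?Ns s" by (rule Ns[OF s])
    show "equationally_flat A (?Ns s)"
      unfolding equationally_flat_def
    proof (intro allI impI)
      fix k :: nat and a n
      assume a: "a \<in> {..<k} \<rightarrow> carrier A" and n: "n \<in> {..<k} \<rightarrow> carrier (?Ns s)"
        and zero: "(\<Oplus>\<^bsub>?Ns s\<^esub>i\<in>{..<k}. a i \<odot>\<^bsub>?Ns s\<^esub> n i) = \<zero>\<^bsub>?Ns s\<^esub>"
      let ?n = "\<lambda>i. product_inj S R s (n i)"
      have an: "(\<lambda>i. a i \<odot>\<^bsub>?Ns s\<^esub> n i) \<in> {..<k} \<rightarrow> carrier (?Ns s)"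
        using a n Ns.smult_closed by (simp add: Pi_iff)
      have n': "?n \<in> {..<k} \<rightarrow> carrier ?N" using n inj.hom_closed by (simp add: Pi_iff)
      have "(\<lambda>i. product_inj S R s (a i \<odot>\<^bsub>?Ns s\<^esub> n i)) \<in> {..<k} \<rightarrow> carrier ?N"
        using an inj.hom_closed by (simp add: Pi_iff)
      then have "(\<Oplus>\<^bsub>?N\<^esub>i\<in>{..<k}. a i \<odot>\<^bsub>?N\<^esub> ?n i) = (\<Oplus>\<^bsub>?N\<^esub>i\<in>{..<k}. product_inj S R s (a i \<odot>\<^bsub>?Ns s\<^esub> n i))"
        using a n by (intro N.M.finsum_cong'[OF refl]) (simp_all add: inj_smult[OF s] Pi_iff)
      also have "\<dots> = product_inj S R s (\<Oplus>\<^bsub>?Ns s\<^esub>i\<in>{..<k}. a i \<odot>\<^bsub>?Ns s\<^esub> n i)"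
        using an by (rule inj.hom_finsum[symmetric])
      finally have "(\<Oplus>\<^bsub>?N\<^esub>i\<in>{..<k}. a i \<odot>\<^bsub>?N\<^esub> ?n i) = \<zero>\<^bsub>?N\<^esub>" using zero inj.hom_zero by simp
      then have "lin_comb ?N {..<k} (relations A {..<k} (self_module A) a) ?n"
        by (rule equationally_flatD[OF flat a n'])
      then have "lin_comb (?Ns s) {..<k} (relations A {..<k} (self_module A) a) (\<lambda>i. ?n i s)"
        by (rule lin_comb_map[OF N Ns[OF s] rel proj[OF s], rotated -1])
          (use s in \<open>auto simp: product_ring_simps\<close>)
      then show "lin_comb (?Ns s) {..<k} (relations A {..<k} (self_module A) a) n"
        by (rule lin_comb_cong) (use s in \<open>simp add: product_inj_def\<close>)
    qed
  next
    assume flat: "\<forall>s\<in>S. equationally_flat A (?Ns s)"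
    show "equationally_flat A ?N"
      unfolding equationally_flat_def
    proof (intro allI impI)
      fix k :: nat and a n
      assume a: "a \<in> {..<k} \<rightarrow> carrier A" and n: "n \<in> {..<k} \<rightarrow> carrier ?N"
        and zero: "(\<Oplus>\<^bsub>?N\<^esub>i\<in>{..<k}. a i \<odot>\<^bsub>?N\<^esub> n i) = \<zero>\<^bsub>?N\<^esub>"
      let ?R = "relations A {..<k} (self_module A) a"
      have comb: "lin_comb ?N {..<k} ?R (\<lambda>i. product_inj S R s (n i s))" if s: "s \<in> S" for s
      proof -
        interpret Ns: Module.module A "?Ns s" by (rule Ns[OF s])
        interpret proj: abelian_group_hom ?N "?Ns s" "\<lambda>p. p s" by (rule proj[OF s])
        interpret Rs: cring "R s" by (rule R[OF s])
        have n': "(\<lambda>i. n i s) \<in> {..<k} \<rightarrow> carrier (?Ns s)" using n proj.hom_closed by (simp add: Pi_iff)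
        have "(\<Oplus>\<^bsub>?Ns s\<^esub>i\<in>{..<k}. a i \<odot>\<^bsub>?Ns s\<^esub> n i s) = (\<Oplus>\<^bsub>?Ns s\<^esub>i\<in>{..<k}. (a i \<odot>\<^bsub>?N\<^esub> n i) s)"
          using a n' s \<phi>A by (intro Ns.M.finsum_cong') (simp_all add: product_ring_simps Pi_iff)
        also have "\<dots> = (\<Oplus>\<^bsub>?N\<^esub>i\<in>{..<k}. a i \<odot>\<^bsub>?N\<^esub> n i) s"
        proof (rule proj.hom_finsum[symmetric])
          show "(\<lambda>i. a i \<odot>\<^bsub>?N\<^esub> n i) \<in> {..<k} \<rightarrow> carrier ?N" using a n N.smult_closed by (simp add: Pi_iff)
        qed
        also have "\<dots> = \<zero>\<^bsub>?Ns s\<^esub>" using zero proj.hom_zero by simp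
        finally have "lin_comb (?Ns s) {..<k} ?R (\<lambda>i. n i s)"
          using flat s by (intro equationally_flatD[OF _ a n']) auto
        then show ?thesis
        proof (rule lin_comb_map[OF Ns[OF s] N rel inj[OF s], where \<tau> = "\<lambda>r. r", rotated -1])
          fix r x i assume "r \<in> ?R" "x \<in> carrier (?Ns s)" "i \<in> {..<k}"
          moreover from this have "r i \<in> carrier A" using rel by blast
          ultimately show "product_inj S R s (r i \<odot>\<^bsub>?Ns s\<^esub> x) = r i \<odot>\<^bsub>?N\<^esub> product_inj S R s x"
            using s by (simp add: inj_smult)
        qed
      qed
      have "lin_comb ?N {..<k} ?R (\<lambda>i. \<Oplus>\<^bsub>?N\<^esub>s\<in>S'. product_inj S R s (n i s))"
        if "finite S'" "S' \<subseteq> S" for S'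
        using that
      proof (induction S' rule: finite_induct)
        case empty
        show ?case by (rule lin_comb.zero) (simp only: N.M.finsum_empty)
      next
        case (insert s S')
        have "lin_comb ?N {..<k} ?R
            (\<lambda>i. product_inj S R s (n i s) \<oplus>\<^bsub>?N\<^esub> (\<Oplus>\<^bsub>?N\<^esub>s\<in>S'. product_inj S R s (n i s)))"
          by (rule lin_comb_add[OF N rel comb insert.IH]) (use insert.prems in blast)+
        then show ?case
        proof (rule lin_comb_cong)
          fix i assume i: "i \<in> {..<k}"
          have "product_inj S R s (n i s) \<in> carrier ?N" if "s \<in> S" for s
            using lin_comb_closed[OF N rel comb[OF that] i] .
          then show "(\<Oplus>\<^bsub>?N\<^esub>s\<in>insert s S'. product_inj S R s (n i s)) =
              product_inj S R s (n i s) \<oplus>\<^bsub>?N\<^esub> (\<Oplus>\<^bsub>?N\<^esub>s\<in>S'. product_inj S R s (n i s))"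
            using insert.hyps insert.prems by (intro N.M.finsum_insert) (auto simp: subset_iff)
        qed
      qed
      from this[OF S subset_refl] show "lin_comb ?N {..<k} ?R n"
        by (rule lin_comb_cong)
          (use n sum_product_inj[where R = R and S = S, OF R S] in \<open>auto simp: finsum_self_module Pi_iff\<close>)
    qed
  qed
qed

lemma ideal_vimage:
  assumes "cring B" "cring C" and \<psi>: "\<psi> \<in> ring_hom B C" and G: "ideal G C"
  shows "ideal {b \<in> carrier B. \<psi> b \<in> G} B"
proof -
  interpret B: cring B by fact
  interpret C: cring C by fact
  interpret G: ideal G C by fact
  interpret \<psi>: ring_hom_cring B C \<psi>
    by (intro ring_hom_cring.intro ring_hom_cring_axioms.intro assms(1-3))
  show ?thesis
  proof (rule idealI)
    show "subgroup {b \<in> carrier B. \<psi> b \<in> G} (add_monoid B)"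
    proof (rule B.add.subgroupI)
      have "\<zero>\<^bsub>B\<^esub> \<in> {b \<in> carrier B. \<psi> b \<in> G}" by simp
      then show "{b \<in> carrier B. \<psi> b \<in> G} \<noteq> {}" by blast
    qed auto
  qed (auto simp: G.I_l_closed G.I_r_closed B.ring_axioms)
qed

lemma genideal_hom:
  assumes "cring B" "cring C" and \<psi>: "\<psi> \<in> ring_hom B C" and X: "X \<subseteq> carrier B"
    and b: "b \<in> genideal B X"
  shows "\<psi> b \<in> genideal C (\<psi> ` X)"
proof -
  interpret B: cring B by fact
  interpret C: cring C by fact
  have \<psi>X: "\<psi> ` X \<subseteq> carrier C" using X ring_hom_closed[OF \<psi>] by blast
  have "ideal (genideal C (\<psi> ` X)) C" by (rule C.genideal_ideal[OF \<psi>X])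
  then have "ideal {b \<in> carrier B. \<psi> b \<in> genideal C (\<psi> ` X)} B"
    by (rule ideal_vimage[OF assms(1-3)])
  then have "genideal B X \<subseteq> {b \<in> carrier B. \<psi> b \<in> genideal C (\<psi> ` X)}"
    by (rule B.genideal_minimal) (use X C.genideal_self[OF \<psi>X] in auto)
  then show ?thesis using b by blast
qed

text \<open>If an ideal \<open>G\<close> of the product meets the condition on every factor, the elements of the factor \<open>s\<close>
  whose extension by zero lies in \<open>G\<close> form an ideal containing the \<open>s\<close>-components of \<open>X\<close>. So \<open>G\<close>
  contains all the idempotents of the factors, and they add up to \<open>1\<close>.\<close>

lemma one_in_genideal_product:
  assumes R: "\<And>s. s \<in> S \<Longrightarrow> cring (R s)" and S: "finite S" and X: "X \<subseteq> carrier (product_ring S R)"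
  shows "\<one>\<^bsub>product_ring S R\<^esub> \<in> genideal (product_ring S R) X \<longleftrightarrow>
    (\<forall>s\<in>S. \<one>\<^bsub>R s\<^esub> \<in> genideal (R s) ((\<lambda>p. p s) ` X))"
proof
  let ?P = "product_ring S R"
  have P: "cring ?P" by (rule cring_product_ring) (rule R)
  interpret P: cring ?P by (rule P)
  let ?G = "genideal ?P X"
  interpret G: ideal ?G ?P by (rule P.genideal_ideal[OF X])
  {
    assume one: "\<one>\<^bsub>?P\<^esub> \<in> ?G"
    show "\<forall>s\<in>S. \<one>\<^bsub>R s\<^esub> \<in> genideal (R s) ((\<lambda>p. p s) ` X)"
    proof
      fix s assume s: "s \<in> S"
      show "\<one>\<^bsub>R s\<^esub> \<in> genideal (R s) ((\<lambda>p. p s) ` X)"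
        using genideal_hom[OF P R[OF s] product_proj_hom[OF s] X one] s by (simp add: product_ring_simps)
    qed
  next
    assume one: "\<forall>s\<in>S. \<one>\<^bsub>R s\<^esub> \<in> genideal (R s) ((\<lambda>p. p s) ` X)"
    have inj_one: "product_inj S R s \<one>\<^bsub>R s\<^esub> \<in> ?G" if s: "s \<in> S" for s
    proof -
      interpret Rs: cring "R s" by (rule R[OF s])
      interpret inj: abelian_group_hom "R s" ?P "product_inj S R s" by (rule product_inj_hom[OF R s])
      let ?H = "{b \<in> carrier (R s). product_inj S R s b \<in> ?G}"
      have mult: "product_inj S R s (b \<otimes>\<^bsub>R s\<^esub> p s) = product_inj S R s b \<otimes>\<^bsub>?P\<^esub> p"
        if "b \<in> carrier (R s)" "p \<in> carrier ?P" for b p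
        using that R by (auto simp: product_inj_def product_ring_simps cring.cring_simprules fun_eq_iff PiE_iff)
      have ext: "\<exists>p\<in>carrier ?P. p s = c" if "c \<in> carrier (R s)" for c
        using product_inj_closed[where R = R, OF R that] s
        by (intro bexI[of _ "product_inj S R s c"]) (auto simp: product_inj_def)
      have "ideal ?H (R s)"
      proof (rule idealI)
        show "subgroup ?H (add_monoid (R s))"
        proof (rule Rs.add.subgroupI)
          have "\<zero>\<^bsub>R s\<^esub> \<in> ?H" using G.zero_closed by simp
          then show "?H \<noteq> {}" by blast
        qed auto
        fix b c assume b: "b \<in> ?H" and c: "c \<in> carrier (R s)"
        obtain p where p: "p \<in> carrier ?P" "p s = c" using ext[OF c] by blast
        show "b \<otimes>\<^bsub>R s\<^esub> c \<in> ?H" using b c mult[of b p] p G.I_r_closed[of _ p] by simp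
        then show "c \<otimes>\<^bsub>R s\<^esub> b \<in> ?H" using b c Rs.m_comm[of b c] by simp
      qed (rule Rs.ring_axioms)
      moreover have "(\<lambda>p. p s) ` X \<subseteq> ?H"
      proof
        fix b assume "b \<in> (\<lambda>p. p s) ` X"
        then obtain p where p: "p \<in> X" "b = p s" by blast
        have pP: "p \<in> carrier ?P" using p X by blast
        then have b: "b \<in> carrier (R s)" using p s by (auto simp: product_ring_simps)
        have "product_inj S R s b = product_inj S R s \<one>\<^bsub>R s\<^esub> \<otimes>\<^bsub>?P\<^esub> p"
          using mult[of "\<one>\<^bsub>R s\<^esub>" p] pP p b by simp
        moreover have "p \<in> ?G" using p P.genideal_self[OF X] by blast
        ultimately show "b \<in> ?H" using b product_inj_closed[where R = R, OF R, of S "\<one>\<^bsub>R s\<^esub>" s]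
          by (simp add: G.I_l_closed)
      qed
      ultimately have "genideal (R s) ((\<lambda>p. p s) ` X) \<subseteq> ?H" by (rule Rs.genideal_minimal)
      then show ?thesis using one s by blast
    qed
    have "\<one>\<^bsub>?P\<^esub> = (\<Oplus>\<^bsub>?P\<^esub>s\<in>S. product_inj S R s (\<one>\<^bsub>?P\<^esub> s))"
      by (rule sum_product_inj[OF R S, symmetric]) auto
    also have "\<dots> \<in> ?G"
    proof -
      have "submodule ?G ?P (self_module ?P)" by (rule ideal_imp_submodule[OF P G.is_ideal])
      from submodule_finsum[OF module_self[OF P] this S] show ?thesis
        using inj_one by (auto simp: finsum_self_module product_ring_simps)
    qed
    finally show "\<one>\<^bsub>?P\<^esub> \<in> ?G" .
  }
qed

theorem faithfully_flat_hom_product_iff: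
  fixes A :: "'r ring" and R :: "'i \<Rightarrow> 's ring"
  assumes A: "cring A" and R: "\<And>s. s \<in> S \<Longrightarrow> cring (R s)" and \<phi>: "\<And>s. s \<in> S \<Longrightarrow> \<phi> s \<in> ring_hom A (R s)"
    and S: "finite S"
  shows "faithfully_flat_hom A (product_ring S R) (\<lambda>a. \<lambda>s\<in>S. \<phi> s a) \<longleftrightarrow>
    (\<forall>s\<in>S. equationally_flat A (module_along (\<phi> s) (R s))) \<and>
    (\<forall>I. ideal I A \<longrightarrow> (\<forall>s\<in>S. \<one>\<^bsub>R s\<^esub> \<in> genideal (R s) (\<phi> s ` I)) \<longrightarrow> \<one>\<^bsub>A\<^esub> \<in> I)"
proof -
  have hom: "(\<lambda>a. \<lambda>s\<in>S. \<phi> s a) \<in> ring_hom A (product_ring S R)" by (rule product_hom[OF \<phi>])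
  have "\<one>\<^bsub>product_ring S R\<^esub> \<in> genideal (product_ring S R) ((\<lambda>a. \<lambda>s\<in>S. \<phi> s a) ` I) \<longleftrightarrow>
    (\<forall>s\<in>S. \<one>\<^bsub>R s\<^esub> \<in> genideal (R s) (\<phi> s ` I))" if "ideal I A" for I
  proof -
    have "I \<subseteq> carrier A" using ideal.Icarr[OF that] by (rule subsetI)
    then have "(\<lambda>a. \<lambda>s\<in>S. \<phi> s a) ` I \<subseteq> carrier (product_ring S R)"
      using ring_hom_closed[OF hom] by (intro image_subsetI) (simp add: subset_iff)
    from one_in_genideal_product[where R = R, OF R S this] show ?thesis by (simp add: image_image)
  qed
  then show ?thesis
    using faithfully_flat_hom_iff[OF A cring_product_ring[where R = R, OF R] hom]
      equationally_flat_product[where R = R, OF A R \<phi> S] by simp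
qed

lemma equationally_flat_transport:
  assumes N: "Module.module A N" and N': "Module.module A' N'"
    and \<sigma>: "\<sigma> \<in> ring_hom A A'" "bij_betw \<sigma> (carrier A) (carrier A')"
    and \<tau>: "abelian_group_hom N N' \<tau>" "bij_betw \<tau> (carrier N) (carrier N')"
    and comm: "\<And>a n. a \<in> carrier A \<Longrightarrow> n \<in> carrier N \<Longrightarrow> \<tau> (a \<odot>\<^bsub>N\<^esub> n) = \<sigma> a \<odot>\<^bsub>N'\<^esub> \<tau> n"
    and flat: "equationally_flat A N"
  shows "equationally_flat A' N'"
  unfolding equationally_flat_def
proof (intro allI impI)
  fix k :: nat and a' n'
  assume a': "a' \<in> {..<k} \<rightarrow> carrier A'" and n': "n' \<in> {..<k} \<rightarrow> carrier N'"
    and zero: "(\<Oplus>\<^bsub>N'\<^esub>i\<in>{..<k}. a' i \<odot>\<^bsub>N'\<^esub> n' i) = \<zero>\<^bsub>N'\<^esub>"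
  have A: "cring A" "cring A'" using N N' by (auto simp: Module.module_def)
  interpret A: cring A by (rule A)
  interpret A': cring A' by (rule A)
  interpret N: Module.module A N by (rule N)
  interpret N': Module.module A' N' by (rule N')
  interpret \<tau>: abelian_group_hom N N' \<tau> by (rule \<tau>)
  define a where "a i = inv_into (carrier A) \<sigma> (a' i)" for i
  define n where "n i = inv_into (carrier N) \<tau> (n' i)" for i
  have a: "a i \<in> carrier A" "\<sigma> (a i) = a' i" if "i < k" for i
    using a' that \<sigma>(2) by (auto simp: a_def bij_betw_def inv_into_into f_inv_into_f Pi_iff)
  have n: "n i \<in> carrier N" "\<tau> (n i) = n' i" if "i < k" for i
    using n' that \<tau>(2) by (auto simp: n_def bij_betw_def inv_into_into f_inv_into_f Pi_iff)
  have aP: "a \<in> {..<k} \<rightarrow> carrier A" and nP: "n \<in> {..<k} \<rightarrow> carrier N" using a n by auto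
  have an: "(\<lambda>i. a i \<odot>\<^bsub>N\<^esub> n i) \<in> {..<k} \<rightarrow> carrier N" using a n by auto
  have "\<tau> (\<Oplus>\<^bsub>N\<^esub>i\<in>{..<k}. a i \<odot>\<^bsub>N\<^esub> n i) = (\<Oplus>\<^bsub>N'\<^esub>i\<in>{..<k}. \<tau> (a i \<odot>\<^bsub>N\<^esub> n i))"
    using an by (rule \<tau>.hom_finsum)
  also have "\<dots> = (\<Oplus>\<^bsub>N'\<^esub>i\<in>{..<k}. a' i \<odot>\<^bsub>N'\<^esub> n' i)"
    using a n a' n' by (intro N'.M.finsum_cong') (auto simp: comm Pi_iff)
  also have "\<dots> = \<tau> \<zero>\<^bsub>N\<^esub>" using zero by simp
  finally have \<tau>_eq: "\<tau> (\<Oplus>\<^bsub>N\<^esub>i\<in>{..<k}. a i \<odot>\<^bsub>N\<^esub> n i) = \<tau> \<zero>\<^bsub>N\<^esub>" .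
  have "(\<Oplus>\<^bsub>N\<^esub>i\<in>{..<k}. a i \<odot>\<^bsub>N\<^esub> n i) = \<zero>\<^bsub>N\<^esub>"
    by (rule inj_onD[OF bij_betw_imp_inj_on[OF \<tau>(2)] \<tau>_eq N.M.finsum_closed[OF an]]) simp
  then have "lin_comb N {..<k} (relations A {..<k} (self_module A) a) n"
    by (rule equationally_flatD[OF flat aP nP])
  then have "lin_comb N' {..<k} (relations A' {..<k} (self_module A') a') (\<lambda>i. \<tau> (n i))"
  proof (rule lin_comb_map[OF N N' _ \<tau>(1), where \<tau> = "\<lambda>r. \<sigma> \<circ> r", rotated -1])
    show "relations A {..<k} (self_module A) a \<subseteq> {..<k} \<rightarrow> carrier A" by (auto simp: relations_def)
    fix r assume r: "r \<in> relations A {..<k} (self_module A) a"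
    have \<sigma>_hom: "abelian_group_hom A A' \<sigma>"
      using \<sigma>(1) A.abelian_group_axioms A'.abelian_group_axioms
      by (intro additive_mapI) (auto simp: ring_hom_def)
    have rA: "r i \<in> carrier A" if "i < k" for i using r that by (auto simp: relations_def)
    have "(\<Oplus>\<^bsub>A'\<^esub>i\<in>{..<k}. \<sigma> (r i) \<otimes>\<^bsub>A'\<^esub> a' i) = (\<Oplus>\<^bsub>A'\<^esub>i\<in>{..<k}. \<sigma> (r i \<otimes>\<^bsub>A\<^esub> a i))"
      using rA a a' ring_hom_closed[OF \<sigma>(1)] ring_hom_mult[OF \<sigma>(1)]
      by (intro A'.finsum_cong') (auto simp: Pi_iff)
    also have "\<dots> = \<sigma> (\<Oplus>\<^bsub>A\<^esub>i\<in>{..<k}. r i \<otimes>\<^bsub>A\<^esub> a i)"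
      using rA a by (intro abelian_group_hom.hom_finsum[OF \<sigma>_hom, symmetric]) auto
    also have "\<dots> = \<zero>\<^bsub>A'\<^esub>"
      using r abelian_group_hom.hom_zero[OF \<sigma>_hom] by (simp add: relations_def finsum_self_module)
    finally show "\<sigma> \<circ> r \<in> relations A' {..<k} (self_module A') a'"
      using rA ring_hom_closed[OF \<sigma>(1)] by (auto simp: relations_def finsum_self_module)
    show "\<tau> (r i \<odot>\<^bsub>N\<^esub> x) = (\<sigma> \<circ> r) i \<odot>\<^bsub>N'\<^esub> \<tau> x" if "x \<in> carrier N" "i \<in> {..<k}" for x i
      using that rA by (simp add: comm)
  qed
  then show "lin_comb N' {..<k} (relations A' {..<k} (self_module A') a') n'"
    by (rule lin_comb_cong) (simp add: n)
qed

section \<open>Finite ringed spaces\<close>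

locale finite_space =
  fixes X :: "('a, 'r) ringed_space"
  assumes finite_ringed_space: "finite_ringed_space X"
begin

abbreviation opn :: "'a set \<Rightarrow> bool" where "opn U \<equiv> openin (rs_top X) U"
abbreviation U :: "'a \<Rightarrow> 'a set" where "U x \<equiv> min_open X x"

lemma finite_points: "finite (points X)"
  and ringed_space: "is_ringed_space X"
  using finite_ringed_space by (auto simp: finite_ringed_space_def)

lemma open_subset: "opn V \<Longrightarrow> V \<subseteq> points X"
  by (rule openin_subset)

lemma finite_open: "opn V \<Longrightarrow> finite V"
  using open_subset finite_points finite_subset by blast

lemma open_min_open: "x \<in> points X \<Longrightarrow> opn (U x)"
  unfolding min_open_def
proof (rule openin_Inter)
  have "{V. opn V \<and> x \<in> V} \<subseteq> Pow (points X)" using open_subset by blast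
  then show "finite {V. opn V \<and> x \<in> V}" using finite_points by (meson finite_Pow_iff finite_subset)
qed (auto intro: openin_topspace)

lemma min_open_self: "x \<in> U x"
  by (auto simp: min_open_def)

lemma min_open_least: "opn V \<Longrightarrow> x \<in> V \<Longrightarrow> U x \<subseteq> V"
  by (auto simp: min_open_def)

lemma min_open_mono: "x \<in> points X \<Longrightarrow> y \<in> U x \<Longrightarrow> U y \<subseteq> U x"
  by (rule min_open_least[OF open_min_open])

lemma cring_sec: "opn V \<Longrightarrow> cring (sec X V)"
  using ringed_space by (auto simp: is_ringed_space_def)

lemma cring_stalk: "x \<in> points X \<Longrightarrow> cring (stalk X x)"
  unfolding stalk_def by (intro cring_sec open_min_open)

lemma res_hom: "opn V \<Longrightarrow> opn W \<Longrightarrow> W \<subseteq> V \<Longrightarrow> res X V W \<in> ring_hom (sec X V) (sec X W)"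
  using ringed_space by (auto simp: is_ringed_space_def)

lemma res_closed:
  "opn V \<Longrightarrow> opn W \<Longrightarrow> W \<subseteq> V \<Longrightarrow> s \<in> carrier (sec X V) \<Longrightarrow> res X V W s \<in> carrier (sec X W)"
  by (rule ring_hom_closed[OF res_hom])

lemma sheaf: "is_sheaf (rs_top X) (\<lambda>U. carrier (sec X U)) (res X)"
  using ringed_space by (auto simp: is_ringed_space_def)

lemmas sheaf_axioms =
  sheaf[unfolded is_sheaf_def, THEN conjunct2, THEN conjunct1]
  sheaf[unfolded is_sheaf_def, THEN conjunct2, THEN conjunct2, THEN conjunct1]
  sheaf[unfolded is_sheaf_def, THEN conjunct2, THEN conjunct2, THEN conjunct2, THEN conjunct1]

lemma res_id: "opn V \<Longrightarrow> s \<in> carrier (sec X V) \<Longrightarrow> res X V V s = s"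
  using sheaf_axioms(1) by blast

lemma res_res:
  "opn V \<Longrightarrow> opn W \<Longrightarrow> opn Z \<Longrightarrow> Z \<subseteq> W \<Longrightarrow> W \<subseteq> V \<Longrightarrow> s \<in> carrier (sec X V) \<Longrightarrow>
    res X W Z (res X V W s) = res X V Z s"
  using sheaf_axioms(2) by blast

lemma sections_eqI:
  assumes "\<And>V. V \<in> \<U> \<Longrightarrow> opn V" "s \<in> carrier (sec X (\<Union>\<U>))" "t \<in> carrier (sec X (\<Union>\<U>))"
    and "\<And>V. V \<in> \<U> \<Longrightarrow> res X (\<Union>\<U>) V s = res X (\<Union>\<U>) V t"
  shows "s = t"
  by (rule sheaf_axioms(3)[THEN spec, THEN mp, THEN bspec, THEN bspec, THEN mp]) (use assms in auto)

lemma sections_glue: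
  assumes "\<And>V. V \<in> \<U> \<Longrightarrow> opn V" "\<And>V. V \<in> \<U> \<Longrightarrow> s V \<in> carrier (sec X V)"
    and "\<And>V W. V \<in> \<U> \<Longrightarrow> W \<in> \<U> \<Longrightarrow> res X V (V \<inter> W) (s V) = res X W (V \<inter> W) (s W)"
  shows "\<exists>t\<in>carrier (sec X (\<Union>\<U>)). \<forall>V\<in>\<U>. res X (\<Union>\<U>) V t = s V"
proof -
  have *: "\<forall>\<U> s. (\<forall>V\<in>\<U>. opn V) \<and> (\<forall>V\<in>\<U>. s V \<in> carrier (sec X V)) \<and>
       (\<forall>V\<in>\<U>. \<forall>W\<in>\<U>. res X V (V \<inter> W) (s V) = res X W (V \<inter> W) (s W)) \<longrightarrow>
       (\<exists>t\<in>carrier (sec X (\<Union>\<U>)). \<forall>V\<in>\<U>. res X (\<Union>\<U>) V t = s V)"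
    by (rule sheaf[unfolded is_sheaf_def, THEN conjunct2, THEN conjunct2, THEN conjunct2, THEN conjunct2])
  show ?thesis by (rule *[THEN spec[of _ \<U>], THEN spec[of _ s], THEN mp])
      (intro conjI ballI assms(1) assms(2) assms(3); assumption)
qed

subsection \<open>Open subspaces\<close>

lemma open_subspace_simps [simp]:
  "sec (open_subspace X V) = sec X" "res (open_subspace X V) = res X"
  "rs_top (open_subspace X V) = subtopology (rs_top X) V"
  by (simp_all add: open_subspace_def)

lemma points_open_subspace: "opn V \<Longrightarrow> points (open_subspace X V) = V"
  using open_subset by (auto simp: topspace_subtopology)

lemma openin_open_subspace: "opn V \<Longrightarrow> openin (rs_top (open_subspace X V)) W \<longleftrightarrow> opn W \<and> W \<subseteq> V"
  by (simp add: openin_open_subtopology)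

lemma min_open_open_subspace:
  assumes "opn V" "x \<in> V"
  shows "min_open (open_subspace X V) x = U x"
proof
  show "min_open (open_subspace X V) x \<subseteq> U x"
  proof -
    have x: "x \<in> points X" using assms open_subset by blast
    have "openin (rs_top (open_subspace X V)) (U x)"
      unfolding openin_open_subspace[OF assms(1)]
      using open_min_open[OF x] min_open_least[OF assms] by simp
    then show ?thesis using min_open_self[of x] unfolding min_open_def[of "open_subspace X V"] by blast
  qed
  show "U x \<subseteq> min_open (open_subspace X V) x"
    using openin_open_subspace[OF assms(1)] unfolding min_open_def by blast
qed

lemma finite_ringed_space_open_subspace:
  assumes V: "opn V"
  shows "finite_ringed_space (open_subspace X V)"
proof -
  note o = openin_open_subspace[OF V, unfolded open_subspace_simps]
  have "is_sheaf (subtopology (rs_top X) V) (\<lambda>U. carrier (sec X U)) (res X)"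
    unfolding is_sheaf_def o
  proof (intro conjI allI impI)
    fix \<U> :: "'a set set" and s
    assume "(\<forall>W\<in>\<U>. opn W \<and> W \<subseteq> V) \<and> (\<forall>V\<in>\<U>. s V \<in> carrier (sec X V)) \<and>
      (\<forall>V\<in>\<U>. \<forall>W\<in>\<U>. res X V (V \<inter> W) (s V) = res X W (V \<inter> W) (s W))"
    then show "\<exists>t\<in>carrier (sec X (\<Union>\<U>)). \<forall>V\<in>\<U>. res X (\<Union>\<U>) V t = s V" 
      by (intro sections_glue) blast+
  qed (auto simp: res_closed res_id res_res intro: sections_eqI)
  then show ?thesis
    using finite_open[OF V] points_open_subspace[OF V] ringed_space
    by (simp add: finite_ringed_space_def is_ringed_space_def o)
qed

end

lemma product_ring_cong:
  assumes "\<And>i. i \<in> S \<Longrightarrow> R i = R' i"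
  shows "product_ring S R = product_ring S R'"
  using assms by (auto simp: product_ring_def fun_eq_iff restrict_def intro!: PiE_cong)

text \<open>Applied to the whole space this is the first condition on an affine space, and applied to
  \<open>U\<^sub>x \<inter> U\<^sub>y\<close> it is the third one.\<close>

definition faithful_to_stalks :: "('a, 'r) ringed_space \<Rightarrow> 'a set \<Rightarrow> bool" where
  "faithful_to_stalks X V \<longleftrightarrow>
    faithfully_flat_hom (sec X V) (product_ring V (stalk X)) (to_stalks X V V)"

text \<open>The natural map \<open>B \<otimes>\<^sub>A C \<rightarrow> D\<close>, for a commutative square of rings, is bijective. All structure maps
  are parameters, so that the square can be replaced by an isomorphic one and the base ring \<open>A\<close> by
  another one.\<close>

definition tensor_iso ::
  "'r ring \<Rightarrow> 'b ring \<Rightarrow> 'c ring \<Rightarrow> 'd ring \<Rightarrow> ('r \<Rightarrow> 'b) \<Rightarrow> ('r \<Rightarrow> 'c) \<Rightarrow> ('b \<Rightarrow> 'd) \<Rightarrow> ('c \<Rightarrow> 'd) \<Rightarrow>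
    ('r \<Rightarrow> 'd) \<Rightarrow> bool" where
  "tensor_iso A B C D \<alpha> \<beta> \<mu> \<nu> \<gamma> \<longleftrightarrow>
    bij_betw (tensor_lift A (module_along \<alpha> B) (module_along \<beta> C) (module_along \<gamma> D) (\<lambda>b c. \<mu> b \<otimes>\<^bsub>D\<^esub> \<nu> c))
      (carrier (tensor A (module_along \<alpha> B) (module_along \<beta> C))) (carrier D)"

lemma algebra_pair_bilinear:
  assumes "cring D" and hom: "\<alpha> \<in> ring_hom A B" "\<beta> \<in> ring_hom A C" "\<mu> \<in> ring_hom B D" "\<nu> \<in> ring_hom C D"
    and comp: "\<And>a. a \<in> carrier A \<Longrightarrow> \<mu> (\<alpha> a) = \<gamma> a" "\<And>a. a \<in> carrier A \<Longrightarrow> \<nu> (\<beta> a) = \<gamma> a"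
  shows "bilinear A (module_along \<alpha> B) (module_along \<beta> C) (module_along \<gamma> D) (\<lambda>b c. \<mu> b \<otimes>\<^bsub>D\<^esub> \<nu> c)"
proof -
  interpret D: cring D by fact
  note closed = ring_hom_closed[OF hom(1)] ring_hom_closed[OF hom(2)] ring_hom_closed[OF hom(3)]
    ring_hom_closed[OF hom(4)]
  show ?thesis
  proof (rule bilinearI)
    fix a b c assume "a \<in> carrier A" "b \<in> carrier (module_along \<alpha> B)" "c \<in> carrier (module_along \<beta> C)"
    then have *: "a \<in> carrier A" "b \<in> carrier B" "c \<in> carrier C" by simp_all
    have \<gamma>: "\<gamma> a \<in> carrier D" using closed(3)[OF closed(1)[OF *(1)]] comp(1)[OF *(1)] by simp
    have "\<mu> (\<alpha> a \<otimes>\<^bsub>B\<^esub> b) \<otimes>\<^bsub>D\<^esub> \<nu> c = (\<gamma> a \<otimes>\<^bsub>D\<^esub> \<mu> b) \<otimes>\<^bsub>D\<^esub> \<nu> c"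
      using * closed by (simp add: ring_hom_mult[OF hom(3)] comp)
    then show "\<mu> (a \<odot>\<^bsub>module_along \<alpha> B\<^esub> b) \<otimes>\<^bsub>D\<^esub> \<nu> c = a \<odot>\<^bsub>module_along \<gamma> D\<^esub> (\<mu> b \<otimes>\<^bsub>D\<^esub> \<nu> c)"
      using * closed \<gamma> by (simp add: D.m_assoc)
    have "\<mu> b \<otimes>\<^bsub>D\<^esub> \<nu> (\<beta> a \<otimes>\<^bsub>C\<^esub> c) = \<mu> b \<otimes>\<^bsub>D\<^esub> (\<gamma> a \<otimes>\<^bsub>D\<^esub> \<nu> c)"
      using * closed by (simp add: ring_hom_mult[OF hom(4)] comp)
    then show "\<mu> b \<otimes>\<^bsub>D\<^esub> \<nu> (a \<odot>\<^bsub>module_along \<beta> C\<^esub> c) = a \<odot>\<^bsub>module_along \<gamma> D\<^esub> (\<mu> b \<otimes>\<^bsub>D\<^esub> \<nu> c)"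
      using * closed \<gamma> by (simp add: D.m_lcomm)
  qed (simp_all add: closed ring_hom_add[OF hom(3)] ring_hom_add[OF hom(4)] D.l_distr D.r_distr)
qed

lemma tensor_iso_transfer:
  assumes rings: "cring A" "cring B" "cring C" "cring D" "cring A'" "cring B'" "cring C'" "cring D'"
    and \<alpha>: "\<alpha> \<in> ring_hom A B" "\<alpha>' \<in> ring_hom A' B'" and \<beta>: "\<beta> \<in> ring_hom A C" "\<beta>' \<in> ring_hom A' C'"
    and \<mu>: "\<mu> \<in> ring_hom B D" "\<mu>' \<in> ring_hom B' D'" and \<nu>: "\<nu> \<in> ring_hom C D" "\<nu>' \<in> ring_hom C' D'"
    and \<gamma>: "\<gamma> \<in> ring_hom A D" "\<gamma>' \<in> ring_hom A' D'"
    and comp: "\<And>a. a \<in> carrier A \<Longrightarrow> \<mu> (\<alpha> a) = \<gamma> a" "\<And>a. a \<in> carrier A \<Longrightarrow> \<nu> (\<beta> a) = \<gamma> a"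
      "\<And>a. a \<in> carrier A' \<Longrightarrow> \<mu>' (\<alpha>' a) = \<gamma>' a" "\<And>a. a \<in> carrier A' \<Longrightarrow> \<nu>' (\<beta>' a) = \<gamma>' a"
    and \<sigma>: "\<sigma> \<in> ring_hom A A'"
    and u: "u \<in> ring_hom B B'" "u ` carrier B = carrier B'"
    and v: "v \<in> ring_hom C C'" "v ` carrier C = carrier C'"
    and w: "w \<in> ring_hom D D'" "bij_betw w (carrier D) (carrier D')"
    and comm: "\<And>a. a \<in> carrier A \<Longrightarrow> u (\<alpha> a) = \<alpha>' (\<sigma> a)" "\<And>a. a \<in> carrier A \<Longrightarrow> v (\<beta> a) = \<beta>' (\<sigma> a)"
      "\<And>b. b \<in> carrier B \<Longrightarrow> w (\<mu> b) = \<mu>' (u b)" "\<And>c. c \<in> carrier C \<Longrightarrow> w (\<nu> c) = \<nu>' (v c)"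
    and iso: "tensor_iso A B C D \<alpha> \<beta> \<mu> \<nu> \<gamma>"
  shows "tensor_iso A' B' C' D' \<alpha>' \<beta>' \<mu>' \<nu>' \<gamma>'"
proof -
  have bil: "bilinear A (module_along \<alpha> B) (module_along \<beta> C) (module_along \<gamma> D) (\<lambda>b c. \<mu> b \<otimes>\<^bsub>D\<^esub> \<nu> c)"
    by (rule algebra_pair_bilinear[OF rings(4) \<alpha>(1) \<beta>(1) \<mu>(1) \<nu>(1) comp(1,2)])
  have bil': "bilinear A' (module_along \<alpha>' B') (module_along \<beta>' C') (module_along \<gamma>' D')
      (\<lambda>b c. \<mu>' b \<otimes>\<^bsub>D'\<^esub> \<nu>' c)"
    by (rule algebra_pair_bilinear[OF rings(8) \<alpha>(2) \<beta>(2) \<mu>(2) \<nu>(2) comp(3,4)])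
  have mods: "Module.module A (module_along \<alpha> B)" "Module.module A (module_along \<beta> C)"
    "Module.module A (module_along \<gamma> D)" "Module.module A' (module_along \<alpha>' B')"
    "Module.module A' (module_along \<beta>' C')" "Module.module A' (module_along \<gamma>' D')"
    by (intro module_module_along rings \<alpha> \<beta> \<gamma>)+
  have add: "abelian_group_hom (module_along \<phi> R) (module_along \<psi> S) h"
    if "cring R" "cring S" "h \<in> ring_hom R S" for \<phi> :: "'i \<Rightarrow> 'j" and \<psi> :: "'k \<Rightarrow> 'l" and R S h
    using cring_module_along[OF that(1), of \<phi>] cring_module_along[OF that(2), of \<psi>] that(3)
    by (intro additive_mapI) (auto simp: cring_def ring_def ring_hom_def)
  have "bij_betw (tensor_lift A' (module_along \<alpha>' B') (module_along \<beta>' C') (module_along \<gamma>' D')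
      (\<lambda>b c. \<mu>' b \<otimes>\<^bsub>D'\<^esub> \<nu>' c)) (carrier (tensor A' (module_along \<alpha>' B') (module_along \<beta>' C')))
      (carrier (module_along \<gamma>' D'))"
  proof (rule tensor_lift_bij_transfer[OF mods bil bil' \<sigma>, of u v w])
    show "bij_betw (tensor_lift A (module_along \<alpha> B) (module_along \<beta> C) (module_along \<gamma> D)
      (\<lambda>b c. \<mu> b \<otimes>\<^bsub>D\<^esub> \<nu> c)) (carrier (tensor A (module_along \<alpha> B) (module_along \<beta> C)))
      (carrier (module_along \<gamma> D))"
      using iso by (simp add: tensor_iso_def)
  qed (use u v w comm in \<open>auto simp: ring_hom_mult[OF u(1)] ring_hom_mult[OF v(1)]
      ring_hom_mult[OF w(1)] ring_hom_closed[OF \<alpha>(1)] ring_hom_closed[OF \<beta>(1)]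
      ring_hom_closed[OF \<mu>(1)] ring_hom_closed[OF \<nu>(1)] intro!: add rings\<close>)
  then show ?thesis by (simp add: tensor_iso_def)
qed

definition stalk_tensor_iso_over :: "('a, 'r) ringed_space \<Rightarrow> 'a set \<Rightarrow> 'a \<Rightarrow> 'a \<Rightarrow> bool" where
  "stalk_tensor_iso_over X V x y \<longleftrightarrow>
    (let Ux = min_open X x; Uy = min_open X y; Uxy = Ux \<inter> Uy in
      tensor_iso (sec X V) (sec X Ux) (sec X Uy) (sec X Uxy) (res X V Ux) (res X V Uy)
        (res X Ux Uxy) (res X Uy Uxy) (res X V Uxy))"

lemma stalk_tensor_iso_eq: "stalk_tensor_iso X x y = stalk_tensor_iso_over X (points X) x y"
  by (simp add: stalk_tensor_iso_def stalk_tensor_iso_over_def tensor_iso_def stalk_def Let_def)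

context finite_space
begin

lemma faithful_to_stalks_iff:
  assumes V: "opn V"
  shows "faithful_to_stalks X V \<longleftrightarrow>
    (\<forall>z\<in>V. equationally_flat (sec X V) (module_along (res X V (U z)) (sec X (U z)))) \<and>
    (\<forall>I. ideal I (sec X V) \<longrightarrow>
      (\<forall>z\<in>V. \<one>\<^bsub>sec X (U z)\<^esub> \<in> genideal (sec X (U z)) (res X V (U z) ` I)) \<longrightarrow> \<one>\<^bsub>sec X V\<^esub> \<in> I)"
proof -
  have z: "z \<in> points X" "opn (U z)" "U z \<subseteq> V" if "z \<in> V" for z
    using V that open_subset open_min_open min_open_least by blast+
  have "to_stalks X V V = (\<lambda>a. \<lambda>z\<in>V. res X V (U z) a)" by (simp add: fun_eq_iff to_stalks_def)
  then show ?thesis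
    unfolding faithful_to_stalks_def
    using faithfully_flat_hom_product_iff[OF cring_sec[OF V], of V "stalk X" "\<lambda>z. res X V (U z)"]
      z V finite_open[OF V] cring_stalk res_hom by (simp add: stalk_def)
qed

text \<open>The tensor product over the sections on the smaller set \<open>W\<close> is a quotient of that over the
  sections on \<open>V\<close>, and both maps into \<open>O\<^sub>x\<^sub>y\<close> are lifts of the
  product map: the one from the quotient is bijective if the other is.\<close>

lemma stalk_tensor_iso_over_smaller:
  assumes V: "opn V" and W: "opn W" "W \<subseteq> V" and xy: "x \<in> W" "y \<in> W"
    and iso: "stalk_tensor_iso_over X V x y"
  shows "stalk_tensor_iso_over X W x y"
proof -
  have o: "opn (U x)" "opn (U y)" "opn (U x \<inter> U y)" "U x \<subseteq> W" "U y \<subseteq> W"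
    using xy W open_subset[OF W(1)] min_open_least[OF W(1)] by (auto intro!: openin_Int open_min_open)
  have sub: "U x \<subseteq> V" "U y \<subseteq> V" "U x \<inter> U y \<subseteq> V" "U x \<inter> U y \<subseteq> W" using o W by auto
  show ?thesis
    using iso unfolding stalk_tensor_iso_over_def Let_def
    by (rule tensor_iso_transfer[rotated -1, where \<sigma> = "res X V W" and u = "\<lambda>s. s" and v = "\<lambda>s. s" and w = "\<lambda>s. s"])
      (use V W o sub in \<open>auto intro!: cring_sec res_hom simp: res_res bij_betw_def ring_hom_def[of "sec X (U x)" "sec X (U x)"]
         ring_hom_def[of "sec X (U y)" "sec X (U y)"] ring_hom_def[of "sec X (U x \<inter> U y)" "sec X (U x \<inter> U y)"]\<close>)
qed

lemma affine_open_subspace_iff: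
  assumes V: "opn V"
  shows "affine_space (open_subspace X V) \<longleftrightarrow>
    faithful_to_stalks X V \<and> (\<forall>x\<in>V. \<forall>y\<in>V. stalk_tensor_iso_over X V x y) \<and>
    (\<forall>x\<in>V. \<forall>y\<in>V. faithful_to_stalks X (U x \<inter> U y))"
proof -
  let ?V = "open_subspace X V"
  have p: "points ?V = V" by (rule points_open_subspace[OF V])
  have m: "min_open ?V x = U x" if "x \<in> V" for x by (rule min_open_open_subspace[OF V that])
  have ff: "faithful_to_stalks ?V W \<longleftrightarrow> faithful_to_stalks X W" if "W \<subseteq> V" for W
  proof -
    have "product_ring W (stalk ?V) = product_ring W (stalk X)"
      using that m by (intro product_ring_cong) (auto simp: stalk_def)
    moreover have "to_stalks ?V W W = to_stalks X W W"
      using that m by (auto simp: to_stalks_def fun_eq_iff restrict_def)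
    ultimately show ?thesis by (simp add: faithful_to_stalks_def)
  qed
  have ti: "stalk_tensor_iso ?V x y \<longleftrightarrow> stalk_tensor_iso_over X V x y" if "x \<in> V" "y \<in> V" for x y
    unfolding stalk_tensor_iso_eq p using that by (simp add: stalk_tensor_iso_over_def m)
  have sub: "U x \<inter> U y \<subseteq> V" if "x \<in> V" for x y using min_open_least[OF V that] by blast
  have "affine_space ?V \<longleftrightarrow> faithful_to_stalks ?V V \<and> (\<forall>x\<in>V. \<forall>y\<in>V. stalk_tensor_iso ?V x y) \<and>
      (\<forall>x\<in>V. \<forall>y\<in>V. faithful_to_stalks ?V (min_open ?V x \<inter> min_open ?V y))"
    unfolding affine_space_def p faithful_to_stalks_def Let_def
    using finite_ringed_space_open_subspace[OF V] by blast
  then show ?thesis by (simp add: ff ti m sub)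
qed

text \<open>The flatness conditions for \<open>U\<^sub>x \<inter> U\<^sub>y\<close> are instances of those for \<open>V\<close>; for the tensor products
  only the base ring changes.\<close>

lemma affine_min_open_Int:
  assumes V: "opn V" and aff: "affine_space (open_subspace X V)" and xy: "x \<in> V" "y \<in> V"
  shows "affine_space (open_subspace X (U x \<inter> U y))"
proof -
  have W: "opn (U x \<inter> U y)" "U x \<inter> U y \<subseteq> V"
    using xy open_subset[OF V] min_open_least[OF V] by (auto intro!: openin_Int open_min_open)
  show ?thesis
    using aff W xy stalk_tensor_iso_over_smaller[OF V W]
    unfolding affine_open_subspace_iff[OF V] affine_open_subspace_iff[OF W(1)] by blast
qed

lemma affine_min_open:
  assumes "opn V" "affine_space (open_subspace X V)" "x \<in> V"
  shows "affine_space (open_subspace X (U x))"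
  using affine_min_open_Int[OF assms(1,2,3,3)] by simp

end

section \<open>Quasi-isomorphisms\<close>

lemma genideal_mono: "S \<subseteq> T \<Longrightarrow> genideal R S \<subseteq> genideal R T"
  by (auto simp: genideal_def)

text \<open>What the proof uses of a quasi-isomorphism to a T0 schematic space: the comorphisms are
  bijective and preimages of affine open sets are affine.\<close>

locale quasi_iso = X: finite_space X + Y: finite_space Y
  for X :: "('a, 'r) ringed_space" and Y :: "('b, 's) ringed_space" +
  fixes f :: "('a, 'r, 'b, 's) rs_map"
  assumes morphism: "rs_morphism X Y f"
    and comap_iso: "\<And>V. openin (rs_top Y) V \<Longrightarrow>
      comap f V \<in> ring_iso (sec Y V) (sec X (preim X (pmap f) V))"
    and affine_preim: "\<And>V. openin (rs_top Y) V \<Longrightarrow> affine_space (open_subspace Y V) \<Longrightarrow>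
      affine_space (open_subspace X (preim X (pmap f) V))"
    and schematic: "schematic_space Y"
    and t0: "t0_space (rs_top Y)"
begin

abbreviation F where "F \<equiv> pmap f"
abbreviation pre where "pre \<equiv> preim X (pmap f)"

lemma F_points: "x \<in> points X \<Longrightarrow> F x \<in> points Y"
  using morphism by (auto simp: rs_morphism_def continuous_map_def Pi_iff)

lemma mem_pre: "x \<in> pre V \<longleftrightarrow> x \<in> points X \<and> F x \<in> V"
  by (simp add: preim_def)

lemma pre_mono: "V \<subseteq> W \<Longrightarrow> pre V \<subseteq> pre W"
  by (auto simp: preim_def)

lemma pre_Int: "pre (V \<inter> W) = pre V \<inter> pre W"
  by (auto simp: preim_def)

lemma pre_open: "Y.opn V \<Longrightarrow> X.opn (pre V)"
  using morphism by (auto simp: rs_morphism_def continuous_map_def preim_def)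

lemma pre_U_open: "x \<in> points X \<Longrightarrow> X.opn (pre (Y.U (F x)))"
  by (intro pre_open Y.open_min_open F_points)

lemma mem_pre_U: "x \<in> points X \<Longrightarrow> x \<in> pre (Y.U (F x))"
  by (simp add: mem_pre Y.min_open_self)

lemma comap_hom: "Y.opn V \<Longrightarrow> comap f V \<in> ring_hom (sec Y V) (sec X (pre V))"
  and comap_bij: "Y.opn V \<Longrightarrow> bij_betw (comap f V) (carrier (sec Y V)) (carrier (sec X (pre V)))"
  using comap_iso by (auto simp: ring_iso_def)

lemma comap_res:
  "Y.opn V \<Longrightarrow> Y.opn W \<Longrightarrow> W \<subseteq> V \<Longrightarrow> s \<in> carrier (sec Y V) \<Longrightarrow>
    comap f W (res Y V W s) = res X (pre V) (pre W) (comap f V s)"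
  using morphism[unfolded rs_morphism_def, THEN conjunct2, THEN conjunct2] by simp

lemma t0_eq:
  assumes "y \<in> points Y" "y' \<in> points Y" "y \<in> Y.U y'" "y' \<in> Y.U y"
  shows "y = y'"
proof (rule ccontr)
  assume "y \<noteq> y'"
  then obtain V where "Y.opn V" "y \<notin> V \<longleftrightarrow> y' \<in> V"
    using t0 assms(1,2) unfolding t0_space_def by blast
  then show False using Y.min_open_least assms(3,4) by blast
qed

lemma affine_U:
  assumes "y \<in> points Y"
  shows "affine_space (open_subspace Y (Y.U y))"
proof -
  obtain \<W> where \<W>: "affine_open_covering Y \<W>" using schematic by (auto simp: schematic_space_def)
  then have "y \<in> \<Union>\<W>" using assms by (simp add: affine_open_covering_def)
  then obtain V where "V \<in> \<W>" "y \<in> V" by blast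
  with \<W> show ?thesis
    by (intro Y.affine_min_open[of V]) (simp_all add: affine_open_covering_def)
qed

text \<open>This is the flatness of \<open>O\<^sub>Y(W) \<rightarrow> O\<^sub>Y\<^sub>,\<^sub>y\<close>, read through the comorphisms.\<close>

lemma flat_pre:
  assumes W: "Y.opn W" "affine_space (open_subspace Y W)" and y: "y \<in> W"
  shows "equationally_flat (sec X (pre W))
    (module_along (res X (pre W) (pre (Y.U y))) (sec X (pre (Y.U y))))"
proof -
  have U: "Y.opn (Y.U y)" "Y.U y \<subseteq> W"
    using Y.open_subset[OF W(1)] y Y.min_open_least[OF W(1) y] by (auto intro!: Y.open_min_open)
  note pre = pre_open[OF W(1)] pre_open[OF U(1)] pre_mono[OF U(2)]
  have "faithful_to_stalks Y W" using W(2) Y.affine_open_subspace_iff[OF W(1)] by blast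
  then have "equationally_flat (sec Y W) (module_along (res Y W (Y.U y)) (sec Y (Y.U y)))"
    using y Y.faithful_to_stalks_iff[OF W(1)] by blast
  then show ?thesis
  proof (rule equationally_flat_transport[rotated -1])
    show "comap f W \<in> ring_hom (sec Y W) (sec X (pre W))"
      "bij_betw (comap f W) (carrier (sec Y W)) (carrier (sec X (pre W)))"
      using W(1) by (rule comap_hom comap_bij)+
    show "Module.module (sec Y W) (module_along (res Y W (Y.U y)) (sec Y (Y.U y)))"
      by (intro module_module_along Y.cring_sec Y.res_hom W U)
    show "Module.module (sec X (pre W)) (module_along (res X (pre W) (pre (Y.U y))) (sec X (pre (Y.U y))))"
      by (intro module_module_along X.cring_sec X.res_hom pre)
    show "bij_betw (comap f (Y.U y)) (carrier (module_along (res Y W (Y.U y)) (sec Y (Y.U y))))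
      (carrier (module_along (res X (pre W) (pre (Y.U y))) (sec X (pre (Y.U y)))))"
      using comap_bij[OF U(1)] by simp
    show "abelian_group_hom (module_along (res Y W (Y.U y)) (sec Y (Y.U y)))
      (module_along (res X (pre W) (pre (Y.U y))) (sec X (pre (Y.U y)))) (comap f (Y.U y))"
    proof (rule additive_mapI)
      have "cring (module_along (res Y W (Y.U y)) (sec Y (Y.U y)))"
        "cring (module_along (res X (pre W) (pre (Y.U y))) (sec X (pre (Y.U y))))"
        by (intro cring_module_along Y.cring_sec X.cring_sec U pre)+
      then show "abelian_group (module_along (res Y W (Y.U y)) (sec Y (Y.U y)))"
        "abelian_group (module_along (res X (pre W) (pre (Y.U y))) (sec X (pre (Y.U y))))"
        by (simp_all add: cring_def ring_def)
    qed (simp_all add: ring_hom_closed[OF comap_hom[OF U(1)]] ring_hom_add[OF comap_hom[OF U(1)]])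
    show "comap f (Y.U y) (a \<odot>\<^bsub>module_along (res Y W (Y.U y)) (sec Y (Y.U y))\<^esub> n) =
        comap f W a \<odot>\<^bsub>module_along (res X (pre W) (pre (Y.U y))) (sec X (pre (Y.U y)))\<^esub> comap f (Y.U y) n"
      if "a \<in> carrier (sec Y W)" "n \<in> carrier (module_along (res Y W (Y.U y)) (sec Y (Y.U y)))" for a n
      using that W U
      by (simp add: ring_hom_mult[OF comap_hom[OF U(1)]] Y.res_closed comap_res)
  qed
qed

text \<open>Faithfulness, in contrast, comes from \<open>X\<close>: the subspace \<open>f\<^sup>-\<^sup>1(W)\<close> is affine, and its restriction map to the
  stalk at a point \<open>x\<close> factors through the sections over \<open>f\<^sup>-\<^sup>1(U\<^sub>f\<^sub>x)\<close>.\<close>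

lemma faithful_pre:
  assumes W: "Y.opn W" "affine_space (open_subspace Y W)" and I: "ideal I (sec X (pre W))"
    and one: "\<And>x. x \<in> pre W \<Longrightarrow> \<one>\<^bsub>sec X (pre (Y.U (F x)))\<^esub> \<in>
      genideal (sec X (pre (Y.U (F x)))) (res X (pre W) (pre (Y.U (F x))) ` I)"
  shows "\<one>\<^bsub>sec X (pre W)\<^esub> \<in> I"
proof -
  note o = pre_open[OF W(1)]
  have IW: "a \<in> carrier (sec X (pre W))" if "a \<in> I" for a using ideal.Icarr[OF I that] .
  have "faithful_to_stalks X (pre W)"
    using affine_preim[OF W] X.affine_open_subspace_iff[OF o] by blast
  moreover have "\<one>\<^bsub>sec X (X.U x)\<^esub> \<in> genideal (sec X (X.U x)) (res X (pre W) (X.U x) ` I)"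
    if x: "x \<in> pre W" for x
  proof -
    have xX: "x \<in> points X" using x by (simp add: mem_pre)
    let ?V = "pre (Y.U (F x))"
    have V: "X.opn ?V" "?V \<subseteq> pre W"
      using x pre_U_open[OF xX] pre_mono[OF Y.min_open_least[OF W(1)]] by (simp_all add: mem_pre)
    have U: "X.opn (X.U x)" "X.U x \<subseteq> ?V"
      using X.open_min_open[OF xX] X.min_open_least[OF V(1) mem_pre_U[OF xX]] by simp_all
    have "res X ?V (X.U x) \<one>\<^bsub>sec X ?V\<^esub> \<in>
        genideal (sec X (X.U x)) (res X ?V (X.U x) ` res X (pre W) ?V ` I)"
      by (rule genideal_hom[OF X.cring_sec[OF V(1)] X.cring_sec[OF U(1)] X.res_hom[OF V(1) U] _ one[OF x]])
        (use X.res_closed[OF o V] IW in auto)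
    moreover have "res X ?V (X.U x) ` res X (pre W) ?V ` I = res X (pre W) (X.U x) ` I"
      unfolding image_image using IW o V U by (intro image_cong) (auto simp: X.res_res)
    ultimately show ?thesis using ring_hom_one[OF X.res_hom[OF V(1) U]] by simp
  qed
  ultimately show ?thesis using X.faithful_to_stalks_iff[OF o] I by blast
qed

text \<open>Flatness holds because \<open>U\<^sub>p\<close> is affine. For the ideals, every point \<open>x\<close> of \<open>f\<^sup>-\<^sup>1(U\<^sub>p)\<close> is mapped to a
  point strictly above \<open>p\<close>, as \<open>p\<close> has no preimage, so that \<open>faithful_pre\<close> applies.\<close>

lemma removable_outside_image:
  assumes p: "p \<in> points Y" "p \<notin> F ` points X"
  shows "removable Y p"
proof -
  let ?A = "sec Y (Y.U p)" and ?S = "{q \<in> points Y. Y.U q \<subset> Y.U p}"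
  have U: "Y.opn (Y.U p)" by (rule Y.open_min_open[OF p(1)])
  note aff = affine_U[OF p(1)]
  have S: "z \<in> points Y" "z \<in> Y.U p" "Y.opn (Y.U z)" "Y.U z \<subseteq> Y.U p" if "z \<in> ?S" for z
    using that Y.min_open_self[of z] Y.open_min_open[of z] by auto
  have "faithfully_flat_hom ?A (product_ring ?S (stalk Y)) (\<lambda>a. \<lambda>z\<in>?S. res Y (Y.U p) (Y.U z) a)"
  proof (subst faithfully_flat_hom_product_iff)
    show "(\<forall>s\<in>?S. equationally_flat ?A (module_along (res Y (Y.U p) (Y.U s)) (stalk Y s))) \<and>
      (\<forall>I. ideal I ?A \<longrightarrow> (\<forall>s\<in>?S. \<one>\<^bsub>stalk Y s\<^esub> \<in> genideal (stalk Y s) (res Y (Y.U p) (Y.U s) ` I)) \<longrightarrow>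
        \<one>\<^bsub>?A\<^esub> \<in> I)"
    proof (intro conjI ballI allI impI)
      fix s assume "s \<in> ?S"
      then show "equationally_flat ?A (module_along (res Y (Y.U p) (Y.U s)) (stalk Y s))"
        using aff S(2)[of s] Y.affine_open_subspace_iff[OF U] Y.faithful_to_stalks_iff[OF U]
        unfolding stalk_def by blast
    next
      fix I assume I: "ideal I ?A"
        and one: "\<forall>s\<in>?S. \<one>\<^bsub>stalk Y s\<^esub> \<in> genideal (stalk Y s) (res Y (Y.U p) (Y.U s) ` I)"
      let ?B = "sec X (pre (Y.U p))"
      let ?\<kappa> = "inv_into (carrier ?A) (comap f (Y.U p))"
      have A: "cring ?A" and B: "cring ?B" using Y.cring_sec[OF U] X.cring_sec[OF pre_open[OF U]] by auto
      have "?\<kappa> \<in> ring_iso ?B ?A"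
        using A comap_iso[OF U] by (intro ring_iso_set_sym) (auto simp: cring_def)
      then have \<kappa>: "?\<kappa> \<in> ring_hom ?B ?A" by (simp add: ring_iso_def)
      have \<kappa>_comap: "?\<kappa> (comap f (Y.U p) a) = a" if "a \<in> carrier ?A" for a
        using that comap_bij[OF U] by (simp add: bij_betw_def)
      let ?I = "{b \<in> carrier ?B. ?\<kappa> b \<in> I}"
      have "\<one>\<^bsub>?B\<^esub> \<in> ?I"
      proof (rule faithful_pre[OF U aff])
        show "ideal ?I ?B" by (rule ideal_vimage[OF B A \<kappa> I])
        fix x assume x: "x \<in> pre (Y.U p)"
        then have xX: "x \<in> points X" and Fx: "F x \<in> Y.U p" by (auto simp: mem_pre)
        let ?q = "F x"
        have qp: "?q \<noteq> p" using p(2) xX by blast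
        have "Y.U ?q \<subseteq> Y.U p" using Fx by (rule Y.min_open_mono[OF p(1)])
        moreover have "p \<notin> Y.U ?q" using t0_eq[OF p(1) F_points[OF xX]] qp Fx by auto
        ultimately have q: "?q \<in> ?S" using Y.min_open_self[of p] F_points[OF xX] by blast
        note V = S[OF q]
        have Vp: "X.opn (pre (Y.U ?q))" using V by (intro pre_open)
        have IA: "a \<in> carrier ?A" if "a \<in> I" for a using ideal.Icarr[OF I that] .
        have "comap f (Y.U ?q) \<one>\<^bsub>sec Y (Y.U ?q)\<^esub> \<in>
          genideal (sec X (pre (Y.U ?q))) (comap f (Y.U ?q) ` res Y (Y.U p) (Y.U ?q) ` I)"
        proof (rule genideal_hom[OF Y.cring_sec[OF V(3)] X.cring_sec[OF Vp] comap_hom[OF V(3)]])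
          show "res Y (Y.U p) (Y.U ?q) ` I \<subseteq> carrier (sec Y (Y.U ?q))"
            using Y.res_closed[OF U V(3,4)] IA by auto
          show "\<one>\<^bsub>sec Y (Y.U ?q)\<^esub> \<in> genideal (sec Y (Y.U ?q)) (res Y (Y.U p) (Y.U ?q) ` I)"
            using one q unfolding stalk_def by blast
        qed
        moreover have "comap f (Y.U ?q) ` res Y (Y.U p) (Y.U ?q) ` I \<subseteq>
            res X (pre (Y.U p)) (pre (Y.U ?q)) ` ?I"
        proof
          fix b assume "b \<in> comap f (Y.U ?q) ` res Y (Y.U p) (Y.U ?q) ` I"
          then obtain a where a: "a \<in> I" "b = comap f (Y.U ?q) (res Y (Y.U p) (Y.U ?q) a)" by blast
          then have "b = res X (pre (Y.U p)) (pre (Y.U ?q)) (comap f (Y.U p) a)"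
            using comap_res[OF U V(3,4)] IA by simp
          moreover have "comap f (Y.U p) a \<in> ?I"
            using a IA \<kappa>_comap ring_hom_closed[OF comap_hom[OF U]] by simp
          ultimately show "b \<in> res X (pre (Y.U p)) (pre (Y.U ?q)) ` ?I" by blast
        qed
        ultimately show "\<one>\<^bsub>sec X (pre (Y.U ?q))\<^esub> \<in>
            genideal (sec X (pre (Y.U ?q))) (res X (pre (Y.U p)) (pre (Y.U ?q)) ` ?I)"
          using ring_hom_one[OF comap_hom[OF V(3)]] genideal_mono by fastforce
      qed
      then show "\<one>\<^bsub>?A\<^esub> \<in> I" using ring_hom_one[OF \<kappa>] by simp
    qed
  next
    show "cring ?A" by (rule Y.cring_sec[OF U])
    show "cring (stalk Y s)" if "s \<in> ?S" for s by (rule Y.cring_stalk[OF S(1)[OF that]])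
    show "res Y (Y.U p) (Y.U s) \<in> ring_hom ?A (stalk Y s)" if "s \<in> ?S" for s
      unfolding stalk_def by (rule Y.res_hom[OF U S(3,4)[OF that]])
    show "finite ?S" using Y.finite_points by simp
  qed
  moreover have "to_stalks Y (Y.U p) ?S = (\<lambda>a. \<lambda>z\<in>?S. res Y (Y.U p) (Y.U z) a)"
    by (simp add: to_stalks_def fun_eq_iff)
  ultimately show ?thesis
    using p(1) by (simp add: removable_def stalk_def Let_def)
qed

section \<open>The quotient by the covering\<close>

abbreviation \<V> where "\<V> \<equiv> preimage_cover X Y f"
abbreviation q where "q \<equiv> cover_class X \<V>"
abbreviation qre where "qre \<equiv> preim X q"
abbreviation Q where "Q \<equiv> cover_space X \<V>"

lemma cover_nbhd_eq:
  assumes x: "x \<in> points X"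
  shows "cover_nbhd \<V> x = pre (Y.U (F x))"
proof
  show "cover_nbhd \<V> x \<subseteq> pre (Y.U (F x))"
    using mem_pre_U[OF x] F_points[OF x] unfolding cover_nbhd_def preimage_cover_def by blast
  show "pre (Y.U (F x)) \<subseteq> cover_nbhd \<V> x"
    unfolding cover_nbhd_def preimage_cover_def
    using Y.min_open_mono[THEN subsetD] by (auto simp: mem_pre)
qed

lemma affine_covering: "affine_open_covering X \<V>"
proof -
  have "x \<in> \<Union>\<V>" if "x \<in> points X" for x
    using mem_pre_U[OF that] F_points[OF that] by (auto simp: preimage_cover_def)
  moreover have "X.opn V" "affine_space (open_subspace X V)" if V: "V \<in> \<V>" for V
    using V by (auto simp: preimage_cover_def intro!: pre_open Y.open_min_open affine_preim affine_U)
  moreover have "\<Union>\<V> \<subseteq> points X" by (auto simp: preimage_cover_def mem_pre)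
  ultimately show ?thesis unfolding affine_open_covering_def by blast
qed

lemma pre_U_subset_iff:
  assumes "x \<in> points X" "x' \<in> points X"
  shows "pre (Y.U (F x')) \<subseteq> pre (Y.U (F x)) \<longleftrightarrow> F x' \<in> Y.U (F x)"
proof
  assume "pre (Y.U (F x')) \<subseteq> pre (Y.U (F x))"
  then have "x' \<in> pre (Y.U (F x))" using mem_pre_U[OF assms(2)] by (rule subsetD)
  then show "F x' \<in> Y.U (F x)" by (simp add: mem_pre)
next
  assume "F x' \<in> Y.U (F x)"
  then show "pre (Y.U (F x')) \<subseteq> pre (Y.U (F x))"
    by (intro pre_mono Y.min_open_mono F_points assms(1))
qed

text \<open>The classes are the fibres of \<open>f\<close>; this is where the T0 axiom enters.\<close>

lemma mem_q: "x \<in> points X \<Longrightarrow> x' \<in> q x \<longleftrightarrow> x' \<in> points X \<and> F x' = F x"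
proof -
  assume x: "x \<in> points X"
  have "pre (Y.U (F x')) = pre (Y.U (F x)) \<longleftrightarrow> F x' = F x" if x': "x' \<in> points X"
    using pre_U_subset_iff[OF x x'] pre_U_subset_iff[OF x' x] t0_eq[OF F_points[OF x'] F_points[OF x]]
    by (metis subset_refl subset_antisym)
  moreover have "x' \<in> q x \<longleftrightarrow> x' \<in> points X \<and> cover_nbhd \<V> x' = cover_nbhd \<V> x"
    unfolding cover_class_def by (rule mem_Collect_eq)
  ultimately show ?thesis using cover_nbhd_eq[OF x] cover_nbhd_eq[of x'] by metis
qed

lemma q_eq_iff:
  assumes "x \<in> points X" "x' \<in> points X"
  shows "q x = q x' \<longleftrightarrow> F x = F x'"
proof
  assume eq: "q x = q x'"
  have "x \<in> q x" using mem_q[OF assms(1), of x] assms(1) by blast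
  then have "x \<in> q x'" unfolding eq .
  then show "F x = F x'" using mem_q[OF assms(2)] by simp
next
  assume "F x = F x'"
  then have "z \<in> q x \<longleftrightarrow> z \<in> q x'" for z
    using mem_q[OF assms(1), of z] mem_q[OF assms(2), of z] by simp
  then show "q x = q x'" by (rule Set.set_eqI)
qed

lemma q_pre: "x \<in> points X \<Longrightarrow> q x \<in> q ` pre V \<longleftrightarrow> F x \<in> V"
proof -
  assume x: "x \<in> points X"
  show ?thesis
  proof
    assume "q x \<in> q ` pre V"
    then obtain x' where x': "q x = q x'" "x' \<in> pre V" by (rule imageE)
    then have "F x = F x'" using q_eq_iff[OF x, of x'] mem_pre[of x' V] by blast
    then show "F x \<in> V" using x'(2) by (simp add: mem_pre)
  next
    assume "F x \<in> V"
    then show "q x \<in> q ` pre V" using x by (intro imageI) (simp add: mem_pre)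
  qed
qed

lemma cover_le_iff:
  assumes "x \<in> points X" "x' \<in> points X"
  shows "cover_le \<V> (q x) (q x') \<longleftrightarrow> F x' \<in> Y.U (F x)"
proof -
  have nbhd: "cover_nbhd \<V> z = pre (Y.U (F w))" if "w \<in> points X" "z \<in> q w" for w z
    using that mem_q[OF that(1), of z] cover_nbhd_eq[of z] by metis
  have self: "w \<in> q w" if "w \<in> points X" for w using mem_q[OF that, of w] that by blast
  have "cover_le \<V> (q x) (q x') \<longleftrightarrow> pre (Y.U (F x')) \<subseteq> pre (Y.U (F x))"
  proof
    assume "cover_le \<V> (q x) (q x')"
    then obtain z z' where "z \<in> q x" "z' \<in> q x'" "cover_nbhd \<V> z' \<subseteq> cover_nbhd \<V> z"
      unfolding cover_le_def by blast
    then show "pre (Y.U (F x')) \<subseteq> pre (Y.U (F x))"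
      using nbhd[OF assms(1), of z] nbhd[OF assms(2), of z'] by simp
  next
    assume "pre (Y.U (F x')) \<subseteq> pre (Y.U (F x))"
    then have "cover_nbhd \<V> x' \<subseteq> cover_nbhd \<V> x" using cover_nbhd_eq assms by simp
    then show "cover_le \<V> (q x) (q x')" unfolding cover_le_def using self assms by blast
  qed
  then show ?thesis using pre_U_subset_iff[OF assms] by simp
qed

text \<open>In terms of points of \<open>X\<close>, the order of the quotient is the order of the images in \<open>Y\<close>.\<close>

lemma openin_Q:
  "openin (rs_top Q) G \<longleftrightarrow> G \<subseteq> q ` points X \<and>
    (\<forall>x\<in>points X. \<forall>x'\<in>points X. q x \<in> G \<and> F x' \<in> Y.U (F x) \<longrightarrow> q x' \<in> G)"
proof -
  have "openin (rs_top Q) G \<longleftrightarrow>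
      G \<subseteq> q ` points X \<and> (\<forall>c\<in>G. \<forall>c'\<in>q ` points X. cover_le \<V> c c' \<longrightarrow> c' \<in> G)"
    unfolding cover_space_def ringed_space.simps openin_up_set_topology by (rule refl)
  moreover have "(\<forall>c\<in>G. \<forall>c'\<in>q ` points X. cover_le \<V> c c' \<longrightarrow> c' \<in> G) \<longleftrightarrow>
      (\<forall>x\<in>points X. \<forall>x'\<in>points X. q x \<in> G \<and> F x' \<in> Y.U (F x) \<longrightarrow> q x' \<in> G)" (is "?L \<longleftrightarrow> ?R")
    if G: "G \<subseteq> q ` points X"
  proof
    assume L: ?L
    show ?R
    proof (intro ballI impI)
      fix x x' assume "x \<in> points X" "x' \<in> points X" "q x \<in> G \<and> F x' \<in> Y.U (F x)"
      then show "q x' \<in> G"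
        using L[THEN bspec, of "q x", THEN bspec, of "q x'", THEN mp] cover_le_iff by blast
    qed
  next
    assume R: ?R
    show ?L
    proof (intro ballI impI)
      fix c c' assume c: "c \<in> G" and c': "c' \<in> q ` points X" and le: "cover_le \<V> c c'"
      obtain x where x: "c = q x" "x \<in> points X" using subsetD[OF G c] by (rule imageE)
      obtain x' where x': "c' = q x'" "x' \<in> points X" using c' by (rule imageE)
      show "c' \<in> G"
        using R[THEN bspec, OF x(2), THEN bspec, OF x'(2), THEN mp] le c
        unfolding x(1) x'(1) cover_le_iff[OF x(2) x'(2)] by blast
    qed
  qed
  ultimately show ?thesis by (meson)
qed

lemma points_Q: "points Q = q ` points X"
proof
  show "points Q \<subseteq> q ` points X"
    by (rule openin_Q[THEN iffD1, THEN conjunct1, OF openin_topspace])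
  have "openin (rs_top Q) (q ` points X)"
    by (rule openin_Q[THEN iffD2]) simp
  then show "q ` points X \<subseteq> points Q" by (rule openin_subset)
qed

lemma Q_simps:
  "sec Q G = sec X (qre G)" "res Q G H = res X (qre G) (qre H)"
  by (simp_all add: cover_space_def)

lemma qre_image: "qre (q ` pre V) = pre V"
proof (rule Set.set_eqI)
  show "x \<in> qre (q ` pre V) \<longleftrightarrow> x \<in> pre V" for x
    using q_pre[of x V] mem_pre[of x V] unfolding preim_def[of _ q] by blast
qed

lemma image_qre: "G \<subseteq> q ` points X \<Longrightarrow> q ` qre G = G"
  by (auto simp: preim_def)

lemma qre_Int: "qre (G \<inter> H) = qre G \<inter> qre H"
  by (auto simp: preim_def)

lemma qre_Union: "qre (\<Union>\<G>) = \<Union>(qre ` \<G>)"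
  by (auto simp: preim_def)

lemma qre_open:
  assumes "openin (rs_top Q) G"
  shows "X.opn (qre G)"
proof -
  have "qre G = \<Union>((\<lambda>x. pre (Y.U (F x))) ` qre G)"
  proof
    show "qre G \<subseteq> \<Union>((\<lambda>x. pre (Y.U (F x))) ` qre G)" using mem_pre_U by (auto simp: preim_def[of _ q])
    show "\<Union>((\<lambda>x. pre (Y.U (F x))) ` qre G) \<subseteq> qre G"
      using assms unfolding openin_Q by (auto simp: preim_def[of _ q] mem_pre)
  qed
  moreover have "X.opn (\<Union>((\<lambda>x. pre (Y.U (F x))) ` qre G))"
    by (rule openin_Union) (auto simp: preim_def[of _ q] intro: pre_U_open)
  ultimately show ?thesis by simp
qed

lemma open_image_pre:
  assumes "Y.opn W" shows "openin (rs_top Q) (q ` pre W)"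
  unfolding openin_Q
proof (intro conjI ballI impI)
  fix x x' assume "x \<in> points X" "x' \<in> points X" "q x \<in> q ` pre W \<and> F x' \<in> Y.U (F x)"
  then show "q x' \<in> q ` pre W" using Y.min_open_least[OF assms] by (auto simp: q_pre)
qed (auto simp: mem_pre)

lemma min_open_Q:
  assumes x: "x \<in> points X"
  shows "min_open Q (q x) = q ` pre (Y.U (F x))"
proof
  show "min_open Q (q x) \<subseteq> q ` pre (Y.U (F x))"
    using open_image_pre[OF Y.open_min_open[OF F_points[OF x]]] mem_pre_U[OF x]
    unfolding min_open_def by blast
  show "q ` pre (Y.U (F x)) \<subseteq> min_open Q (q x)"
  proof
    fix c assume "c \<in> q ` pre (Y.U (F x))"
    then obtain x' where x': "c = q x'" "x' \<in> points X" "F x' \<in> Y.U (F x)" by (auto simp: mem_pre)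
    have "c \<in> G" if "openin (rs_top Q) G" "q x \<in> G" for G
      using openin_Q[THEN iffD1, OF that(1), THEN conjunct2] x x' that(2) by blast
    then show "c \<in> min_open Q (q x)" unfolding min_open_def by blast
  qed
qed

text \<open>The structure sheaf is a direct image. The projection is surjective, so that an open set of the
  quotient is determined by its preimage and gluing data can be carried over to \<open>X\<close>.\<close>

lemma finite_ringed_space_Q: "finite_ringed_space Q"
proof -
  have mono: "qre H \<subseteq> qre G" if "H \<subseteq> G" for G H using that by (auto simp: preim_def)
  have "is_sheaf (rs_top Q) (\<lambda>G. carrier (sec Q G)) (res Q)"
    unfolding is_sheaf_def Q_simps
  proof (intro conjI allI impI)
    fix \<G> assume \<G>: "\<forall>G\<in>\<G>. openin (rs_top Q) G"
    show "\<forall>s\<in>carrier (sec X (qre (\<Union>\<G>))). \<forall>t\<in>carrier (sec X (qre (\<Union>\<G>))).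
      (\<forall>G\<in>\<G>. res X (qre (\<Union>\<G>)) (qre G) s = res X (qre (\<Union>\<G>)) (qre G) t) \<longrightarrow> s = t"
    proof (intro ballI impI)
      fix s t assume "s \<in> carrier (sec X (qre (\<Union>\<G>)))" "t \<in> carrier (sec X (qre (\<Union>\<G>)))"
        "\<forall>G\<in>\<G>. res X (qre (\<Union>\<G>)) (qre G) s = res X (qre (\<Union>\<G>)) (qre G) t"
      then show "s = t"
        using \<G> unfolding qre_Union by (intro X.sections_eqI[of "qre ` \<G>" s t]) (auto intro: qre_open)
    qed
  next
    fix \<G> s assume *: "(\<forall>G\<in>\<G>. openin (rs_top Q) G) \<and> (\<forall>G\<in>\<G>. s G \<in> carrier (sec X (qre G))) \<and>
      (\<forall>G\<in>\<G>. \<forall>H\<in>\<G>. res X (qre G) (qre (G \<inter> H)) (s G) = res X (qre H) (qre (G \<inter> H)) (s H))"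
    have qq: "q ` qre G = G" if "G \<in> \<G>" for G
      using * that openin_Q[of G] by (intro image_qre) blast
    have "\<exists>t\<in>carrier (sec X (\<Union>(qre ` \<G>))). \<forall>V\<in>qre ` \<G>. res X (\<Union>(qre ` \<G>)) V t = s (q ` V)"
    proof (rule X.sections_glue)
      show "res X V (V \<inter> W) (s (q ` V)) = res X W (V \<inter> W) (s (q ` W))"
        if "V \<in> qre ` \<G>" "W \<in> qre ` \<G>" for V W
        using that * by (auto simp: qq simp flip: qre_Int)
    qed (use * in \<open>auto simp: qq intro: qre_open\<close>)
    then show "\<exists>t\<in>carrier (sec X (qre (\<Union>\<G>))). \<forall>G\<in>\<G>. res X (qre (\<Union>\<G>)) (qre G) t = s G"
      unfolding qre_Union by (auto simp: qq)
  qed (auto intro!: X.res_closed X.res_id X.res_res qre_open mono)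
  moreover have "finite (points Q)" using X.finite_points by (simp add: points_Q)
  ultimately show ?thesis
    unfolding finite_ringed_space_def is_ringed_space_def Q_simps
    by (auto intro!: X.cring_sec X.res_hom qre_open mono)
qed

sublocale Q: finite_space Q
  by unfold_locales (rule finite_ringed_space_Q)

text \<open>The stalk of the quotient at the class of \<open>x\<close> is \<open>O\<^sub>X(f\<^sup>-\<^sup>1(U\<^sub>f\<^sub>x))\<close>, so the two halves of the criterion
  are \<open>flat_pre\<close> and \<open>faithful_pre\<close>.\<close>

lemma faithful_to_stalks_Q:
  assumes W: "Y.opn W" "affine_space (open_subspace Y W)"
  shows "faithful_to_stalks Q (q ` pre W)"
  unfolding Q.faithful_to_stalks_iff[OF open_image_pre[OF W(1)]]
proof (intro conjI ballI allI impI)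
  fix c assume "c \<in> q ` pre W"
  then obtain x where x: "x \<in> points X" "F x \<in> W" "c = q x" by (auto simp: mem_pre)
  show "equationally_flat (sec Q (q ` pre W)) (module_along (res Q (q ` pre W) (Q.U c)) (sec Q (Q.U c)))"
    using flat_pre[OF W x(2)] by (simp add: x(3) min_open_Q[OF x(1)] Q_simps qre_image)
next
  fix I assume I: "ideal I (sec Q (q ` pre W))"
    and one: "\<forall>c\<in>q ` pre W. \<one>\<^bsub>sec Q (Q.U c)\<^esub> \<in> genideal (sec Q (Q.U c)) (res Q (q ` pre W) (Q.U c) ` I)"
  have "\<one>\<^bsub>sec X (pre W)\<^esub> \<in> I"
  proof (rule faithful_pre[OF W])
    show "ideal I (sec X (pre W))" using I by (simp add: Q_simps qre_image)
    fix x assume x: "x \<in> pre W"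
    then have "x \<in> points X" by (simp add: mem_pre)
    then show "\<one>\<^bsub>sec X (pre (Y.U (F x)))\<^esub> \<in>
      genideal (sec X (pre (Y.U (F x)))) (res X (pre W) (pre (Y.U (F x))) ` I)"
      using one[rule_format, OF imageI[OF x]] by (simp add: min_open_Q Q_simps qre_image)
  qed
  then show "\<one>\<^bsub>sec Q (q ` pre W)\<^esub> \<in> I" by (simp add: Q_simps qre_image)
qed

text \<open>The four rings involved are isomorphic, via the comorphisms, to those of \<open>Y\<close>.\<close>

lemma stalk_tensor_iso_Q:
  assumes W: "Y.opn W" and x: "x \<in> pre W" and x': "x' \<in> pre W"
    and iso: "stalk_tensor_iso_over Y W (F x) (F x')"
  shows "stalk_tensor_iso_over Q (q ` pre W) (q x) (q x')"
proof -
  let ?U = "Y.U (F x)" and ?U' = "Y.U (F x')"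
  have xX: "x \<in> points X" "x' \<in> points X" "F x \<in> W" "F x' \<in> W" using x x' by (auto simp: mem_pre)
  have o: "Y.opn ?U" "Y.opn ?U'" "Y.opn (?U \<inter> ?U')"
    by (intro openin_Int Y.open_min_open F_points xX(1,2))+
  have sub: "?U \<subseteq> W" "?U' \<subseteq> W" "?U \<inter> ?U' \<subseteq> W" "?U \<inter> ?U' \<subseteq> ?U" "?U \<inter> ?U' \<subseteq> ?U'"
    using xX(3,4) Y.min_open_least[OF W] by auto
  note po = pre_open[OF W] pre_open[OF o(1)] pre_open[OF o(2)] pre_open[OF o(3)]
  note ps = sub[THEN pre_mono]
  have Int: "qre (q ` pre ?U \<inter> q ` pre ?U') = pre (?U \<inter> ?U')"
    by (simp add: qre_Int qre_image pre_Int)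
  have surj: "comap f V ` carrier (sec Y V) = carrier (sec X (pre V))" if "Y.opn V" for V
    using comap_bij[OF that] by (simp add: bij_betw_def)
  show ?thesis
    using iso unfolding stalk_tensor_iso_over_def Let_def min_open_Q[OF xX(1)] min_open_Q[OF xX(2)]
      Q_simps qre_image Int
    by (rule tensor_iso_transfer[rotated -1, where \<sigma> = "comap f W" and u = "comap f ?U"
          and v = "comap f ?U'" and w = "comap f (?U \<inter> ?U')"])
      (use W o sub po ps in \<open>auto intro!: Y.cring_sec X.cring_sec Y.res_hom X.res_hom comap_hom
        comap_bij surj simp: Y.res_res X.res_res comap_res\<close>)
qed

lemma schematic_Q: "schematic_space Q"
proof -
  have "affine_space (open_subspace Q (q ` pre (Y.U (F x))))" if x: "x \<in> points X" for x
  proof -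
    let ?W = "Y.U (F x)"
    have W: "Y.opn ?W" by (rule Y.open_min_open[OF F_points[OF x]])
    note aff = affine_U[OF F_points[OF x]]
    show ?thesis
      unfolding Q.affine_open_subspace_iff[OF open_image_pre[OF W]]
    proof (intro conjI ballI)
      show "faithful_to_stalks Q (q ` pre ?W)" by (rule faithful_to_stalks_Q[OF W aff])
      fix c c' assume "c \<in> q ` pre ?W" "c' \<in> q ` pre ?W"
      then obtain z z' where z: "z \<in> pre ?W" "c = q z" "z' \<in> pre ?W" "c' = q z'" by blast
      then have zX: "z \<in> points X" "F z \<in> ?W" "z' \<in> points X" "F z' \<in> ?W" by (auto simp: mem_pre)
      have "stalk_tensor_iso_over Y ?W (F z) (F z')"
        using aff zX Y.affine_open_subspace_iff[OF W] by blast
      then show "stalk_tensor_iso_over Q (q ` pre ?W) c c'"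
        using z stalk_tensor_iso_Q[OF W] by simp
      let ?Z = "Y.U (F z) \<inter> Y.U (F z')"
      have "Y.opn ?Z" by (intro openin_Int Y.open_min_open F_points zX)
      then have "faithful_to_stalks Q (q ` pre ?Z)"
        using Y.affine_min_open_Int[OF W aff zX(2,4)] by (rule faithful_to_stalks_Q)
      moreover have "q ` pre ?Z = q ` pre (Y.U (F z)) \<inter> q ` pre (Y.U (F z'))"
      proof -
        have "qre (q ` pre (Y.U (F z)) \<inter> q ` pre (Y.U (F z'))) = pre ?Z"
          by (simp add: qre_Int qre_image pre_Int)
        moreover have "q ` pre (Y.U (F z)) \<subseteq> q ` points X" by (rule image_mono) (auto simp: mem_pre)
        ultimately show ?thesis
          using image_qre[of "q ` pre (Y.U (F z)) \<inter> q ` pre (Y.U (F z'))"]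
          by (metis le_infI1)
      qed
      ultimately show "faithful_to_stalks Q (Q.U c \<inter> Q.U c')"
        using z zX by (simp add: min_open_Q)
    qed
  qed
  moreover have "openin (rs_top Q) (q ` pre (Y.U (F x)))" if "x \<in> points X" for x
    using that by (intro open_image_pre Y.open_min_open F_points)
  moreover have "(\<Union>x\<in>points X. q ` pre (Y.U (F x))) = points Q"
    unfolding points_Q using mem_pre_U by (auto simp: mem_pre)
  ultimately have "affine_open_covering Q ((\<lambda>x. q ` pre (Y.U (F x))) ` points X)"
    unfolding affine_open_covering_def by blast
  then show ?thesis unfolding schematic_space_def using finite_ringed_space_Q by blast
qed

lemma projection_morphism: "rs_morphism X Q (cover_projection X \<V>)"
proof -
  have "continuous_map (rs_top X) (rs_top Q) q"
    using qre_open by (auto simp: continuous_map_def points_Q preim_def)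
  moreover have "(\<lambda>s. s) \<in> ring_hom R R" for R :: "'r ring" by (auto simp: ring_hom_def)
  ultimately show ?thesis
    by (simp add: rs_morphism_def cover_projection_def Q_simps)
qed

section \<open>The isomorphism with the complement of the removed points\<close>

definition point_map :: "'a set \<Rightarrow> 'b" where
  "point_map c = F (SOME x. x \<in> c)"

lemma point_map_q:
  assumes "x \<in> points X" shows "point_map (q x) = F x"
proof -
  have "x \<in> q x" using mem_q[OF assms, of x] assms by blast
  then have "(SOME x'. x' \<in> q x) \<in> q x" by (rule someI)
  then show ?thesis unfolding point_map_def using mem_q[OF assms] by blast
qed

abbreviation img where "img \<equiv> F ` points X"

lemma img_points: "img \<subseteq> points Y"
  using F_points by blast

lemma preim_point_map: "preim Q point_map V = q ` pre V"
proof (rule Set.set_eqI)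
  fix c
  show "c \<in> preim Q point_map V \<longleftrightarrow> c \<in> q ` pre V"
  proof
    assume "c \<in> preim Q point_map V"
    then obtain x where "x \<in> points X" "c = q x" "point_map c \<in> V"
      unfolding preim_def points_Q by blast
    then show "c \<in> q ` pre V" using point_map_q by (simp add: q_pre)
  next
    assume "c \<in> q ` pre V"
    then obtain x where "x \<in> points X" "c = q x" "F x \<in> V" by (auto simp: mem_pre)
    then show "c \<in> preim Q point_map V" unfolding preim_def points_Q using point_map_q by auto
  qed
qed

lemma qre_preim_point_map: "qre (preim Q point_map V) = pre V"
  by (simp add: preim_point_map qre_image)

lemma pre_Int_img: "pre (V \<inter> img) = pre V"
  by (auto simp: preim_def)

lemma point_map_homeomorphic: "homeomorphic_map (rs_top Q) (subtopology (rs_top Y) img) point_map"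
proof (rule bijective_open_imp_homeomorphic_map)
  have top: "topspace (subtopology (rs_top Y) img) = img" using img_points by auto
  show surj: "point_map ` topspace (rs_top Q) = topspace (subtopology (rs_top Y) img)"
    unfolding top points_Q image_image using point_map_q by auto
  show "continuous_map (rs_top Q) (subtopology (rs_top Y) img) point_map"
    unfolding continuous_map_def
  proof (intro conjI allI impI)
    show "point_map \<in> topspace (rs_top Q) \<rightarrow> topspace (subtopology (rs_top Y) img)" using surj by auto
    fix V assume "openin (subtopology (rs_top Y) img) V"
    then obtain W where "Y.opn W" "V = W \<inter> img" by (auto simp: openin_subtopology)
    moreover from this have "{c \<in> topspace (rs_top Q). point_map c \<in> V} = q ` pre W"
      using preim_point_map[of V] by (simp add: preim_def[of Q] pre_Int_img)
    ultimately show "openin (rs_top Q) {c \<in> topspace (rs_top Q). point_map c \<in> V}"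
      using open_image_pre by simp
  qed
  show "open_map (rs_top Q) (subtopology (rs_top Y) img) point_map"
    unfolding open_map_def
  proof (intro allI impI)
    fix G assume G: "openin (rs_top Q) G"
    let ?W = "\<Union>((\<lambda>x. Y.U (F x)) ` qre G)"
    have Gq: "q ` qre G = G" by (rule image_qre[OF openin_Q[THEN iffD1, THEN conjunct1, OF G]])
    have qX: "x \<in> points X" "q x \<in> G" if "x \<in> qre G" for x using that by (auto simp: preim_def[of X])
    have "Y.opn ?W" using qX(1) by (intro openin_Union) (auto intro: Y.open_min_open F_points)
    moreover have "point_map ` G = ?W \<inter> img"
    proof
      show "point_map ` G \<subseteq> ?W \<inter> img"
      proof
        fix y assume "y \<in> point_map ` G"
        then obtain c where c: "y = point_map c" "c \<in> G" by (rule imageE)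
        have "c \<in> q ` qre G" unfolding Gq by (rule c(2))
        then obtain x where x: "c = q x" "x \<in> qre G" by (rule imageE)
        have y: "y = F x" using point_map_q[OF qX(1)[OF x(2)]] c(1) x(1) by simp
        have "F x \<in> ?W" using x(2) Y.min_open_self by (rule UN_I)
        moreover have "F x \<in> img" using qX(1)[OF x(2)] by (rule imageI)
        ultimately show "y \<in> ?W \<inter> img" unfolding y by (rule IntI)
      qed
      show "?W \<inter> img \<subseteq> point_map ` G"
      proof
        fix y assume "y \<in> ?W \<inter> img"
        then obtain x x' where x: "x \<in> qre G" "y \<in> Y.U (F x)" "y = F x'" "x' \<in> points X" by blast
        have "q x' \<in> G"
          using openin_Q[THEN iffD1, OF G, THEN conjunct2] qX[OF x(1)] x by blast
        then have "point_map (q x') \<in> point_map ` G" by (rule imageI)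
        then show "y \<in> point_map ` G" unfolding point_map_q[OF x(4)] x(3) .
      qed
    qed
    ultimately show "openin (subtopology (rs_top Y) img) (point_map ` G)"
      by (auto simp: openin_subtopology)
  qed
  show "inj_on point_map (topspace (rs_top Q))"
    unfolding points_Q
  proof (rule inj_onI)
    fix c c' assume "c \<in> q ` points X" "c' \<in> q ` points X" and eq: "point_map c = point_map c'"
    then obtain x x' where "x \<in> points X" "c = q x" "x' \<in> points X" "c' = q x'" by blast
    then show "c = c'" using eq by (simp add: point_map_q q_eq_iff)
  qed
qed

abbreviation P where "P \<equiv> points Y - img"
abbreviation R where "R \<equiv> remove_points Y P"

lemma top_R: "rs_top R = subtopology (rs_top Y) img"
proof -
  have "points Y - P = img" using img_points by blast
  then show ?thesis by (simp add: remove_points_def)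
qed

lemma res_R: "res R V W s = restrict s W"
  by (simp add: remove_points_def)

lemma sec_R_simps:
  "s \<in> carrier (sec R V) \<longleftrightarrow> s \<in> (\<Pi>\<^sub>E y\<in>V. carrier (sec Y (Y.U y))) \<and>
    (\<forall>y\<in>V. \<forall>z\<in>V. Y.U z \<subseteq> Y.U y \<longrightarrow> res Y (Y.U y) (Y.U z) (s y) = s z)"
  "s \<otimes>\<^bsub>sec R V\<^esub> t = (\<lambda>y\<in>V. s y \<otimes>\<^bsub>sec Y (Y.U y)\<^esub> t y)"
  "s \<oplus>\<^bsub>sec R V\<^esub> t = (\<lambda>y\<in>V. s y \<oplus>\<^bsub>sec Y (Y.U y)\<^esub> t y)"
  "\<one>\<^bsub>sec R V\<^esub> = (\<lambda>y\<in>V. \<one>\<^bsub>sec Y (Y.U y)\<^esub>)"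
  by (auto simp: remove_points_def product_ring_def stalk_def)

definition stalk_inv :: "'b \<Rightarrow> 'r \<Rightarrow> 's" where
  "stalk_inv y = inv_into (carrier (sec Y (Y.U y))) (comap f (Y.U y))"

lemma stalk_inv_hom: "y \<in> points Y \<Longrightarrow> stalk_inv y \<in> ring_hom (sec X (pre (Y.U y))) (sec Y (Y.U y))"
  unfolding stalk_inv_def
  using ring_iso_set_sym[OF _ comap_iso[OF Y.open_min_open]] cring.axioms(1)[OF Y.cring_sec[OF Y.open_min_open]]
  by (auto simp: ring_iso_def)

lemma comap_stalk_inv:
  "y \<in> points Y \<Longrightarrow> t \<in> carrier (sec X (pre (Y.U y))) \<Longrightarrow> comap f (Y.U y) (stalk_inv y t) = t"
  unfolding stalk_inv_def using comap_bij[OF Y.open_min_open, of y]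
  by (simp add: bij_betw_def f_inv_into_f)

lemma stalk_inv_comap:
  "y \<in> points Y \<Longrightarrow> s \<in> carrier (sec Y (Y.U y)) \<Longrightarrow> stalk_inv y (comap f (Y.U y) s) = s"
  unfolding stalk_inv_def using comap_bij[OF Y.open_min_open, of y]
  by (simp add: bij_betw_def)

text \<open>The comorphism to be inverted: a section over \<open>f\<^sup>-\<^sup>1(V)\<close> is sent to its restrictions to the sets
  \<open>f\<^sup>-\<^sup>1(U\<^sub>y)\<close>, viewed as germs on \<open>Y\<close>. It is easier to define than its inverse, which glues.\<close>

definition germs :: "'b set \<Rightarrow> 'r \<Rightarrow> 'b \<Rightarrow> 's" where
  "germs V t = (\<lambda>y\<in>V. stalk_inv y (res X (pre V) (pre (Y.U y)) t))"

lemma open_R: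
  assumes "openin (rs_top R) V"
  shows "V \<subseteq> img" and "X.opn (pre V)" and "\<And>y. y \<in> V \<Longrightarrow> y \<in> points Y"
    and "\<And>y. y \<in> V \<Longrightarrow> X.opn (pre (Y.U y))" and "\<And>y. y \<in> V \<Longrightarrow> pre (Y.U y) \<subseteq> pre V"
    and "pre V = \<Union>((\<lambda>y. pre (Y.U y)) ` V)"
proof -
  obtain W where W: "Y.opn W" "V = W \<inter> img" using assms by (auto simp: top_R openin_subtopology)
  show img: "V \<subseteq> img" using W by blast
  have pre: "pre V = pre W" by (simp add: W(2) pre_Int_img)
  show "X.opn (pre V)" unfolding pre by (rule pre_open[OF W(1)])
  show pt: "y \<in> points Y" if "y \<in> V" for y using that img img_points by blast
  show "X.opn (pre (Y.U y))" if "y \<in> V" for y using pt[OF that] by (intro pre_open Y.open_min_open)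
  show sub: "pre (Y.U y) \<subseteq> pre V" if "y \<in> V" for y
    unfolding pre using that W by (intro pre_mono Y.min_open_least) auto
  have "pre V \<subseteq> \<Union>((\<lambda>y. pre (Y.U y)) ` V)"
  proof
    fix x assume "x \<in> pre V"
    then have "F x \<in> V" "x \<in> pre (Y.U (F x))" using mem_pre_U by (auto simp: mem_pre)
    then show "x \<in> \<Union>((\<lambda>y. pre (Y.U y)) ` V)" by blast
  qed
  then show "pre V = \<Union>((\<lambda>y. pre (Y.U y)) ` V)" using sub by blast
qed

text \<open>The sets \<open>f\<^sup>-\<^sup>1(U\<^sub>y)\<close> with \<open>y \<in> V\<close> cover \<open>f\<^sup>-\<^sup>1(V)\<close>, which gives injectivity. A compatible family of germs
  defines sections over these sets; they agree on \<open>f\<^sup>-\<^sup>1(U\<^sub>y) \<inter> f\<^sup>-\<^sup>1(U\<^sub>z)\<close> because this is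
  covered by the sets \<open>f\<^sup>-\<^sup>1(U\<^sub>w)\<close> with \<open>w\<close> in the image of \<open>f\<close> and above \<open>y\<close> and \<open>z\<close>, and so they glue.\<close>

lemma germs_ring_iso:
  assumes V: "openin (rs_top R) V"
  shows "germs V \<in> ring_iso (sec X (pre V)) (sec R V)"
proof -
  note o = open_R[OF V]
  have res_in: "res X (pre V) (pre (Y.U y)) t \<in> carrier (sec X (pre (Y.U y)))"
    if "y \<in> V" "t \<in> carrier (sec X (pre V))" for y t
    using that X.res_closed[OF o(2) o(4) o(5)] by blast
  note inv_hom = stalk_inv_hom[OF o(3)] and res_hom = X.res_hom[OF o(2,4,5)]
  have closed: "germs V t \<in> carrier (sec R V)" if t: "t \<in> carrier (sec X (pre V))" for t
    unfolding sec_R_simps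
  proof (intro conjI ballI impI)
    show "germs V t \<in> (\<Pi>\<^sub>E y\<in>V. carrier (sec Y (Y.U y)))"
      using t res_in ring_hom_closed[OF inv_hom] by (auto simp: germs_def)
    fix y z assume y: "y \<in> V" and z: "z \<in> V" and sub: "Y.U z \<subseteq> Y.U y"
    have oy: "Y.opn (Y.U y)" "Y.opn (Y.U z)" using o(3) y z by (auto intro: Y.open_min_open)
    have sy: "stalk_inv y (res X (pre V) (pre (Y.U y)) t) \<in> carrier (sec Y (Y.U y))"
      using ring_hom_closed[OF inv_hom[OF y] res_in[OF y t]] .
    have "comap f (Y.U z) (res Y (Y.U y) (Y.U z) (stalk_inv y (res X (pre V) (pre (Y.U y)) t))) =
        res X (pre (Y.U y)) (pre (Y.U z)) (res X (pre V) (pre (Y.U y)) t)"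
      using comap_res[OF oy sub sy] comap_stalk_inv[OF o(3)[OF y] res_in[OF y t]] by simp
    also have "\<dots> = res X (pre V) (pre (Y.U z)) t"
      by (rule X.res_res[OF o(2) o(4)[OF y] o(4)[OF z] pre_mono[OF sub] o(5)[OF y] t])
    finally have "stalk_inv z (comap f (Y.U z) (res Y (Y.U y) (Y.U z)
        (stalk_inv y (res X (pre V) (pre (Y.U y)) t)))) = stalk_inv z (res X (pre V) (pre (Y.U z)) t)"
      by simp
    then show "res Y (Y.U y) (Y.U z) (germs V t y) = germs V t z"
      using y z stalk_inv_comap[OF o(3)[OF z] Y.res_closed[OF oy sub sy]] by (simp add: germs_def)
  qed
  have hom: "germs V \<in> ring_hom (sec X (pre V)) (sec R V)"
  proof (rule ring_hom_memI)
    show "germs V (s \<otimes>\<^bsub>sec X (pre V)\<^esub> t) = germs V s \<otimes>\<^bsub>sec R V\<^esub> germs V t"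
      "germs V (s \<oplus>\<^bsub>sec X (pre V)\<^esub> t) = germs V s \<oplus>\<^bsub>sec R V\<^esub> germs V t"
      if "s \<in> carrier (sec X (pre V))" "t \<in> carrier (sec X (pre V))" for s t
      using that res_in
      by (auto simp: germs_def sec_R_simps(2-4) fun_eq_iff ring_hom_mult[OF res_hom] ring_hom_add[OF res_hom]
          ring_hom_mult[OF inv_hom] ring_hom_add[OF inv_hom])
    show "germs V \<one>\<^bsub>sec X (pre V)\<^esub> = \<one>\<^bsub>sec R V\<^esub>"
      by (auto simp: germs_def sec_R_simps(2-4) fun_eq_iff ring_hom_one[OF res_hom] ring_hom_one[OF inv_hom])
  qed (rule closed)
  let ?\<U> = "(\<lambda>y. pre (Y.U y)) ` V"
  have inj: "s = t"
    if st: "s \<in> carrier (sec X (pre V))" "t \<in> carrier (sec X (pre V))" and eq: "germs V s = germs V t" for s t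
  proof -
    have "res X (pre V) (pre (Y.U y)) s = res X (pre V) (pre (Y.U y)) t" if y: "y \<in> V" for y
    proof -
      have "germs V s y = germs V t y" using eq by simp
      then have "stalk_inv y (res X (pre V) (pre (Y.U y)) s) = stalk_inv y (res X (pre V) (pre (Y.U y)) t)"
        using y by (simp add: germs_def)
      then have "comap f (Y.U y) (stalk_inv y (res X (pre V) (pre (Y.U y)) s)) =
          comap f (Y.U y) (stalk_inv y (res X (pre V) (pre (Y.U y)) t))" by (rule arg_cong)
      then show ?thesis
        unfolding comap_stalk_inv[OF o(3)[OF y] res_in[OF y st(1)]]
          comap_stalk_inv[OF o(3)[OF y] res_in[OF y st(2)]] .
    qed
    then have "res X (\<Union>?\<U>) N s = res X (\<Union>?\<U>) N t" if "N \<in> ?\<U>" for N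
      using that o(6) by auto
    moreover have "s \<in> carrier (sec X (\<Union>?\<U>))" "t \<in> carrier (sec X (\<Union>?\<U>))" using st o(6) by simp_all
    ultimately show "s = t" using o(4) by (intro X.sections_eqI[of ?\<U> s t]) auto
  qed
  have surj: "\<exists>t\<in>carrier (sec X (pre V)). germs V t = s" if s: "s \<in> carrier (sec R V)" for s
  proof -
    have sy: "s y \<in> carrier (sec Y (Y.U y))" if "y \<in> V" for y
      using s that by (auto simp: sec_R_simps(1))
    have compat: "res Y (Y.U y) (Y.U z) (s y) = s z" if "y \<in> V" "z \<in> V" "Y.U z \<subseteq> Y.U y" for y z
      using s that by (auto simp: sec_R_simps(1))
    (* Gluing expects a family indexed by open sets; y is recovered from its open set by T0. *)
    define y_of where "y_of N = (SOME y. y \<in> V \<and> pre (Y.U y) = N)" for N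
    have inj_pre: "y = y'" if y: "y \<in> V" and y': "y' \<in> V" and eq: "pre (Y.U y) = pre (Y.U y')" for y y'
    proof -
      obtain x x' where x: "x \<in> points X" "y = F x" "x' \<in> points X" "y' = F x'"
        using y y' o(1) by blast
      have "F x \<in> Y.U (F x')" "F x' \<in> Y.U (F x)"
        using eq x mem_pre_U[OF x(1)] mem_pre_U[OF x(3)] mem_pre by blast+
      then show ?thesis unfolding x(2,4) by (intro t0_eq F_points x)
    qed
    have y_of: "y_of (pre (Y.U y)) = y" if y: "y \<in> V" for y
    proof -
      have "y_of (pre (Y.U y)) \<in> V \<and> pre (Y.U (y_of (pre (Y.U y)))) = pre (Y.U y)"
        unfolding y_of_def by (rule someI[of _ y]) (simp add: y)
      then show ?thesis using inj_pre y by blast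
    qed
    define g where "g N = comap f (Y.U (y_of N)) (s (y_of N))" for N
    have g: "g (pre (Y.U y)) = comap f (Y.U y) (s y)" if "y \<in> V" for y
      using y_of[OF that] by (simp add: g_def)
    have oU: "Y.opn (Y.U y)" if "y \<in> V" for y using o(3)[OF that] by (rule Y.open_min_open)
    have gc: "g (pre (Y.U y)) \<in> carrier (sec X (pre (Y.U y)))" if "y \<in> V" for y
      using g[OF that] ring_hom_closed[OF comap_hom[OF oU[OF that]] sy[OF that]] by simp
    have g_res: "res X (pre (Y.U y)) (pre (Y.U z)) (g (pre (Y.U y))) = g (pre (Y.U z))"
      if y: "y \<in> V" and z: "z \<in> V" and sub: "Y.U z \<subseteq> Y.U y" for y z
      using comap_res[OF oU[OF y] oU[OF z] sub sy[OF y]] compat[OF y z sub] g[OF y] g[OF z] by simp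
    have "\<exists>t\<in>carrier (sec X (\<Union>?\<U>)). \<forall>N\<in>?\<U>. res X (\<Union>?\<U>) N t = g N"
    proof (rule X.sections_glue)
      fix N N' assume "N \<in> ?\<U>" "N' \<in> ?\<U>"
      then obtain y y' where y: "y \<in> V" "N = pre (Y.U y)" "y' \<in> V" "N' = pre (Y.U y')" by blast
      note oN = o(4)[OF y(1), folded y(2)] o(4)[OF y(3), folded y(4)]
      have oI: "X.opn (N \<inter> N')" using oN by (rule openin_Int)
      let ?\<W> = "(\<lambda>x. pre (Y.U (F x))) ` (N \<inter> N')"
      have x: "x \<in> points X" "F x \<in> V" "Y.U (F x) \<subseteq> Y.U y" "Y.U (F x) \<subseteq> Y.U y'" if "x \<in> N \<inter> N'" for x
      proof -
        show "x \<in> points X" using that y by (auto simp: mem_pre)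
        show "F x \<in> V" using that o(5)[OF y(1)] y(2) mem_pre by blast
        show "Y.U (F x) \<subseteq> Y.U y" "Y.U (F x) \<subseteq> Y.U y'"
        proof -
          have "F x \<in> Y.U y" "F x \<in> Y.U y'" using that by (simp_all add: y(2,4) mem_pre)
          then show "Y.U (F x) \<subseteq> Y.U y" "Y.U (F x) \<subseteq> Y.U y'"
            by (simp_all add: Y.min_open_mono o(3) y(1,3))
        qed
      qed
      have sub: "pre (Y.U (F x)) \<subseteq> N \<inter> N'" if "x \<in> N \<inter> N'" for x
        using pre_mono[OF x(3)[OF that]] pre_mono[OF x(4)[OF that]] y by blast
      have un: "\<Union>?\<W> = N \<inter> N'"
      proof
        show "\<Union>?\<W> \<subseteq> N \<inter> N'" using sub by blast
        show "N \<inter> N' \<subseteq> \<Union>?\<W>" using mem_pre_U x(1) by blast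
      qed
      have gN: "g N \<in> carrier (sec X N)" "g N' \<in> carrier (sec X N')" using gc y by auto
      have agree: "res X (\<Union>?\<W>) M (res X N (N \<inter> N') (g N)) = res X (\<Union>?\<W>) M (res X N' (N \<inter> N') (g N'))"
        if "M \<in> ?\<W>" for M
      proof -
        obtain x' where x': "x' \<in> N \<inter> N'" "M = pre (Y.U (F x'))" using \<open>M \<in> ?\<W>\<close> by blast
        note xs = x[OF x'(1)]
        have oM: "X.opn M" using x'(2) o(4)[OF xs(2)] by simp
        have M: "M \<subseteq> N \<inter> N'" using sub[OF x'(1)] x'(2) by simp
        have "res X (N \<inter> N') M (res X N (N \<inter> N') (g N)) = res X N M (g N)"
          by (rule X.res_res[OF oN(1) oI oM M _ gN(1)]) simp
        also have "\<dots> = g M" using g_res[OF y(1) xs(2,3)] y x' by simp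
        also have "\<dots> = res X N' M (g N')" using g_res[OF y(3) xs(2,4)] y x' by simp
        also have "\<dots> = res X (N \<inter> N') M (res X N' (N \<inter> N') (g N'))"
          by (rule X.res_res[OF oN(2) oI oM M _ gN(2), symmetric]) simp
        finally show ?thesis unfolding un .
      qed
      have mem: "res X N (N \<inter> N') (g N) \<in> carrier (sec X (\<Union>?\<W>))"
        "res X N' (N \<inter> N') (g N') \<in> carrier (sec X (\<Union>?\<W>))"
        unfolding un by (rule X.res_closed[OF oN(1) oI _ gN(1)], simp) (rule X.res_closed[OF oN(2) oI _ gN(2)], simp)
      have op: "X.opn M" if "M \<in> ?\<W>" for M using that x(2) o(4) by auto
      show "res X N (N \<inter> N') (g N) = res X N' (N \<inter> N') (g N')"
        by (rule X.sections_eqI[of ?\<W>, OF op mem agree])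
    qed (use o(4) gc in auto)
    then obtain t where t: "t \<in> carrier (sec X (pre V))"
      "\<And>y. y \<in> V \<Longrightarrow> res X (pre V) (pre (Y.U y)) t = g (pre (Y.U y))"
      using o(6) by auto
    have "germs V t = s"
    proof
      fix y
      show "germs V t y = s y"
      proof (cases "y \<in> V")
        case True
        then show ?thesis using t(2) g stalk_inv_comap[OF o(3) sy] by (simp add: germs_def)
      next
        case False
        then show ?thesis using s by (auto simp: germs_def sec_R_simps(1) PiE_iff extensional_def)
      qed
    qed
    then show ?thesis using t(1) by blast
  qed
  have "bij_betw (germs V) (carrier (sec X (pre V))) (carrier (sec R V))"
    unfolding bij_betw_def
  proof
    show "inj_on (germs V) (carrier (sec X (pre V)))" using inj by (rule inj_onI)
    show "germs V ` carrier (sec X (pre V)) = carrier (sec R V)" using closed surj by blast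
  qed
  then show ?thesis using hom by (simp add: ring_iso_def)
qed

definition quotient_iso :: "('a set, 'r, 'b, 'b \<Rightarrow> 's) rs_map" where
  "quotient_iso = \<lparr>pmap = point_map, comap = (\<lambda>V. inv_into (carrier (sec X (pre V))) (germs V))\<rparr>"

lemma quotient_iso_comap:
  assumes V: "openin (rs_top R) V"
  shows "comap quotient_iso V \<in> ring_iso (sec R V) (sec X (pre V))"
    and "\<And>t. t \<in> carrier (sec X (pre V)) \<Longrightarrow> comap quotient_iso V (germs V t) = t"
    and "\<And>s. s \<in> carrier (sec R V) \<Longrightarrow> germs V (comap quotient_iso V s) = s"
proof -
  have iso: "germs V \<in> ring_iso (sec X (pre V)) (sec R V)" by (rule germs_ring_iso[OF V])
  have "ring (sec X (pre V))" using X.cring_sec[OF open_R(2)[OF V]] by (simp add: cring_def)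
  then show "comap quotient_iso V \<in> ring_iso (sec R V) (sec X (pre V))"
    unfolding quotient_iso_def using ring_iso_set_sym[OF _ iso] by simp
  have bij: "bij_betw (germs V) (carrier (sec X (pre V))) (carrier (sec R V))"
    using iso by (simp add: ring_iso_def)
  show "comap quotient_iso V (germs V t) = t" if "t \<in> carrier (sec X (pre V))" for t
    using that bij by (simp add: quotient_iso_def bij_betw_def)
  show "germs V (comap quotient_iso V s) = s" if "s \<in> carrier (sec R V)" for s
    using that bij by (simp add: quotient_iso_def bij_betw_def f_inv_into_f)
qed

lemma germs_res:
  assumes V: "openin (rs_top R) V" and W: "openin (rs_top R) W" and sub: "W \<subseteq> V"
    and t: "t \<in> carrier (sec X (pre V))"
  shows "germs W (res X (pre V) (pre W) t) = restrict (germs V t) W"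
proof
  fix y
  show "germs W (res X (pre V) (pre W) t) y = restrict (germs V t) W y"
  proof (cases "y \<in> W")
    case True
    have "res X (pre W) (pre (Y.U y)) (res X (pre V) (pre W) t) = res X (pre V) (pre (Y.U y)) t"
      by (rule X.res_res[OF open_R(2)[OF V] open_R(2)[OF W] open_R(4)[OF W True] open_R(5)[OF W True]
            pre_mono[OF sub] t])
    then show ?thesis using True sub by (auto simp: germs_def)
  qed (simp add: germs_def)
qed

theorem quotient_iso_isomorphism: "rs_isomorphism Q R quotient_iso"
proof -
  have pm: "pmap quotient_iso = point_map" by (simp add: quotient_iso_def)
  have sec_eq: "sec Q (preim Q point_map V) = sec X (pre V)" for V
    by (simp add: Q_simps qre_preim_point_map)
  have res_eq: "res Q (preim Q point_map V) (preim Q point_map W) = res X (pre V) (pre W)" for V W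
    using Q_simps(2) by (simp add: fun_eq_iff qre_preim_point_map)
  have homeo: "homeomorphic_map (rs_top Q) (rs_top R) point_map"
    unfolding top_R by (rule point_map_homeomorphic)
  have nat: "comap quotient_iso W (res R V W s) = res X (pre V) (pre W) (comap quotient_iso V s)"
    if V: "openin (rs_top R) V" and W: "openin (rs_top R) W" and sub: "W \<subseteq> V"
      and s: "s \<in> carrier (sec R V)" for V W s
  proof -
    let ?t = "comap quotient_iso V s"
    have t: "?t \<in> carrier (sec X (pre V))"
      using ring_iso_memE(1)[OF quotient_iso_comap(1)[OF V]] s by blast
    have "germs W (res X (pre V) (pre W) ?t) = restrict (germs V ?t) W"
      by (rule germs_res[OF V W sub t])
    also have "\<dots> = res R V W s" using quotient_iso_comap(3)[OF V s] by (simp add: res_R)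
    finally show ?thesis
      using quotient_iso_comap(2)[OF W X.res_closed[OF open_R(2)[OF V] open_R(2)[OF W] pre_mono[OF sub] t]]
      by simp
  qed
  show ?thesis
    unfolding rs_isomorphism_def rs_morphism_def pm sec_eq res_eq
    using homeo homeomorphic_imp_continuous_map[OF homeo] quotient_iso_comap(1) nat
    by (auto simp: ring_iso_def)
qed

lemma quotient_iso_factorization:
  "rs_map_eq X Y f
    (rs_comp R (remove_points_inclusion Y P) (rs_comp Q quotient_iso (cover_projection X \<V>)))"
proof -
  let ?g = "rs_comp R (remove_points_inclusion Y P) (rs_comp Q quotient_iso (cover_projection X \<V>))"
  have "pmap f x = pmap ?g x" if "x \<in> points X" for x
    using point_map_q[OF that]
    by (simp add: rs_comp_def remove_points_inclusion_def quotient_iso_def cover_projection_def)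
  moreover have "comap f W s = comap ?g W s" if W: "Y.opn W" and s: "s \<in> carrier (sec Y W)" for W s
  proof -
    have pR: "points R = img" unfolding top_R using img_points by auto
    have VW: "W - P = W \<inter> img" using Y.open_subset[OF W] by blast
    have pi: "preim R (\<lambda>y. y) W = W \<inter> img" unfolding preim_def pR by auto
    let ?V = "W \<inter> img"
    have V: "openin (rs_top R) ?V" unfolding top_R using W by (auto simp: openin_subtopology)
    have preV: "pre ?V = pre W" by (rule pre_Int_img)
    let ?t = "comap f W s"
    have t: "?t \<in> carrier (sec X (pre ?V))"
      unfolding preV by (rule ring_hom_closed[OF comap_hom[OF W] s])
    have "germs ?V ?t = to_stalks Y W ?V s"
    proof
      fix y
      show "germs ?V ?t y = to_stalks Y W ?V s y"
      proof (cases "y \<in> ?V")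
        case True
        then have y: "y \<in> points Y" "Y.U y \<subseteq> W" using img_points Y.min_open_least[OF W] by auto
        note oU = Y.open_min_open[OF y(1)]
        have "res X (pre W) (pre (Y.U y)) ?t = comap f (Y.U y) (res Y W (Y.U y) s)"
          by (rule comap_res[OF W oU y(2) s, symmetric])
        then show ?thesis
          using True stalk_inv_comap[OF y(1) Y.res_closed[OF W oU y(2) s]]
          by (simp add: germs_def to_stalks_def preV)
      qed (auto simp: germs_def to_stalks_def)
    qed
    then have "comap quotient_iso ?V (to_stalks Y W ?V s) = ?t"
      using quotient_iso_comap(2)[OF V t] by simp
    then show ?thesis
      by (simp add: rs_comp_def remove_points_inclusion_def cover_projection_def pi VW)
  qed
  ultimately show ?thesis unfolding rs_map_eq_def by blast
qed

text \<open>When no point is removed the comorphisms of \<open>f\<close> themselves serve, with sections of \<open>Y\<close> in place of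
  families of germs.\<close>

lemma surjective_isomorphism:
  assumes surj: "img = points Y"
  shows "rs_isomorphism Q Y \<lparr>pmap = point_map, comap = comap f\<rparr>"
    and "rs_map_eq X Y f (rs_comp Q \<lparr>pmap = point_map, comap = comap f\<rparr> (cover_projection X \<V>))"
proof -
  have sec_eq: "sec Q (preim Q point_map V) = sec X (pre V)" for V
    by (simp add: Q_simps qre_preim_point_map)
  have res_eq: "res Q (preim Q point_map V) (preim Q point_map W) = res X (pre V) (pre W)" for V W
    using Q_simps(2) by (simp add: fun_eq_iff qre_preim_point_map)
  have homeo: "homeomorphic_map (rs_top Q) (rs_top Y) point_map"
    using point_map_homeomorphic unfolding surj subtopology_topspace .
  show "rs_isomorphism Q Y \<lparr>pmap = point_map, comap = comap f\<rparr>"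
    unfolding rs_isomorphism_def rs_morphism_def rs_map.simps sec_eq res_eq
    using homeo homeomorphic_imp_continuous_map[OF homeo] comap_iso comap_hom comap_res by simp
  show "rs_map_eq X Y f (rs_comp Q \<lparr>pmap = point_map, comap = comap f\<rparr> (cover_projection X \<V>))"
    using point_map_q by (simp add: rs_map_eq_def rs_comp_def cover_projection_def)
qed

end

theorem theorem9p15:
  fixes X :: "('a, 'r) ringed_space" and Y :: "('b, 's) ringed_space"
    and f :: "('a, 'r, 'b, 's) rs_map"
  assumes "schematic_space X" and "schematic_space Y"
    and "quasi_isomorphism X Y f"
  shows
    "(t0_space (rs_top Y) \<longrightarrow>
       (let \<V> = preimage_cover X Y f; Q = cover_space X \<V>; \<pi> = cover_projection X \<V> in
          affine_open_covering X \<V> \<and>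
          schematic_space Q \<and> rs_morphism X Q \<pi> \<and>
          (\<exists>P. (\<forall>p\<in>P. removable Y p) \<and>
             (\<exists>f'. rs_isomorphism Q (remove_points Y P) f' \<and>
                (\<forall>x\<in>points X. pmap f' (cover_class X \<V> x) = pmap f x) \<and>
                rs_map_eq X Y f
                  (rs_comp (remove_points Y P) (remove_points_inclusion Y P)
                    (rs_comp Q f' \<pi>))))))
     \<and>
     (minimal_space Y \<longrightarrow>
       (let \<V> = preimage_cover X Y f; Q = cover_space X \<V>; \<pi> = cover_projection X \<V> in
          \<exists>f'. rs_isomorphism Q Y f' \<and> rs_map_eq X Y f (rs_comp Q f' \<pi>)))"
proof -
  have qi: "quasi_iso X Y f" if "t0_space (rs_top Y)"
  proof
    show "finite_ringed_space X" "finite_ringed_space Y" "schematic_space Y"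
      using assms(1,2) by (simp_all add: schematic_space_def)
    show "rs_morphism X Y f" using assms(3) by (simp add: quasi_isomorphism_def affine_morphism_def)
    show "t0_space (rs_top Y)" by (rule that)
    fix V assume "openin (rs_top Y) V"
    then show "comap f V \<in> ring_iso (sec Y V) (sec X (preim X (pmap f) V))"
      and "affine_space (open_subspace Y V) \<Longrightarrow> affine_space (open_subspace X (preim X (pmap f) V))"
      using assms(3) by (simp_all add: quasi_isomorphism_def affine_morphism_def)
  qed
  show ?thesis
  proof (intro conjI impI)
    assume t0: "t0_space (rs_top Y)"
    interpret quasi_iso X Y f by (rule qi[OF t0])
    have "\<forall>p\<in>P. removable Y p" using removable_outside_image by blast
    moreover have "\<forall>x\<in>points X. pmap quotient_iso (q x) = F x"
      using point_map_q by (simp add: quotient_iso_def)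
    ultimately show "let \<V> = preimage_cover X Y f; Q = cover_space X \<V>; \<pi> = cover_projection X \<V> in
          affine_open_covering X \<V> \<and> schematic_space Q \<and> rs_morphism X Q \<pi> \<and>
          (\<exists>P. (\<forall>p\<in>P. removable Y p) \<and>
             (\<exists>f'. rs_isomorphism Q (remove_points Y P) f' \<and>
                (\<forall>x\<in>points X. pmap f' (cover_class X \<V> x) = pmap f x) \<and>
                rs_map_eq X Y f
                  (rs_comp (remove_points Y P) (remove_points_inclusion Y P)
                    (rs_comp Q f' \<pi>))))"
      unfolding Let_def
      using affine_covering schematic_Q projection_morphism quotient_iso_isomorphism
        quotient_iso_factorization by blast
  next
    assume min: "minimal_space Y"
    then interpret quasi_iso X Y f by (intro qi) (simp add: minimal_space_def)
    have "img = points Y"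
      using min removable_outside_image img_points unfolding minimal_space_def by blast
    from surjective_isomorphism[OF this]
    show "let \<V> = preimage_cover X Y f; Q = cover_space X \<V>; \<pi> = cover_projection X \<V> in
          \<exists>f'. rs_isomorphism Q Y f' \<and> rs_map_eq X Y f (rs_comp Q f' \<pi>)"
      unfolding Let_def by blast
  qed
qed

end
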